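(* Let $N\ge1$ and let $\psi$ be a Dirichlet character modulo $N$. Let $A_F(m_1,m_2)$ and $A_{\tilde F}(m_1,m_2)$ be complex numbers indexed by positive integers, such that $A_F(m,n)=\psi(m)\psi(n)A_{\tilde F}(n,m)$ whenever $(mn,N)=1$, and such that the Hecke relations $$A_F(1,m)A_F(n_2,n_1)=\sum_{\substack{abc=m\\ b\mid n_1,\ c\mid n_2}}A_F\Big(\frac{bn_2}{c},\frac{an_1}{b}\Big)\psi(c),\qquad A_{\tilde F}(1,m)A_{\tilde F}(n_2,n_1)=\sum_{\substack{abc=m\\ b\mid n_1,\ c\mid n_2}}A_{\tilde F}\Big(\frac{bn_2}{c},\frac{an_1}{b}\Big)\bar\psi(c)$$ hold for all positive integers $m,n_1,n_2$ with $(n_1n_2,N)=1$. Let $G_+,G_-$ be functions of $s$, and assume that for every primitive Dirichlet character $\chi^*$ modulo $c^*$ with $(c^*,N)=1$, $$L(s,F\times\chi^* )=G_\pm(s)\psi(c^* )\chi^*(N)(c^* )^{-3s}\tau(\chi^* )^3L(1-s,\tilde F\times\overline{\chi^*}),$$ where $L(s,F\times\chi^* )=\sum_{n\ge1}A_F(1,n)\chi^*(n)n^{-s}$, $L(s,\tilde F\times\overline{\chi^*})=\sum_{n\ge1}A_{\tilde F}(1,n)\overline{\chi^*}(n)n^{-s}$, and $G_\pm=G_+$ if $\chi^*(-1)=1$, $G_\pm=G_-$ if $\chi^*(-1)=-1$. Let $c$ and $q$ be positive integers with $(c,N)=(q,N)=1$, let $a$ be an integer with $(a,c)=1$, and let $\bar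 a,\bar N$ be multiplicative inverses of $a,N$ modulo $c$. Then $$\sum_{n=1}^\infty\frac{A_F(q,n)}{n^s}e\Big(\frac{\bar an}{c}\Big)=c\,\psi(cq)\sum_{\pm}\sum_{m_2=1}^\infty\sum_{m_1\mid cq}\frac{G_+(s)\mp G_-(s)}{2}\,\frac{A_{\tilde F}(m_1,m_2)}{m_1m_2}\,S\Big(\pm\bar Nqa,m_2;\frac{cq}{m_1}\Big)\Big(\frac{m_1^2m_2}{c^3q}\Big)^s,$$ where the Dirichlet series on the left converges for $\mathrm{Re}\,s$ large, the one on the right for $-\mathrm{Re}\,s$ large, and both have analytic continuation to all of $\mathbb C$.
   Context: $e(x)=\exp(2\pi ix)$. For a Dirichlet character $\chi^*$ mod $c^*$, $\tau(\chi^* )=\sum_{u\bmod c^*}\chi^*(u)e(u/c^* )$. For integers $u,v$ and positive $C$, $S(u,v;C)=\sum_{D\bmod C,(D,C)=1}e\big(\frac{uD+v\bar D}{C}\big)$ with $D\bar D\equiv1\pmod C$. In the sum $\sum_{m_1\mid cq}$, $m_1$ runs over positive divisors. *)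

theory Defs
  imports "HOL-Complex_Analysis.Complex_Analysis" "HOL-Number_Theory.Number_Theory"
begin

definition additive_char :: "real \<Rightarrow> complex" where
  "additive_char x = exp (2 * complex_of_real pi * \<i> * complex_of_real x)"

definition dirichlet_character :: "nat \<Rightarrow> (int \<Rightarrow> complex) \<Rightarrow> bool" where
  "dirichlet_character N chi \<longleftrightarrow>
     N \<ge> 1 \<and>
     (\<forall>x y. chi (x * y) = chi x * chi y) \<and>
     (\<forall>x. chi (x + int N) = chi x) \<and>
     (\<forall>x. chi x \<noteq> 0 \<longleftrightarrow> coprime x (int N))"

text \<open>Primitive: not induced by a character of a proper divisor of the modulus.
  The trivial character modulo 1 is primitive.\<close>

definition primitive_dirichlet_character :: "nat \<Rightarrow> (int \<Rightarrow> complex) \<Rightarrow> bool" where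
  "primitive_dirichlet_character c chi \<longleftrightarrow>
     dirichlet_character c chi \<and>
     \<not> (\<exists>d chi'. d dvd c \<and> d < c \<and> dirichlet_character d chi' \<and>
            (\<forall>x. coprime x (int c) \<longrightarrow> chi x = chi' x))"

definition gauss_sum :: "nat \<Rightarrow> (int \<Rightarrow> complex) \<Rightarrow> complex" where
  "gauss_sum c chi = (\<Sum>u\<in>{0..<int c}. chi u * additive_char (real_of_int u / real c))"

definition kloosterman_sum :: "int \<Rightarrow> int \<Rightarrow> nat \<Rightarrow> complex" where
  "kloosterman_sum u v C =
     (\<Sum>D | D \<in> {0..<int C} \<and> coprime D (int C).
        additive_char (real_of_int (u * D + v * modular_inverse (int C) D) / real C))"

text \<open>Coefficient families are functions on pairs of natural numbers of which only the
  values at positive arguments are ever used; the two divisions below are exact.\<close>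

definition hecke_relations :: "nat \<Rightarrow> (int \<Rightarrow> complex) \<Rightarrow> (nat \<Rightarrow> nat \<Rightarrow> complex) \<Rightarrow> bool" where
  "hecke_relations N \<psi> A \<longleftrightarrow>
     (\<forall>m n1 n2. m > 0 \<longrightarrow> n1 > 0 \<longrightarrow> n2 > 0 \<longrightarrow> coprime (n1 * n2) N \<longrightarrow>
        A 1 m * A n2 n1 =
          (\<Sum>(a, b, c) | a * b * c = m \<and> b dvd n1 \<and> c dvd n2.
             A (b * n2 div c) (a * n1 div b) * \<psi> (int c)))"

text \<open>The Dirichlet series with coefficients \<open>f 1, f 2, \<dots>\<close> converges in some right
  half-plane, and the entire function \<open>\<Phi>\<close> is its (unique) analytic continuation.\<close>

definition dirichlet_series_continuation :: "(nat \<Rightarrow> complex) \<Rightarrow> (complex \<Rightarrow> complex) \<Rightarrow> bool" where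
  "dirichlet_series_continuation f \<Phi> \<longleftrightarrow>
     \<Phi> holomorphic_on UNIV \<and>
     (\<exists>\<sigma>::real. \<forall>s. Re s > \<sigma> \<longrightarrow> (\<lambda>k. f (Suc k) / of_nat (Suc k) powr s) sums \<Phi> s)"

text \<open>The functional equations of all twists by primitive characters of conductor prime to
  \<open>N\<close>, as identities between the analytically continued \<open>L\<close>-functions.  The set \<open>P\<close>
  consists of points at which the factors \<open>Gp\<close> and \<open>Gm\<close> need not be defined (for instance
  their poles); no identity is required there.\<close>

definition twisted_functional_equations ::
  "nat \<Rightarrow> (int \<Rightarrow> complex) \<Rightarrow> complex set \<Rightarrow> (complex \<Rightarrow> complex) \<Rightarrow> (complex \<Rightarrow> complex) \<Rightarrow>
   (nat \<Rightarrow> nat \<Rightarrow> complex) \<Rightarrow> (nat \<Rightarrow> nat \<Rightarrow> complex) \<Rightarrow> bool" where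
  "twisted_functional_equations N \<psi> P Gp Gm A At \<longleftrightarrow>
     (\<forall>c chi. primitive_dirichlet_character c chi \<longrightarrow> coprime c N \<longrightarrow>
        (\<exists>L Lt.
           dirichlet_series_continuation (\<lambda>n. A 1 n * chi (int n)) L \<and>
           dirichlet_series_continuation (\<lambda>n. At 1 n * cnj (chi (int n))) Lt \<and>
           (\<forall>s. s \<notin> P \<longrightarrow>
              L s = (if chi (- 1) = 1 then Gp s else Gm s) * \<psi> (int c) * chi (int N) *
                    of_nat c powr (- 3 * s) * gauss_sum c chi ^ 3 * Lt (1 - s))))"

text \<open>The sign \<open>\<epsilon>\<close> is 1 or -1; \<open>Nbar\<close> and \<open>a\<close> matter only modulo \<open>c\<close>.\<close>

definition dual_term ::
  "(nat \<Rightarrow> nat \<Rightarrow> complex) \<Rightarrow> nat \<Rightarrow> nat \<Rightarrow> int \<Rightarrow> int \<Rightarrow> int \<Rightarrow> complex \<Rightarrow> nat \<Rightarrow> complex" where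
  "dual_term At c q a Nbar \<epsilon> s m2 =
     (\<Sum>m1 | m1 dvd c * q.
        At m1 m2 / (of_nat m1 * of_nat m2) *
        kloosterman_sum (\<epsilon> * Nbar * int q * a) (int m2) (c * q div m1) *
        complex_of_real (real (m1\<^sup>2 * m2) / real (c ^ 3 * q)) powr s)"

end

(*
  Hecke's relations can be inverted: A(q, d m) is a finite combination, with Moebius coefficients, of
  products A(1, m') A(q', d').  Hence, for chi primitive of conductor c and modulus c l, the series
  sum_n A(q, n) g(chi, n) n^(-s) weighted by Gauss sums is a Dirichlet polynomial times
  L(s, F x cnj chi), which continues it and carries the functional equation.  On the dual side
  L(1 - s, F~ x chi) A~(x, y) is expanded by the Hecke relations into the finitely many series
  U(x, y) = sum_n A~(x, n y) chi(n) n^(s - 1); Moebius inversion collapses the sum over the divisors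
  of l, and what is left agrees, after a change of variables, with the average of the Kloosterman
  side over chi, which is a product of two Gauss sums.  Finally the indicator of 1 on the units
  modulo c is a combination of characters, so both sides are recovered from these averages.
*)
theory Submission
  imports Defs
begin

subsection \<open>Additive characters and sums over residues\<close>

text \<open>A modulus is written as conductor times l, where l may share factors with the conductor
  and with q, so nothing splits into local factors. Induced Gauss sums are therefore kept as divisor
  sums over l. Their terms live on multiples of d, and this is why A(q, d m) has to be expressed
  through A(1, m'). The cube of tau(cnj chi) in the functional equation is spent as follows. The
  Gauss weight on the left contributes tau(chi), which together with one of the three factors gives
  chi(-1) times the conductor; the other two are exactly those that come out of averaging
  Kloosterman sums. The left-over sign explains the combinations of G+ and G-: for either parity
  chi(-1) G = (G+ - G-)/2 + chi(-1) (G+ + G-)/2, and chi(-1) can be absorbed into the first argument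
  of the Kloosterman sum. No contour is moved. Continuation is inherited from the L-functions, and
  the identity is checked only where the dual series converge absolutely; convergence at one point
  bounds the coefficients polynomially and so provides such a half-plane.\<close>

lemma additive_char_add: "additive_char (x + y) = additive_char x * additive_char y"
  by (simp add: additive_char_def exp_add [symmetric] algebra_simps)

lemma additive_char_of_int [simp]: "additive_char (real_of_int k) = 1"
  by (simp add: additive_char_def exp_eq_1 mult.commute)

lemma additive_char_0 [simp]: "additive_char 0 = 1"
  by (simp add: additive_char_def)

lemma additive_char_nonzero [simp]: "additive_char x \<noteq> 0"
  by (simp add: additive_char_def)

lemma additive_char_power: "additive_char x ^ n = additive_char (real n * x)"
  by (simp add: additive_char_def exp_of_nat_mult [symmetric] algebra_simps)

lemma additive_char_eq_1_iff: "additive_char x = 1 \<longleftrightarrow> x \<in> \<int>"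
  by (auto simp: additive_char_def exp_eq_1 Ints_def)

lemma additive_char_cong:
  assumes "[k = l] (mod int c)" "c > 0"
  shows "additive_char (real_of_int k / real c) = additive_char (real_of_int l / real c)"
proof -
  from assms(1) obtain t where "k = l + int c * t"
    by (metis cong_iff_lin cong_sym)
  then have "real_of_int k / real c = real_of_int l / real c + real_of_int t"
    using assms(2) by (simp add: field_simps)
  then show ?thesis
    by (simp add: additive_char_add)
qed

text \<open>The sum is geometric, and its ratio is a \<open>c\<close>-th root of unity that equals 1
  only if \<open>c\<close> divides \<open>n\<close>.\<close>

lemma additive_char_sum:
  assumes "c > 0"
  shows "(\<Sum>t\<in>{0..<int c}. additive_char (real_of_int (t * n) / real c)) = (if int c dvd n then of_nat c else 0)"
proof -
  define z where "z = additive_char (real_of_int n / real c)"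
  have zc: "z ^ c = 1"
    using assms by (simp add: z_def additive_char_power)
  have "(\<Sum>t\<in>{0..<int c}. additive_char (real_of_int (t * n) / real c)) = (\<Sum>t<c. z ^ t)"
    by (rule sum.reindex_bij_witness[of _ int nat]) (auto simp: z_def additive_char_power)
  moreover have "z = 1 \<longleftrightarrow> int c dvd n"
  proof -
    have "real_of_int n / real c \<in> \<int> \<longleftrightarrow> int c dvd n"
      using assms by (metis of_int_div_of_int_in_Ints_iff of_int_of_nat_eq of_nat_0_eq_iff less_irrefl)
    then show ?thesis
      by (simp add: z_def additive_char_eq_1_iff)
  qed
  ultimately show ?thesis
    using geometric_sum[of z c] zc by (cases "z = 1") auto
qed

section \<open>Periodic functions and complete residue systems\<close>

lemma periodic_mod:
  fixes F :: "int \<Rightarrow> 'a"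
  assumes "\<And>x. F (x + int c) = F x"
  shows "F (x mod int c) = F x"
proof -
  have nat: "F (y + int c * int k) = F y" for y k
  proof (induction k)
    case (Suc k)
    then show ?case using assms[of "y + int c * int k"] by (simp add: algebra_simps)
  qed simp
  have "F (y + int c * k) = F y" for y k
  proof (cases "k \<ge> 0")
    case True
    then show ?thesis using nat[of y "nat k"] by simp
  next
    case False
    \<comment> \<open>For negative \<open>k\<close> the nonnegative case is applied from the shifted
      point back to \<open>y\<close>.\<close>
    then show ?thesis using nat[of "y + int c * k" "nat (-k)"] by simp
  qed
  from this[of "x mod int c" "x div int c"] show ?thesis
    by simp
qed

lemma periodic_cong:
  fixes F :: "int \<Rightarrow> 'a"
  assumes "\<And>x. F (x + int c) = F x" "[x = y] (mod int c)"
  shows "F x = F y"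
  using periodic_mod[of F c x, OF assms(1)] periodic_mod[of F c y, OF assms(1)] assms(2)
  by (simp add: cong_def)

lemma sum_residues_mult:
  fixes F :: "int \<Rightarrow> 'a::comm_monoid_add"
  assumes per: "\<And>x. F (x + int c) = F x" and u: "coprime u (int c)" and "c > 0"
  shows "(\<Sum>x\<in>{0..<int c}. F (u * x)) = (\<Sum>x\<in>{0..<int c}. F x)"
proof -
  from u obtain w where w: "[u * w = 1] (mod int c)"
    using cong_solve_coprime_int by blast
  have "u * (w * x mod int c) mod int c = x" "w * (u * x mod int c) mod int c = x" if "x \<in> {0..<int c}" for x
  proof -
    have "[u * w * x = x] (mod int c)"
      using w by (metis cong_scalar_right mult_1)
    then show "u * (w * x mod int c) mod int c = x" "w * (u * x mod int c) mod int c = x"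
      using that by (simp_all add: cong_def mod_mult_right_eq mult_ac)
  qed
  note 1 = this
  show ?thesis
    by (rule sum.reindex_bij_witness[of _ "\<lambda>x. w * x mod int c" "\<lambda>x. u * x mod int c"])
       (use assms 1 in \<open>auto simp: periodic_mod[of F, OF per]\<close>)
qed

lemma sum_residues_split:
  fixes F :: "int \<Rightarrow> 'a::comm_monoid_add"
  assumes "c > 0" "d > 0"
  shows "(\<Sum>x\<in>{0..<int (c * d)}. F x) = (\<Sum>r\<in>{0..<int c}. \<Sum>t\<in>{0..<int d}. F (r + int c * t))"
proof -
  have le: "r + int c * t < int c * int d" if "r < int c" "t < int d" for r t
  proof -
    have "r + int c * t < int c + int c * t" using that by simp
    also have "\<dots> = int c * (t + 1)" by (simp add: algebra_simps)
    also have "\<dots> \<le> int c * int d" using that by (intro mult_left_mono) auto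
    finally show ?thesis .
  qed
  have div: "x div int c < int d" if "x < int c * int d" for x
  proof -
    have "int c * (x div int c) \<le> x" using minus_mod_eq_mult_div[of x "int c"] assms(1) by (smt (verit) of_nat_0_less_iff pos_mod_sign)
    then have "int c * (x div int c) < int c * int d" using that by linarith
    then show ?thesis using assms by simp
  qed
  show ?thesis
    unfolding sum.cartesian_product
    by (rule sum.reindex_bij_witness[of _ "\<lambda>(r, t). r + int c * t" "\<lambda>x. (x mod int c, x div int c)"])
       (use assms in \<open>auto simp: le div pos_imp_zdiv_nonneg_iff\<close>)
qed

subsection \<open>Dirichlet characters\<close>

lemma dc_mult: "dirichlet_character N chi \<Longrightarrow> chi (x * y) = chi x * chi y"
  by (simp add: dirichlet_character_def)

lemma dc_add: "dirichlet_character N chi \<Longrightarrow> chi (x + int N) = chi x"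
  by (simp add: dirichlet_character_def)

lemma dc_eq_0_iff: "dirichlet_character N chi \<Longrightarrow> chi x = 0 \<longleftrightarrow> \<not> coprime x (int N)"
  by (auto simp: dirichlet_character_def)

lemma dc_pos: "dirichlet_character N chi \<Longrightarrow> N > 0"
  by (simp add: dirichlet_character_def)

lemma dc_cong: "dirichlet_character N chi \<Longrightarrow> [x = y] (mod int N) \<Longrightarrow> chi x = chi y"
  by (rule periodic_cong[of chi N]) (auto simp: dc_add)

lemma dc_1: 
  assumes "dirichlet_character N chi"
  shows "chi 1 = 1"
  using dc_mult[OF assms, of 1 1] dc_eq_0_iff[OF assms, of 1] by simp

lemma dc_power: "dirichlet_character N chi \<Longrightarrow> chi (x ^ n) = chi x ^ n"
  by (induction n) (auto simp: dc_1 dc_mult)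

text \<open>By Euler's theorem the value at a unit is a root of unity of order dividing
  \<open>totient N\<close>. Euler's theorem speaks of natural numbers, hence the passage to the
  residue \<open>y\<close>.\<close>

lemma dc_norm:
  assumes "dirichlet_character N chi" "coprime x (int N)"
  shows "norm (chi x) = 1"
proof -
  have N: "N > 0" using dc_pos assms(1) .
  define y where "y = nat (x mod int N)"
  have yx: "[int y = x] (mod int N)"
    using N by (simp add: y_def cong_def)
  have cy: "coprime y N"
    using assms(2) yx by (metis cong_imp_coprime cong_sym coprime_int_iff)
  have "[y ^ totient N = 1] (mod N)"
    using euler_theorem cy by blast
  then have "[int y ^ totient N = 1] (mod int N)"
    by (metis cong_int_iff of_nat_1 of_nat_power)
  then have "chi (int y) ^ totient N = 1"
    using dc_cong[OF assms(1)] dc_1[OF assms(1)] dc_power[OF assms(1)] by metis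
  then have "norm (chi (int y)) ^ totient N = 1"
    by (metis norm_power norm_one)
  moreover have "totient N > 0" using N by simp
  ultimately have "norm (chi (int y)) = 1"
    by (metis norm_ge_zero power_eq_1_iff less_numeral_extra(3) abs_of_nonneg real_norm_def power_eq_imp_eq_base power_one)
  then show ?thesis
    using dc_cong[OF assms(1) yx] by simp
qed

lemma dc_norm_le: "dirichlet_character N chi \<Longrightarrow> norm (chi x) \<le> 1"
  using dc_norm[of N chi x] dc_eq_0_iff[of N chi x] by (cases "coprime x (int N)") auto

lemma dc_mult_cnj:
  assumes "dirichlet_character N chi" "coprime x (int N)"
  shows "chi x * cnj (chi x) = 1"
  using dc_norm[OF assms] by (simp add: complex_norm_square [symmetric])

lemma dc_cnj_eqI:
  assumes "dirichlet_character N chi" "[x * y = 1] (mod int N)"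
  shows "cnj (chi x) = chi y"
proof -
  have "chi x * chi y = 1"
    using dc_cong[OF assms] dc_1[OF assms(1)] dc_mult[OF assms(1)] by simp
  moreover have "coprime x (int N)"
    using assms(2) by (metis cong_imp_coprime cong_sym coprime_1_left coprime_mult_left_iff)
  then have "cnj (chi x) * chi x = 1"
    using dc_mult_cnj[OF assms(1)] by (simp add: mult.commute)
  ultimately show ?thesis
    by (metis mult.assoc mult.commute mult_1)
qed

lemma dc_cnj: "dirichlet_character N chi \<Longrightarrow> dirichlet_character N (\<lambda>x. cnj (chi x))"
  by (simp add: dirichlet_character_def)

lemma dc_minus_1:
  assumes "dirichlet_character N chi"
  shows "chi (-1) = 1 \<or> chi (-1) = -1"
proof -
  have "chi (-1) * chi (-1) = 1"
    using dc_mult[OF assms, of "-1" "-1"] dc_1[OF assms] by simp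
  then show ?thesis
    by (metis square_eq_1_iff)
qed

lemma primitive_imp_dc: "primitive_dirichlet_character c chi \<Longrightarrow> dirichlet_character c chi"
  by (simp add: primitive_dirichlet_character_def)

lemma primitive_cnj:
  assumes "primitive_dirichlet_character c chi"
  shows "primitive_dirichlet_character c (\<lambda>x. cnj (chi x))"
  unfolding primitive_dirichlet_character_def
proof (intro conjI notI)
  assume "\<exists>d chi'. d dvd c \<and> d < c \<and> dirichlet_character d chi' \<and>
            (\<forall>x. coprime x (int c) \<longrightarrow> cnj (chi x) = chi' x)"
  then obtain d chi' where d: "d dvd c" "d < c" "dirichlet_character d chi'"
    "\<forall>x. coprime x (int c) \<longrightarrow> cnj (chi x) = chi' x"
    by blast
  then have "\<forall>x. coprime x (int c) \<longrightarrow> chi x = cnj (chi' x)"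
    by (metis complex_cnj_cnj)
  then show False
    using d dc_cnj[OF d(3)] assms unfolding primitive_dirichlet_character_def by blast
qed (use assms in \<open>simp add: dc_cnj primitive_imp_dc\<close>)

text \<open>Take the least divisor of \<open>c\<close> from which \<open>chi\<close> is induced; a
  proper inducing modulus for \<open>chi'\<close> would contradict minimality. Agreement is claimed
  on the units modulo \<open>c\<close> only, since \<open>chi'\<close> may be nonzero at further
  integers.\<close>

lemma ex_inducing_primitive:
  assumes "dirichlet_character c chi"
  obtains d chi' where "d dvd c" "primitive_dirichlet_character d chi'"
    "\<And>x. coprime x (int c) \<Longrightarrow> chi x = chi' x"
proof -
  define Q where "Q d \<longleftrightarrow> (d dvd c \<and> (\<exists>chi'. dirichlet_character d chi' \<and> (\<forall>x. coprime x (int c) \<longrightarrow> chi x = chi' x)))" for d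
  have "Q c" using assms by (auto simp: Q_def)
  define d where "d = (LEAST d. Q d)"
  have "Q d" unfolding d_def using \<open>Q c\<close> by (rule LeastI)
  then obtain chi' where chi': "d dvd c" "dirichlet_character d chi'" "\<forall>x. coprime x (int c) \<longrightarrow> chi x = chi' x"
    by (auto simp: Q_def)
  have "primitive_dirichlet_character d chi'"
    unfolding primitive_dirichlet_character_def
  proof (intro conjI notI)
    assume "\<exists>d' chi''. d' dvd d \<and> d' < d \<and> dirichlet_character d' chi'' \<and>
            (\<forall>x. coprime x (int d) \<longrightarrow> chi' x = chi'' x)"
    then obtain d' chi'' where d': "d' dvd d" "d' < d" "dirichlet_character d' chi''"
      "\<forall>x. coprime x (int d) \<longrightarrow> chi' x = chi'' x" by blast
    have "coprime x (int d)" if "coprime x (int c)" for x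
      using that chi'(1) by (metis coprime_divisors dvd_refl int_dvd_int_iff)
    then have "Q d'"
      using d' chi' by (auto simp: Q_def intro: dvd_trans)
    then show False
      using d'(2) not_less_Least d_def by blast
  qed (use chi' in auto)
  then show ?thesis using that chi' by blast
qed

text \<open>Each translation has finite order, so a function on the units splits into eigenfunctions of
  all translations, and these are multiples of characters.\<close>

definition unit_functions :: "nat \<Rightarrow> (int \<Rightarrow> complex) set" where
  "unit_functions c = {h. (\<forall>x. h (x + int c) = h x) \<and> (\<forall>x. \<not> coprime x (int c) \<longrightarrow> h x = 0)}"

definition translation_eigenfunction :: "int \<Rightarrow> (int \<Rightarrow> complex) \<Rightarrow> bool" where
  "translation_eigenfunction g h \<longleftrightarrow> (\<exists>\<zeta>. \<forall>x. h (g * x) = \<zeta> * h x)"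

text \<open>Translation by \<open>g\<close> has order dividing \<open>n = totient c\<close>, so
  averaging its powers against the \<open>n\<close>-th roots of unity projects onto its eigenspaces.
  Translations commute, so these projections keep every eigenproperty that \<open>h\<close> already
  had; the third conclusion is what allows the step to be iterated.\<close>

lemma eigenfunction_decomposition_step:
  assumes c: "c > 0" and h: "h \<in> unit_functions c" and g: "coprime g (int c)"
  obtains fs where
    "\<And>f. f \<in> set fs \<Longrightarrow> f \<in> unit_functions c"
    "\<And>f. f \<in> set fs \<Longrightarrow> translation_eigenfunction g f"
    "\<And>f g'. f \<in> set fs \<Longrightarrow> translation_eigenfunction g' h \<Longrightarrow> translation_eigenfunction g' f"
    "\<And>x. h x = (\<Sum>f\<leftarrow>fs. f x)"
proof -
  define n where "n = totient c"
  have n: "n > 0" using c by (simp add: n_def)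
  have per: "h (x + int c) = h x" for x using h by (simp add: unit_functions_def)
  define G where "G = nat (g mod int c)"
  have Gg: "[int G = g] (mod int c)" using c by (simp add: G_def cong_def)
  have "coprime G c"
    using g Gg by (metis cong_imp_coprime cong_sym coprime_int_iff)
  then have "[G ^ n = 1] (mod c)" using euler_theorem n_def by blast
  then have "[int G ^ n = 1] (mod int c)"
    by (metis cong_int_iff of_nat_1 of_nat_power)
  then have gn: "[g ^ n = 1] (mod int c)"
    using Gg by (meson cong_pow cong_sym cong_trans)
  have hgn: "h (g ^ n * x) = h x" for x
    by (rule periodic_cong[of h c, OF per]) (use cong_scalar_right[OF gn, of x] in simp)
  define z where "z k = additive_char (real k / real n)" for k
  have zn: "z k ^ n = 1" and z0: "z k \<noteq> 0" for k
    using n additive_char_of_int[of "int k"] by (auto simp: z_def additive_char_power)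
  \<comment> \<open>The projector onto the eigenvalue \<open>z k\<close>; summing over
    \<open>k\<close> leaves only the term \<open>j = 0\<close>, which is \<open>h\<close>
    itself.\<close>
  define E where "E k = (\<lambda>x. (\<Sum>j<n. h (g ^ j * x) / z k ^ j) / of_nat n)" for k
  have Eg: "E k (g * x) = z k * E k x" for k x
  proof -
    define F where "F j = h (g ^ j * x) / z k ^ j" for j
    have F: "h (g ^ j * (g * x)) / z k ^ j = z k * F (Suc j)" for j
      using z0 by (simp add: F_def field_simps)
    have "(\<Sum>j<n. F (Suc j)) = (\<Sum>j<Suc n. F j) - F 0"
      by (simp add: sum.lessThan_Suc_shift del: sum.lessThan_Suc)
    also have "\<dots> = (\<Sum>j<n. F j)"
      by (simp add: F_def hgn zn)
    finally show ?thesis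
      unfolding E_def F sum_distrib_left [symmetric] by (simp add: F_def)
  qed
  have Esum: "(\<Sum>k<n. E k x) = h x" for x
  proof -
    have zj: "(\<Sum>k<n. 1 / z k ^ j) = (if j = 0 then of_nat n else 0)" if "j < n" for j
    proof -
      have "(\<Sum>k<n. 1 / z k ^ j) = (\<Sum>t\<in>{0..<int n}. additive_char (real_of_int (t * (- int j)) / real n))"
      proof (rule sum.reindex_bij_witness[of _ nat int], goal_cases)
        case (5 k)
        have "additive_char (real_of_int (int k * (- int j)) / real n) * z k ^ j
            = additive_char (real_of_int (int k * (- int j)) / real n + real j * (real k / real n))"
          by (simp only: z_def additive_char_power additive_char_add)
        also have "real_of_int (int k * (- int j)) / real n + real j * (real k / real n) = 0"
          by simp
        finally show ?case using z0 by (simp add: field_simps)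
      qed auto
      also have "\<dots> = (if j = 0 then of_nat n else 0)"
        using additive_char_sum[OF n, of "- int j"] that by (auto dest: nat_dvd_not_less)
      finally show ?thesis .
    qed
    have "(\<Sum>k<n. E k x) = (\<Sum>j<n. h (g ^ j * x) * (\<Sum>k<n. 1 / z k ^ j)) / of_nat n"
      unfolding E_def sum_divide_distrib [symmetric] sum_distrib_left
      by (subst sum.swap) simp
    also have "\<dots> = (\<Sum>j<n. if j = 0 then h x * of_nat n else 0) / of_nat n"
      by (intro arg_cong2[of _ _ _ _ "(/)"] sum.cong refl) (auto simp: zj)
    also have "\<dots> = h x" using n by simp
    finally show ?thesis .
  qed
  show ?thesis
  proof (rule that[of "map E [0..<n]"])
    fix f assume "f \<in> set (map E [0..<n])"
    then obtain k where f: "f = E k" by auto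
    have "E k (x + int c) = E k x" for x
      unfolding E_def
      by (intro arg_cong2[of _ _ _ _ "(/)"] sum.cong refl periodic_cong[of h c, OF per])
         (auto simp: algebra_simps cong_def)
    moreover have "E k x = 0" if "\<not> coprime x (int c)" for x
    proof -
      have "h (g ^ j * x) = 0" for j
        using h that by (auto simp: unit_functions_def)
      then show ?thesis by (simp add: E_def)
    qed
    ultimately show "f \<in> unit_functions c" by (auto simp: unit_functions_def f)
    show "translation_eigenfunction g f"
      using Eg by (auto simp: translation_eigenfunction_def f)
    fix g' assume "translation_eigenfunction g' h"
    then obtain \<zeta> where \<zeta>: "\<And>x. h (g' * x) = \<zeta> * h x" by (auto simp: translation_eigenfunction_def)
    have "h (g ^ j * (g' * x)) = \<zeta> * h (g ^ j * x)" for j x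
      using \<zeta>[of "g ^ j * x"] by (simp add: mult_ac)
    then have "E k (g' * x) = \<zeta> * E k x" for x
      by (simp add: E_def sum_distrib_left)
    then show "translation_eigenfunction g' f"
      by (auto simp: translation_eigenfunction_def f)
  next
    show "h x = (\<Sum>f\<leftarrow>map E [0..<n]. f x)" for x
      using Esum[of x] by (simp add: comp_def interv_sum_list_conv_sum_set_nat atLeast0LessThan)
  qed
qed

text \<open>Simultaneous diagonalization, one translation at a time: each piece found for
  \<open>gs\<close> is split further with respect to \<open>g\<close> and remains an eigenfunction
  for the members of \<open>gs\<close>.\<close>

lemma eigenfunction_decomposition:
  assumes c: "c > 0" and "h \<in> unit_functions c" and "\<And>g. g \<in> set gs \<Longrightarrow> coprime g (int c)"
  shows "\<exists>fs. (\<forall>f\<in>set fs. f \<in> unit_functions c \<and> (\<forall>g\<in>set gs. translation_eigenfunction g f)) \<and>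
              (\<forall>x. h x = (\<Sum>f\<leftarrow>fs. f x))"
  using assms(3)
proof (induction gs)
  case Nil
  then show ?case
    by (intro exI[of _ "[h]"]) (use assms in auto)
next
  case (Cons g gs)
  then obtain fs where fs: "\<And>f. f \<in> set fs \<Longrightarrow> f \<in> unit_functions c"
    "\<And>f g. f \<in> set fs \<Longrightarrow> g \<in> set gs \<Longrightarrow> translation_eigenfunction g f"
    "\<And>x. h x = (\<Sum>f\<leftarrow>fs. f x)"
    by auto
  define R where "R f es \<longleftrightarrow> (\<forall>e\<in>set es. e \<in> unit_functions c \<and> translation_eigenfunction g e \<and>
            (\<forall>g'. translation_eigenfunction g' f \<longrightarrow> translation_eigenfunction g' e)) \<and>
          (\<forall>x. f x = (\<Sum>e\<leftarrow>es. e x))" for f es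
  have "\<exists>es. R f es" if "f \<in> set fs" for f
  proof -
    have g: "coprime g (int c)" using Cons.prems by simp
    show ?thesis
      by (rule eigenfunction_decomposition_step[OF c fs(1)[OF that] g])
         (unfold R_def, blast)
  qed
  then obtain es where "\<And>f. f \<in> set fs \<Longrightarrow> R f (es f)"
    by metis
  then obtain es where es: "\<And>f e. f \<in> set fs \<Longrightarrow> e \<in> set (es f) \<Longrightarrow> e \<in> unit_functions c"
    "\<And>f e. f \<in> set fs \<Longrightarrow> e \<in> set (es f) \<Longrightarrow> translation_eigenfunction g e"
    "\<And>f e g'. f \<in> set fs \<Longrightarrow> e \<in> set (es f) \<Longrightarrow> translation_eigenfunction g' f \<Longrightarrow> translation_eigenfunction g' e"
    "\<And>f x. f \<in> set fs \<Longrightarrow> f x = (\<Sum>e\<leftarrow>es f. e x)"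
    unfolding R_def by blast
  have sl: "(\<Sum>e\<leftarrow>concat (map es fs'). e x) = (\<Sum>f\<leftarrow>fs'. \<Sum>e\<leftarrow>es f. e x)" for fs' x
    by (induction fs') auto
  show ?case
    by (rule exI[of _ "concat (map es fs)"])
       (use fs es in \<open>auto simp: sl intro!: arg_cong[of _ _ sum_list]\<close>)
qed

text \<open>Evaluation at 1 identifies the eigenvalue of translation by \<open>x\<close> as
  \<open>f x / f 1\<close>, and the eigenvalue equation then becomes multiplicativity.\<close>

lemma full_eigenfunction_imp_character:
  assumes f: "f \<in> unit_functions c" and c: "c > 0"
    and eig: "\<And>g. g \<in> {0..<int c} \<Longrightarrow> coprime g (int c) \<Longrightarrow> translation_eigenfunction g f"
    and f1: "f 1 \<noteq> 0"
  shows "dirichlet_character c (\<lambda>x. f x / f 1)"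
proof -
  have per: "f (x + int c) = f x" and z: "\<not> coprime x (int c) \<Longrightarrow> f x = 0" for x
    using f by (auto simp: unit_functions_def)
  have key: "f (x * y) * f 1 = f x * f y" for x y
  proof (cases "coprime x (int c)")
    case True
    have "coprime (x mod int c) (int c)" using True c by simp
    then obtain \<zeta> where \<zeta>: "\<And>y. f (x mod int c * y) = \<zeta> * f y"
      using eig[of "x mod int c"] c by (auto simp: translation_eigenfunction_def)
    have "f (x * y) = \<zeta> * f y" for y
      unfolding \<zeta> [symmetric] by (rule periodic_cong[of f, OF per]) (auto simp: cong_def mod_simps)
    from this[of 1] this[of y] show ?thesis by simp
  next
    case False
    then show ?thesis by (simp add: z)
  qed
  have nz: "f x \<noteq> 0" if x: "coprime x (int c)" for x
  proof -
    obtain w where "[x * w = 1] (mod int c)"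
      using x cong_solve_coprime_int by blast
    then have "f (x * w) = f 1" by (intro periodic_cong[of f, OF per])
    then show ?thesis using key[of x w] f1 by auto
  qed
  have "f (x * y) / f 1 = f x / f 1 * (f y / f 1)" for x y
    using key[of x y] f1 by (simp add: field_simps)
  then show ?thesis
    using c f1 nz z by (auto simp: dirichlet_character_def per)
qed

text \<open>This replaces orthogonality of characters. Neither distinctness of the
  \<open>X i\<close> nor the value of the weights \<alpha> matters below: all later averages use
  only that the combination detects 1 among the units.\<close>

lemma unit_delta_decomposition:
  assumes c: "c > 0"
  obtains n :: nat and \<alpha> X where "\<And>i. i < n \<Longrightarrow> dirichlet_character c (X i)"
    "\<And>u. coprime u (int c) \<Longrightarrow> (\<Sum>i<n. \<alpha> i * X i u) = (if [u = 1] (mod int c) then 1 else 0)"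
proof -
  define gs where "gs = filter (\<lambda>g. coprime g (int c)) (map int [0..<c])"
  define h :: "int \<Rightarrow> complex" where "h u = (if [u = 1] (mod int c) then 1 else 0)" for u
  have h: "h \<in> unit_functions c"
  proof -
    have "coprime x (int c)" if "[x = 1] (mod int c)" for x
      using that by (metis cong_imp_coprime cong_sym coprime_1_left)
    then show ?thesis by (auto simp: unit_functions_def h_def cong_def)
  qed
  obtain fs where fs: "\<And>f. f \<in> set fs \<Longrightarrow> f \<in> unit_functions c"
    "\<And>f g. f \<in> set fs \<Longrightarrow> g \<in> set gs \<Longrightarrow> translation_eigenfunction g f"
    "\<And>x. h x = (\<Sum>f\<leftarrow>fs. f x)"
    using eigenfunction_decomposition[OF c h, of gs] by (auto simp: gs_def)
  have "g \<in> set gs" if "g \<in> {0..<int c}" "coprime g (int c)" for g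
    using that by (auto simp: gs_def intro!: image_eqI[of _ _ "nat g"])
  then have eig: "translation_eigenfunction g f" if "f \<in> set fs" "g \<in> {0..<int c}" "coprime g (int c)" for f g
    using that fs(2) by blast
  define es where "es = filter (\<lambda>f. f 1 \<noteq> 0) fs"
  \<comment> \<open>An eigenfunction of all translations that vanishes at 1 vanishes on every unit,
    so dropping these pieces changes nothing and division by \<open>f 1\<close> becomes
    legitimate.\<close>
  have zero: "f u = 0" if "f \<in> set fs" "f 1 = 0" for f u
  proof (cases "coprime u (int c)")
    case True
    have per: "f (x + int c) = f x" for x
      using fs(1)[OF that(1)] by (auto simp: unit_functions_def)
    have "translation_eigenfunction (u mod int c) f"
      using eig[OF that(1), of "u mod int c"] c True by simp
    then obtain \<zeta> where "\<And>y. f (u mod int c * y) = \<zeta> * f y"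
      by (auto simp: translation_eigenfunction_def)
    from this[of 1] that(2) show ?thesis using periodic_mod[of f c u, OF per] by simp
  next
    case False
    then show ?thesis using fs(1)[OF that(1)] by (auto simp: unit_functions_def)
  qed
  have "h u = (\<Sum>f\<leftarrow>es. f u)" for u
    unfolding fs(3) es_def by (rule sum_list_map_filter [symmetric]) (use zero in auto)
  also have "(\<Sum>f\<leftarrow>es. f u) = (\<Sum>i<length es. (es ! i) 1 * ((es ! i) u / (es ! i) 1))" for u
    unfolding sum_list_sum_nth length_map atLeast0LessThan
  proof (intro sum.cong refl)
    fix i assume "i \<in> {..<length es}"
    then have "es ! i \<in> set es" by simp
    then have "(es ! i) 1 \<noteq> 0" by (simp add: es_def)
    with \<open>i \<in> _\<close> show "map (\<lambda>f. f u) es ! i = (es ! i) 1 * ((es ! i) u / (es ! i) 1)" by simp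
  qed
  finally have "h u = (\<Sum>i<length es. (es ! i) 1 * ((es ! i) u / (es ! i) 1))" for u .
  moreover have "dirichlet_character c (\<lambda>x. (es ! i) x / (es ! i) 1)" if "i < length es" for i
  proof -
    have "es ! i \<in> set es" using that by simp
    then show ?thesis
      using full_eigenfunction_imp_character[OF fs(1) c] eig by (auto simp: es_def)
  qed
  ultimately show ?thesis
    using that[of "length es" "\<lambda>i x. (es ! i) x / (es ! i) 1" "\<lambda>i. (es ! i) 1"] by (auto simp: h_def)
qed

subsection \<open>Moebius inversion\<close>

text \<open>Defined by the recursion that forces its divisor sums, because the divisor sum is the
  only property of the Moebius function that enters the inversions.\<close>

fun moebius_mu :: "nat \<Rightarrow> complex" where
  "moebius_mu n = (if n = 0 then 0 else if n = 1 then 1 else - (\<Sum>d | d dvd n \<and> d < n. moebius_mu d))"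

declare moebius_mu.simps [simp del]

lemma moebius_sum:
  assumes "n > 0"
  shows "(\<Sum>d | d dvd n. moebius_mu d) = (if n = 1 then 1 else 0)"
proof (cases "n = 1")
  case True
  then show ?thesis by (simp add: moebius_mu.simps)
next
  case False
  have "{d. d dvd n} = insert n {d. d dvd n \<and> d < n}"
    using assms by (auto dest: dvd_imp_le)
  then have "(\<Sum>d | d dvd n. moebius_mu d) = moebius_mu n + (\<Sum>d | d dvd n \<and> d < n. moebius_mu d)"
    using assms by simp
  then show ?thesis
    using False assms by (subst (asm) (2) moebius_mu.simps) simp
qed

text \<open>Grouping the pairs by their product \<open>k\<close> leaves the sum of the Moebius
  function over all divisors of \<open>k\<close>, which is zero unless \<open>k = 1\<close>. The set
  \<open>K\<close> is arbitrary, so any constraint that depends on the product alone can be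
  collapsed.\<close>

lemma moebius_collapse:
  assumes K: "finite K" "0 \<notin> K"
  shows "(\<Sum>(f, b) | f * b \<in> K. moebius_mu f * Z (f * b)) = (if 1 \<in> K then Z 1 else 0)"
proof -
  have "(\<Sum>(f, b) | f * b \<in> K. moebius_mu f * Z (f * b))
      = (\<Sum>(k, f)\<in>(SIGMA k:K. {f. f dvd k}). moebius_mu f * Z k)"
    by (rule sum.reindex_bij_witness[of _ "\<lambda>(k, f). (f, k div f)" "\<lambda>(f, b). (f * b, f)"])
       (use K in \<open>auto intro: gr0I\<close>)
  also have "\<dots> = (\<Sum>k\<in>K. (\<Sum>f | f dvd k. moebius_mu f) * Z k)"
    using K by (subst sum.Sigma [symmetric]) (auto simp: sum_distrib_right intro: finite_divisors_nat gr0I)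
  also have "\<dots> = (\<Sum>k\<in>K. if k = 1 then Z 1 else 0)"
    by (intro sum.cong refl, subst moebius_sum) (use K in \<open>auto intro: gr0I\<close>)
  also have "\<dots> = (if 1 \<in> K then Z 1 else 0)"
    using K by simp
  finally show ?thesis .
qed

subsection \<open>Gauss sums\<close>

text \<open>Units modulo \<open>d\<close> lift to integers prime to \<open>c\<close>. This is needed
  to see a character that is trivial on the kernel of reduction as a character of the smaller
  modulus.\<close>

lemma ex_coprime_lift:
  fixes x :: int and c d :: nat
  assumes "c > 0" "coprime x (int d)"
  obtains y where "[y = x] (mod int d)" "coprime y (int c)"
proof -
  \<comment> \<open>For \<open>y = x + d * t\<close> with \<open>t\<close> the product of these
    primes, a prime divisor of \<open>c\<close> divides exactly one of \<open>x\<close> and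
    \<open>d * t\<close>: if it divides \<open>x\<close>, it divides neither \<open>d\<close> nor
    \<open>t\<close>.\<close>
  define T where "T = {p. prime p \<and> p dvd c \<and> \<not> int p dvd x}"
  define t where "t = \<Prod>T"
  have fin: "finite T"
    by (rule finite_subset[of _ "{p. p dvd c}"]) (use assms(1) in \<open>auto simp: T_def\<close>)
  have t: "p dvd t \<longleftrightarrow> p \<in> T" if pp: "prime p" for p
  proof
    assume "p dvd t"
    then obtain r where "r \<in> T" "p dvd r"
      using prime_dvd_prod_iff[OF fin pp, of "\<lambda>x. x"] unfolding t_def by auto
    then show "p \<in> T"
      using pp primes_dvd_imp_eq[of p r] by (auto simp: T_def)
  next
    assume "p \<in> T"
    then show "p dvd t" unfolding t_def using dvd_prodI[OF fin, of p "\<lambda>x. x"] by simp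
  qed
  define y where "y = x + int d * int t"
  have "coprime y (int c)"
  proof (rule ccontr)
    assume "\<not> coprime y (int c)"
    moreover have "gcd y (int c) \<noteq> 0" using assms(1) by simp
    ultimately obtain p' where p'': "prime p'" "p' dvd gcd y (int c)"
      using prime_divisor_exists[of "gcd y (int c)"] is_unit_gcd[of y "int c"] by blast
    then have p': "prime p'" "p' dvd y" "p' dvd int c" by auto
    define p where "p = nat p'"
    have p: "p' = int p" "prime p" using p'(1) by (auto simp: p_def prime_ge_0_int)
    have pc: "p dvd c" using p' p by simp
    show False
    proof (cases "int p dvd x")
      case True
      then have "int p dvd int d * int t"
        using p'(2) p by (simp add: y_def dvd_add_right_iff)
      then have "p dvd d \<or> p dvd t"
        using p(2) by (metis int_dvd_int_iff of_nat_mult prime_dvd_mult_iff)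
      moreover have "\<not> p dvd d"
      proof
        assume "p dvd d"
        then have "is_unit (int p)"
          by (intro coprime_common_divisor[OF assms(2) True]) simp
        then show False using p(2) by simp
      qed
      moreover have "\<not> p dvd t"
        using t[OF p(2)] True by (simp add: T_def)
      ultimately show False by blast
    next
      case False
      then have "int p dvd int t"
        using t[OF p(2)] p(2) pc by (simp add: T_def)
      then have "int p dvd int d * int t" by simp
      then have "int p dvd x"
        using p'(2) p by (simp add: y_def dvd_add_left_iff)
      then show False using False by simp
    qed
  qed
  moreover have "[y = x] (mod int d)" by (simp add: y_def cong_def)
  ultimately show ?thesis using that by blast
qed

text \<open>Primitivity in the form that makes Gauss sums vanish. If \<open>chi\<close> were trivial
  on all units congruent to 1 modulo \<open>d\<close>, it would factor through the units modulo
  \<open>d\<close> and hence be induced from there.\<close>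

lemma primitive_nontrivial:
  assumes prim: "primitive_dirichlet_character c chi" and d: "d dvd c" "d < c"
  obtains x where "[x = 1] (mod int d)" "coprime x (int c)" "chi x \<noteq> 1"
proof (rule ccontr)
  assume neg: "\<not> thesis"
  have that0: "\<not> ([x = 1] (mod int d) \<and> coprime x (int c) \<and> chi x \<noteq> 1)" for x
    using that neg by blast
  have triv: "chi x = 1" if "[x = 1] (mod int d)" "coprime x (int c)" for x
    using that0[of x] that by blast
  have dc: "dirichlet_character c chi" using prim by (rule primitive_imp_dc)
  have c0: "c > 0" using dc_pos[OF dc] .
  have d0: "d > 0" using d(1) c0 by (auto intro: gr0I)
  have wd: "chi y = chi y'" if yy: "[y = y'] (mod int d)" "coprime y (int c)" "coprime y' (int c)" for y y'
  proof -
    obtain w where w: "[y' * w = 1] (mod int c)"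
      using yy(3) cong_solve_coprime_int by blast
    have wc: "coprime w (int c)"
      using w by (metis cong_imp_coprime cong_sym coprime_1_left coprime_mult_left_iff)
    have "[y * w = y' * w] (mod int d)" using yy(1) by (rule cong_scalar_right)
    moreover have "[y' * w = 1] (mod int d)"
      using w d(1) by (meson cong_dvd_modulus int_dvd_int_iff)
    ultimately have "[y * w = 1] (mod int d)" by (rule cong_trans)
    then have "chi (y * w) = 1" using triv yy(2) wc by simp
    moreover have "chi (y' * w) = 1"
      using dc_cong[OF dc w] dc_1[OF dc] by simp
    moreover have "chi w \<noteq> 0" using wc dc_eq_0_iff[OF dc] by simp
    ultimately show ?thesis using dc_mult[OF dc] by (metis mult_right_cancel)
  qed
  \<comment> \<open>An arbitrary lift of \<open>x\<close> to a unit modulo \<open>c\<close>; by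
    \<open>wd\<close> the value of \<open>chi\<close> does not depend on the choice.\<close>
  define L where "L x = (SOME y. [y = x] (mod int d) \<and> coprime y (int c))" for x
  have L: "[L x = x] (mod int d)" "coprime (L x) (int c)" if "coprime x (int d)" for x
  proof -
    obtain y where "[y = x] (mod int d)" "coprime y (int c)"
      using ex_coprime_lift[OF c0 \<open>coprime x (int d)\<close>] .
    then have "[L x = x] (mod int d) \<and> coprime (L x) (int c)"
      unfolding L_def by (rule someI[of "\<lambda>y. [y = x] (mod int d) \<and> coprime y (int c)" y, OF conjI])
    then show "[L x = x] (mod int d)" "coprime (L x) (int c)" by auto
  qed
  have red: "coprime x (int d)" if "coprime x (int c)" for x
    using that d(1) by (metis coprime_divisors dvd_refl int_dvd_int_iff)
  define chi' where "chi' x = (if coprime x (int d) then chi (L x) else 0)" for x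
  have "dirichlet_character d chi'"
    unfolding dirichlet_character_def
  proof (intro conjI allI)
    show "d \<ge> 1" using d0 by simp
    fix x y
    show "chi' (x * y) = chi' x * chi' y"
    proof (cases "coprime x (int d) \<and> coprime y (int d)")
      case True
      then have xy: "coprime (x * y) (int d)" by simp
      have "chi (L (x * y)) = chi (L x * L y)"
      proof (rule wd)
        show "[L (x * y) = L x * L y] (mod int d)"
          using L(1)[OF xy] L(1)[of x] L(1)[of y] True by (meson cong_mult cong_sym cong_trans)
      qed (use L True xy in auto)
      then show ?thesis using True xy by (simp add: chi'_def dc_mult[OF dc])
    qed (auto simp: chi'_def)
    show "chi' (x + int d) = chi' x"
    proof (cases "coprime x (int d)")
      case True
      then have 1: "coprime (x + int d) (int d)" by (simp add: coprime_iff_gcd_eq_1)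
      have "[L (x + int d) = x + int d] (mod int d)" "[x + int d = x] (mod int d)" "[x = L x] (mod int d)"
        using L(1)[OF 1] L(1)[OF True] by (auto simp: cong_def)
      then have "chi (L (x + int d)) = chi (L x)"
        by (intro wd L(2) 1 True) (meson cong_trans)
      then show ?thesis using True 1 by (simp add: chi'_def)
    next
      case False
      then show ?thesis by (simp add: chi'_def coprime_iff_gcd_eq_1)
    qed
    show "chi' x \<noteq> 0 \<longleftrightarrow> coprime x (int d)"
      using L(2)[of x] dc_eq_0_iff[OF dc] by (simp add: chi'_def)
  qed
  moreover have "chi x = chi' x" if "coprime x (int c)" for x
    using red[OF that] L[of x] that wd by (metis chi'_def)
  ultimately show False
    using prim d unfolding primitive_dirichlet_character_def by blast
qed

text \<open>For a unit \<open>n\<close> substitute \<open>n * v\<close> for \<open>v\<close>.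
  Otherwise the right-hand side is zero, and the sum on the left is multiplied by some
  \<open>chi x\<close> different from 1 under a permutation of its terms.\<close>

lemma primitive_gauss_sum:
  assumes prim: "primitive_dirichlet_character c chi"
  shows "(\<Sum>v\<in>{0..<int c}. chi v * additive_char (real_of_int (v * n) / real c)) = cnj (chi n) * gauss_sum c chi"
proof -
  have dc: "dirichlet_character c chi" using prim by (rule primitive_imp_dc)
  have c0: "c > 0" using dc_pos[OF dc] .
  define F where "F n v = chi v * additive_char (real_of_int (v * n) / real c)" for n v
  have per: "F n (v + int c) = F n v" for n v
    unfolding F_def using c0 by (intro arg_cong2[of _ _ _ _ "(*)"] dc_add[OF dc] additive_char_cong)
      (auto simp: cong_def algebra_simps)
  show ?thesis
  proof (cases "coprime n (int c)")
    case True
    have "F 1 (n * v) * cnj (chi n) = F n v" for v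
      using dc_mult_cnj[OF dc True] by (simp add: F_def dc_mult[OF dc] mult_ac)
    then have "(\<Sum>v\<in>{0..<int c}. F n v) = (\<Sum>v\<in>{0..<int c}. F 1 (n * v)) * cnj (chi n)"
      by (simp add: sum_distrib_right)
    also have "(\<Sum>v\<in>{0..<int c}. F 1 (n * v)) = (\<Sum>v\<in>{0..<int c}. F 1 v)"
      by (rule sum_residues_mult[of "F 1", OF per True c0])
    finally show ?thesis by (simp add: F_def gauss_sum_def mult.commute)
  next
    case False
    define g where "g = gcd n (int c)"
    define d where "d = nat (int c div g)"
    have g: "g > 1" using False c0
      by (smt (verit) g_def coprime_iff_gcd_eq_1 gcd_pos_int of_nat_0_less_iff)
    have dg: "int d * g = int c" using g c0
      by (simp add: d_def g_def pos_imp_zdiv_nonneg_iff)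
    have "int d dvd int c" by (metis dg dvd_triv_left)
    then have d: "d dvd c" by simp
    moreover have "d < c"
    proof -
      have "int d > 0" using dg c0 g by (metis mult_eq_0_iff of_nat_0_less_iff of_nat_eq_0_iff gr0I less_irrefl)
      then have "int d * 1 < int d * g" using g by (intro mult_strict_left_mono) auto
      then show ?thesis using dg by simp
    qed
    ultimately obtain x where x: "[x = 1] (mod int d)" "coprime x (int c)" "chi x \<noteq> 1"
      using primitive_nontrivial[OF prim] by blast
    \<comment> \<open>Being 1 modulo \<open>c / gcd n c\<close>, the unit \<open>x\<close> leaves
      \<open>v * n\<close> unchanged modulo \<open>c\<close>, so only the character value
      changes.\<close>
    have xn: "[x * n = n] (mod int c)"
    proof -
      have "int d dvd x - 1" using x(1) by (simp add: cong_iff_dvd_diff)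
      moreover have "g dvd n" by (simp add: g_def)
      ultimately have "int d * g dvd (x - 1) * n" by (rule mult_dvd_mono)
      then show ?thesis unfolding dg by (simp add: cong_iff_dvd_diff algebra_simps)
    qed
    have "F n (x * v) = chi x * F n v" for v
    proof -
      have "[v * (x * n) = v * n] (mod int c)" using xn by (rule cong_scalar_left)
      then have "additive_char (real_of_int (x * v * n) / real c) = additive_char (real_of_int (v * n) / real c)"
        by (intro additive_char_cong c0) (simp add: mult_ac)
      then show ?thesis by (simp add: F_def dc_mult[OF dc])
    qed
    then have "(\<Sum>v\<in>{0..<int c}. F n v) = chi x * (\<Sum>v\<in>{0..<int c}. F n v)"
      using sum_residues_mult[of "F n", OF per x(2) c0] by (simp add: sum_distrib_left)
    then have "(\<Sum>v\<in>{0..<int c}. F n v) = 0" using x(3) by auto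
    then show ?thesis using False dc_eq_0_iff[OF dc] by (simp add: F_def)
  qed
qed

text \<open>Separability is used backwards: \<open>cnj (chi m)\<close> times the Gauss sum is
  reopened as a sum over \<open>v\<close>, after which the sum over \<open>m\<close> keeps only
  \<open>v\<close> congruent to -1, represented by \<open>c - 1\<close>.\<close>

lemma gauss_sum_mult_cnj:
  assumes prim: "primitive_dirichlet_character c chi"
  shows "gauss_sum c chi * gauss_sum c (\<lambda>x. cnj (chi x)) = chi (- 1) * of_nat c"
proof -
  have dc: "dirichlet_character c chi" using prim by (rule primitive_imp_dc)
  have c0: "c > 0" using dc_pos[OF dc] .
  have "gauss_sum c chi * gauss_sum c (\<lambda>x. cnj (chi x))
      = (\<Sum>m\<in>{0..<int c}. cnj (chi m) * gauss_sum c chi * additive_char (real_of_int m / real c))"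
    unfolding gauss_sum_def[of c "\<lambda>x. cnj (chi x)"] sum_distrib_left by (simp add: mult_ac)
  also have "\<dots> = (\<Sum>m\<in>{0..<int c}. \<Sum>v\<in>{0..<int c}. chi v * additive_char (real_of_int (m * (v + 1)) / real c))"
    unfolding primitive_gauss_sum[OF prim, symmetric] sum_distrib_right mult.assoc additive_char_add [symmetric]
    by (simp add: add_divide_distrib algebra_simps)
  also have "\<dots> = (\<Sum>v\<in>{0..<int c}. chi v * (\<Sum>m\<in>{0..<int c}. additive_char (real_of_int (m * (v + 1)) / real c)))"
    by (subst sum.swap) (simp add: sum_distrib_left)
  also have "\<dots> = (\<Sum>v\<in>{0..<int c}. if v = int c - 1 then chi (- 1) * of_nat c else 0)"
  proof (intro sum.cong refl)
    fix v assume v: "v \<in> {0..<int c}"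
    have "int c dvd v + 1 \<longleftrightarrow> v = int c - 1"
      using v zdvd_imp_le[of "int c" "v + 1"] by auto
    moreover have "chi (int c - 1) = chi (- 1)"
      by (rule dc_cong[OF dc]) (simp add: cong_iff_dvd_diff)
    ultimately show "chi v * (\<Sum>m\<in>{0..<int c}. additive_char (real_of_int (m * (v + 1)) / real c))
        = (if v = int c - 1 then chi (- 1) * of_nat c else 0)"
      by (subst additive_char_sum[OF c0]) auto
  qed
  also have "\<dots> = chi (- 1) * of_nat c" using c0 by simp
  finally show ?thesis .
qed

text \<open>The Gauss sum of the character induced by \<open>chi\<close> to modulus
  \<open>C\<close>. The explicit coprimality condition is essential: \<open>chi\<close> belongs to a
  smaller modulus and need not vanish at integers that share a factor with \<open>C\<close>.\<close>

definition unit_gauss_sum :: "(int \<Rightarrow> complex) \<Rightarrow> nat \<Rightarrow> int \<Rightarrow> complex" where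
  "unit_gauss_sum chi C n =
     (\<Sum>v | v \<in> {0..<int C} \<and> coprime v (int C). chi v * additive_char (real_of_int (v * n) / real C))"

text \<open>Writing \<open>v = r + c * t\<close>, the character sees only \<open>r\<close>, and the
  sum over \<open>t\<close> forces \<open>d\<close> to divide \<open>n\<close>.\<close>

lemma gauss_sum_multiple_modulus:
  assumes prim: "primitive_dirichlet_character c chi" and d: "d > 0"
  shows "(\<Sum>v\<in>{0..<int (c * d)}. chi v * additive_char (real_of_int (v * n) / real (c * d))) =
    (if int d dvd n then of_nat d * cnj (chi (n div int d)) * gauss_sum c chi else 0)"
proof -
  have dc: "dirichlet_character c chi" using prim by (rule primitive_imp_dc)
  have c0: "c > 0" using dc_pos[OF dc] .
  have shift: "chi (r + int c * t) * additive_char (real_of_int ((r + int c * t) * n) / real (c * d))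
     = chi r * additive_char (real_of_int (r * n) / real (c * d)) * additive_char (real_of_int (t * n) / real d)" for r t
  proof -
    have "real_of_int ((r + int c * t) * n) / real (c * d) = real_of_int (r * n) / real (c * d) + real_of_int (t * n) / real d"
      using c0 d by (simp add: field_simps)
    moreover have "chi (r + int c * t) = chi r"
      by (rule dc_cong[OF dc]) (simp add: cong_def)
    ultimately show ?thesis by (simp add: additive_char_add)
  qed
  have "(\<Sum>v\<in>{0..<int (c * d)}. chi v * additive_char (real_of_int (v * n) / real (c * d)))
     = (\<Sum>r\<in>{0..<int c}. chi r * additive_char (real_of_int (r * n) / real (c * d))) * (if int d dvd n then of_nat d else 0)"
    by (subst sum_residues_split[OF c0 d], unfold shift sum_distrib_left [symmetric], subst additive_char_sum[OF d])
       (simp add: sum_distrib_right)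
  moreover have "(\<Sum>r\<in>{0..<int c}. chi r * additive_char (real_of_int (r * n) / real (c * d)))
     = cnj (chi (n div int d)) * gauss_sum c chi" if dn: "int d dvd n"
  proof -
    have "real_of_int (r * n) / real (c * d) = real_of_int (r * (n div int d)) / real c" for r
      using dn d by (auto elim!: dvdE)
    then show ?thesis using primitive_gauss_sum[OF prim, of "n div int d"] by simp
  qed
  ultimately show ?thesis by simp
qed

text \<open>Since \<open>chi\<close> already vanishes off the units modulo \<open>c\<close>, only
  coprimality to \<open>l\<close> has to be imposed, and Moebius inversion does this. Multiples
  \<open>v = k * w\<close> contribute \<open>chi k\<close> times an unrestricted sum modulo
  \<open>c * d\<close> with \<open>d = l div k\<close>.\<close>

lemma unit_gauss_sum_formula:
  assumes prim: "primitive_dirichlet_character c chi" and l: "l > 0"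
  shows "unit_gauss_sum chi (c * l) n = gauss_sum c chi *
    (\<Sum>d | d dvd l \<and> int d dvd n. of_nat d * cnj (chi (n div int d)) * chi (int (l div d)) * moebius_mu (l div d))"
proof -
  have dc: "dirichlet_character c chi" using prim by (rule primitive_imp_dc)
  have c0: "c > 0" using dc_pos[OF dc] .
  define F where "F v = chi v * additive_char (real_of_int (v * n) / real (c * l))" for v
  have ind: "(\<Sum>k | k dvd l \<and> int k dvd v. moebius_mu k) = (if coprime v (int l) then 1 else 0)" for v
  proof -
    define g where "g = nat (gcd v (int l))"
    have g: "int g = gcd v (int l)" by (simp add: g_def)
    then have "g > 0" using l by (metis gcd_pos_int of_nat_0_less_iff less_irrefl)
    moreover have "{k. k dvd l \<and> int k dvd v} = {k. k dvd g}"
      by (metis (no_types, lifting) g gcd_greatest_iff int_dvd_int_iff)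
    moreover have "g = 1 \<longleftrightarrow> coprime v (int l)"
      using g by (metis coprime_iff_gcd_eq_1 of_nat_eq_1_iff)
    ultimately show ?thesis by (simp add: moebius_sum)
  qed
  have "unit_gauss_sum chi (c * l) n = (\<Sum>v\<in>{0..<int (c * l)}. F v * (if coprime v (int l) then 1 else 0))"
    unfolding unit_gauss_sum_def
    by (rule sum.mono_neutral_cong_left) (auto simp: F_def dc_eq_0_iff[OF dc])
  also have "\<dots> = (\<Sum>v\<in>{0..<int (c * l)}. \<Sum>k | k dvd l. if int k dvd v then moebius_mu k * F v else 0)"
  proof (intro sum.cong refl)
    fix v
    have "(\<Sum>k | k dvd l. if int k dvd v then moebius_mu k * F v else 0) = (\<Sum>k | k dvd l \<and> int k dvd v. moebius_mu k * F v)"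
      using l by (intro sum.mono_neutral_cong_right) auto
    also have "\<dots> = F v * (if coprime v (int l) then 1 else 0)"
      unfolding ind [symmetric] by (simp add: sum_distrib_left mult.commute)
    finally show "F v * (if coprime v (int l) then 1 else 0) = (\<Sum>k | k dvd l. if int k dvd v then moebius_mu k * F v else 0)" ..
  qed
  also have "\<dots> = (\<Sum>k | k dvd l. \<Sum>v\<in>{0..<int (c * l)}. if int k dvd v then moebius_mu k * F v else 0)"
    by (rule sum.swap)
  also have "\<dots> = (\<Sum>k | k dvd l. moebius_mu k * chi (int k) *
      (if int (l div k) dvd n then of_nat (l div k) * cnj (chi (n div int (l div k))) * gauss_sum c chi else 0))"
  proof (intro sum.cong refl)
    fix k assume "k \<in> {k. k dvd l}"
    then obtain d where ld: "l = k * d" by (auto elim: dvdE)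
    then have kd: "k > 0" "d > 0" using l by auto
    have "(\<Sum>v\<in>{0..<int (c * l)}. if int k dvd v then moebius_mu k * F v else 0) = (\<Sum>v | v \<in> {0..<int (c * l)} \<and> int k dvd v. moebius_mu k * F v)"
      by (rule sum.inter_filter [symmetric]) simp
    also have "\<dots> = (\<Sum>w\<in>{0..<int (c * d)}. moebius_mu k * F (int k * w))"
    proof (rule sum.reindex_bij_witness[of _ "\<lambda>w. int k * w" "\<lambda>v. v div int k"])
      fix v assume "v \<in> {v. v \<in> {0..<int (c * l)} \<and> int k dvd v}"
      then obtain w where w: "v = int k * w" "0 \<le> v" "v < int (c * l)" by auto
      then have "int k * w < int k * int (c * d)" by (simp add: ld mult_ac)
      then have "w < int (c * d)" using kd by simp
      moreover have "0 \<le> w" using w kd by (simp add: zero_le_mult_iff)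
      ultimately show "v div int k \<in> {0..<int (c * d)}" using w kd by simp
    next
      fix w assume "w \<in> {0..<int (c * d)}"
      then have w: "0 \<le> w" "w < int (c * d)" by auto
      then have "int k * w < int k * int (c * d)" using kd by (intro mult_strict_left_mono) auto
      then show "int k * w \<in> {v. v \<in> {0..<int (c * l)} \<and> int k dvd v}"
        using w by (auto simp: ld mult_ac)
    qed (use kd in auto)
    also have "\<dots> = (\<Sum>w\<in>{0..<int (c * d)}. moebius_mu k * chi (int k) * (chi w * additive_char (real_of_int (w * n) / real (c * d))))"
    proof (intro sum.cong refl)
      fix w
      have "real_of_int (int k * w * n) / real (c * l) = real_of_int (w * n) / real (c * d)"
        using kd by (simp add: ld)
      then show "moebius_mu k * F (int k * w) = moebius_mu k * chi (int k) * (chi w * additive_char (real_of_int (w * n) / real (c * d)))"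
        by (simp add: F_def dc_mult[OF dc])
    qed
    also have "\<dots> = moebius_mu k * chi (int k) * (if int d dvd n then of_nat d * cnj (chi (n div int d)) * gauss_sum c chi else 0)"
      by (simp only: sum_distrib_left [symmetric] gauss_sum_multiple_modulus[OF prim kd(2)])
    finally show "(\<Sum>v\<in>{0..<int (c * l)}. if int k dvd v then moebius_mu k * F v else 0) = moebius_mu k * chi (int k) *
      (if int (l div k) dvd n then of_nat (l div k) * cnj (chi (n div int (l div k))) * gauss_sum c chi else 0)"
      using kd by (simp add: ld)
  qed
  also have "\<dots> = (\<Sum>d | d dvd l. if int d dvd n then
      moebius_mu (l div d) * chi (int (l div d)) * (of_nat d * cnj (chi (n div int d)) * gauss_sum c chi) else 0)"
    by (rule sum.reindex_bij_witness[of _ "\<lambda>d. l div d" "\<lambda>d. l div d"]) (use l in \<open>auto elim!: dvdE\<close>)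
  also have "\<dots> = (\<Sum>d | d dvd l \<and> int d dvd n. moebius_mu (l div d) * chi (int (l div d)) * (of_nat d * cnj (chi (n div int d)) * gauss_sum c chi))"
    using l by (intro sum.mono_neutral_cong_right) auto
  finally show ?thesis
    by (simp add: sum_distrib_left mult_ac)
qed

subsection \<open>Hecke relations\<close>

text \<open>The variable \<open>a\<close> is determined by the other two. The second argument of
  \<open>A\<close> parses as \<open>(m div (b * c) * n1) div b\<close>, where the last division is
  exact because \<open>b\<close> divides \<open>n1\<close>.\<close>

lemma hecke_pairs:
  assumes hecke: "hecke_relations N \<psi> A" and pos: "m > 0" "n1 > 0" "n2 > 0" and cop: "coprime (n1 * n2) N"
  shows "A 1 m * A n2 n1 =
    (\<Sum>(b, c) | b dvd n1 \<and> c dvd n2 \<and> b * c dvd m. A (b * n2 div c) (m div (b * c) * n1 div b) * \<psi> (int c))"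
proof -
  have "A 1 m * A n2 n1 = (\<Sum>(a, b, c) | a * b * c = m \<and> b dvd n1 \<and> c dvd n2.
             A (b * n2 div c) (a * n1 div b) * \<psi> (int c))"
    using hecke pos cop unfolding hecke_relations_def by blast
  also have "\<dots> = (\<Sum>(b, c) | b dvd n1 \<and> c dvd n2 \<and> b * c dvd m. A (b * n2 div c) (m div (b * c) * n1 div b) * \<psi> (int c))"
    by (rule sum.reindex_bij_witness[of _ "\<lambda>(b, c). (m div (b * c), b, c)" "\<lambda>(a, b, c). (b, c)"])
       (use pos in \<open>auto simp: mult.assoc\<close>)
  finally show ?thesis .
qed

lemma finite_dvd_pairs:
  fixes d :: nat and Q :: "nat \<Rightarrow> nat"
  assumes "d > 0" "\<And>f. f dvd d \<Longrightarrow> 0 < Q f"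
  shows "finite {(f, g). f dvd d \<and> g dvd Q f}"
proof -
  have "{(f, g). f dvd d \<and> g dvd Q f} = (SIGMA f:{f. f dvd d}. {g. g dvd Q f})" by auto
  also have "finite \<dots>"
  proof (intro finite_SigmaI)
    show "finite {g. g dvd Q f}" if "f \<in> {f. f dvd d}" for f
      using assms(2)[of f] that by simp
  qed (use assms(1) in simp)
  finally show ?thesis .
qed

text \<open>Pieri-type inversion: expanding the right-hand side by the Hecke relation, the sums over \<open>f * b\<close>
  and \<open>g * c\<close> collapse by Moebius inversion.  The condition on \<open>g\<close> is \<open>g dvd q * f\<close>, not \<open>g dvd q\<close>.\<close>

lemma hecke_inversion:
  assumes hecke: "hecke_relations N \<psi> A" and \<psi>: "dirichlet_character N \<psi>"
    and pos: "q > 0" "d > 0" "m > 0" and cop: "coprime (q * d) N"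
  shows "A q (d * m) =
    (\<Sum>(f, g) | f dvd d \<and> g dvd q * f. moebius_mu f * moebius_mu g * \<psi> (int g) *
        (if f * g dvd m then A 1 (m div (f * g)) else 0) * A (q * f div g) (d div f))"
proof -
  \<comment> \<open>The Hecke expansion of the term indexed by \<open>(f, g)\<close> depends on
    \<open>f, b\<close> and on \<open>g, c\<close> through the products \<open>k = f * b\<close> and
    \<open>l = g * c\<close> only, apart from the Moebius factors.\<close>
  define Z where "Z k l = A (q * k div l) (m div (k * l) * (d div k)) * \<psi> (int l)" for k l
  define I where "I = {(f, g). f dvd d \<and> g dvd q * f}"
  define J where "J f g = {(b, c). b dvd d div f \<and> c dvd q * f div g \<and> b * c dvd m div (f * g)}" for f g
  define I' where "I' = {(f, g). f dvd d \<and> g dvd q * f \<and> f * g dvd m}"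
  have finI: "finite I" unfolding I_def by (rule finite_dvd_pairs) (use pos in \<open>auto intro: gr0I\<close>)
  then have finI': "finite I'" by (rule rev_finite_subset) (auto simp: I_def I'_def)
  have finJ: "finite (J f g)" if "(f, g) \<in> I'" for f g
  proof -
    have "0 < d div f" "0 < q * f div g"
      using that pos by (auto simp: I'_def elim!: dvdE intro!: gr0I)
    then have "finite {(b, c). b dvd d div f \<and> c dvd q * f div g}"
      by (intro finite_dvd_pairs)
    then show ?thesis by (rule rev_finite_subset) (auto simp: J_def)
  qed
  have fg: "moebius_mu f * moebius_mu g * \<psi> (int g) * A 1 (m div (f * g)) * A (q * f div g) (d div f)
      = (\<Sum>(b, c)\<in>J f g. moebius_mu f * (moebius_mu g * Z (f * b) (g * c)))" if "(f, g) \<in> I'" for f g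
  proof -
    from that obtain d' q' m' where ex: "d = f * d'" "q * f = g * q'" "m = f * g * m'"
      by (auto simp: I'_def elim!: dvdE)
    then have fgpos: "f > 0" "g > 0" "d' > 0" "q' > 0" "m' > 0" using pos by (auto intro!: gr0I)
    have "coprime (d' * q') N"
    proof -
      have "coprime d' N" using cop ex by auto
      moreover have "coprime f N" using cop ex by auto
      then have "coprime (q * f) N" using cop by auto
      then have "coprime q' N" by (simp add: ex)
      ultimately show ?thesis by simp
    qed
    then have "A 1 m' * A q' d' = (\<Sum>(b, c) | b dvd d' \<and> c dvd q' \<and> b * c dvd m'. A (b * q' div c) (m' div (b * c) * d' div b) * \<psi> (int c))"
      using fgpos by (intro hecke_pairs[OF hecke]) auto
    also have "{(b, c). b dvd d' \<and> c dvd q' \<and> b * c dvd m'} = J f g"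
      using fgpos by (simp add: J_def ex)
    finally have "moebius_mu f * moebius_mu g * \<psi> (int g) * (A 1 m' * A q' d')
        = (\<Sum>(b, c)\<in>J f g. moebius_mu f * (moebius_mu g * (\<psi> (int g) * (A (b * q' div c) (m' div (b * c) * d' div b) * \<psi> (int c)))))"
      by (simp add: sum_distrib_left mult.assoc case_prod_unfold)
    also have "\<dots> = (\<Sum>(b, c)\<in>J f g. moebius_mu f * (moebius_mu g * Z (f * b) (g * c)))"
    proof (intro sum.cong refl, clarify)
      fix b c assume "(b, c) \<in> J f g"
      then have "b dvd d'" "c dvd q'" "b * c dvd m'" using fgpos by (auto simp: J_def ex)
      then obtain d'' q'' m'' where ex': "d' = b * d''" "q' = c * q''" "m' = b * c * m''"
        by (auto elim!: dvdE)
      have bc: "b > 0" "c > 0" using fgpos ex' by auto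
      have "b * q' div c = b * q''" using bc by (simp add: ex')
      moreover have "q * (f * b) div (g * c) = b * q''"
      proof -
        have "q * (f * b) = (g * c) * (b * q'')" using ex(2) ex'(2) by (simp add: mult_ac)
        then show ?thesis using bc fgpos by (metis mult_pos_pos nonzero_mult_div_cancel_left less_irrefl)
      qed
      moreover have "m' div (b * c) * d' div b = m'' * d''" using bc by (simp add: ex')
      moreover have "m div (f * b * (g * c)) * (d div (f * b)) = m'' * d''"
      proof -
        have "m = f * b * (g * c) * m''" "d = f * b * d''" using ex ex' by simp_all
        then show ?thesis using bc fgpos by (metis mult_pos_pos nonzero_mult_div_cancel_left less_irrefl)
      qed
      moreover have "\<psi> (int (g * c)) = \<psi> (int g) * \<psi> (int c)"
        by (simp add: dc_mult[OF \<psi>])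
      ultimately show "moebius_mu f * (moebius_mu g * (\<psi> (int g) * (A (b * q' div c) (m' div (b * c) * d' div b) * \<psi> (int c))))
          = moebius_mu f * (moebius_mu g * Z (f * b) (g * c))"
        by (simp add: Z_def)
    qed
    finally show ?thesis using fgpos by (simp add: ex mult.assoc)
  qed
  have "(\<Sum>(f, g)\<in>I. moebius_mu f * moebius_mu g * \<psi> (int g) *
        (if f * g dvd m then A 1 (m div (f * g)) else 0) * A (q * f div g) (d div f))
      = (\<Sum>(f, g)\<in>I'. moebius_mu f * moebius_mu g * \<psi> (int g) * A 1 (m div (f * g)) * A (q * f div g) (d div f))"
    by (rule sum.mono_neutral_cong_right) (use finI in \<open>auto simp: I_def I'_def split: if_splits\<close>)
  also have "\<dots> = (\<Sum>(f, g)\<in>I'. \<Sum>(b, c)\<in>J f g. moebius_mu f * (moebius_mu g * Z (f * b) (g * c)))"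
    by (intro sum.cong refl) (auto simp: fg simp del: One_nat_def)
  also have "\<dots> = (\<Sum>((f, g), (b, c))\<in>(SIGMA p:I'. J (fst p) (snd p)). moebius_mu f * (moebius_mu g * Z (f * b) (g * c)))"
    using finI' finJ by (subst sum.Sigma [symmetric]) (auto simp: case_prod_unfold)
  \<comment> \<open>Exchanging \<open>g\<close> and \<open>b\<close> makes the conditions on
    \<open>g\<close> and \<open>c\<close> a condition on \<open>g * c\<close>. Its bound
    \<open>q * f\<close> still involves \<open>f\<close> alone, so the pair \<open>(g, c)\<close>
    has to be collapsed before \<open>(f, b)\<close>.\<close>
  also have "\<dots> = (\<Sum>((f, b), (g, c))\<in>(SIGMA p:{(f, b). f * b \<in> {k. k dvd d}}. {(g, c). g * c \<in> {l. l dvd q * fst p \<and> fst p * snd p * l dvd m}}).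
      moebius_mu f * (moebius_mu g * Z (f * b) (g * c)))"
  proof (rule sum.reindex_bij_witness[of _ "\<lambda>((f, b), (g, c)). ((f, g), (b, c))" "\<lambda>((f, g), (b, c)). ((f, b), (g, c))"], goal_cases)
    case (2 x)
    then obtain f g b c where x: "x = ((f, g), (b, c))" and fg: "(f, g) \<in> I'" and bc: "(b, c) \<in> J f g" by auto
    then obtain d' q' m' where ex: "d = f * d'" "q * f = g * q'" "m = f * g * m'"
      by (auto simp: I'_def elim!: dvdE)
    then have fgpos: "f > 0" "g > 0" using pos by (auto intro!: gr0I)
    then have "b dvd d'" "c dvd q'" "b * c dvd m'" using bc by (auto simp: J_def ex)
    then have "f * b dvd d" "g * c dvd q * f" "f * g * (b * c) dvd m"
      unfolding ex by (auto intro: mult_dvd_mono)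
    then show ?case by (simp add: x mult_ac)
  next
    case (4 x)
    then obtain f g b c where x: "x = ((f, b), (g, c))" and fb: "f * b dvd d" and gc: "g * c dvd q * f" "f * b * (g * c) dvd m" by auto
    have 1: "f dvd d" "g dvd q * f" using fb gc by (meson dvd_mult_left)+
    have 2: "f * g dvd m" using gc(2) by (metis dvd_mult_left mult.assoc mult.left_commute)
    obtain d' q' m' where ex: "d = f * d'" "q * f = g * q'" "m = f * g * m'"
      using 1 2 by (auto elim!: dvdE)
    then have fgpos: "f > 0" "g > 0" using pos by (auto intro!: gr0I)
    have "f * g * (b * c) dvd f * g * m'" using gc(2) by (simp add: ex mult_ac)
    then have "b * c dvd m'" using fgpos by simp
    then have "(b, c) \<in> J f g" using fb gc fgpos by (auto simp: J_def ex)
    then show ?case using 1 2 by (auto simp: x I'_def)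
  qed auto
  also have "\<dots> = (\<Sum>(f, b) | f * b \<in> {k. k dvd d}. \<Sum>(g, c) | g * c \<in> {l. l dvd q * f \<and> f * b * l dvd m}.
      moebius_mu f * (moebius_mu g * Z (f * b) (g * c)))"
  proof -
    have fin1: "finite {(f, b). f * b \<in> {k. k dvd d}}"
      by (rule finite_subset[of _ "{k. k dvd d} \<times> {k. k dvd d}"]) (use pos in \<open>auto dest: dvd_mult_left dvd_mult_right\<close>)
    have fin2: "finite {(g, c). g * c \<in> {l. l dvd q * fst p \<and> fst p * snd p * l dvd m}}"
      if "p \<in> {(f, b). f * b \<in> {k. k dvd d}}" for p
      by (rule finite_subset[of _ "{k. k dvd q * fst p} \<times> {k. k dvd q * fst p}"])
         (use pos that in \<open>auto dest: dvd_mult_left dvd_mult_right intro!: finite_cartesian_product gr0I\<close>)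
    show ?thesis
      using fin1 fin2 by (subst sum.Sigma [symmetric]) (auto simp: case_prod_unfold)
  qed
  \<comment> \<open>Only \<open>g * c = 1\<close> survives, and with it the separate dependence on
    \<open>f\<close> disappears: what remains is a function of \<open>f * b\<close>, ready for the
    second collapse.\<close>
  also have "\<dots> = (\<Sum>(f, b) | f * b \<in> {k. k dvd d}. moebius_mu f * (if f * b dvd m then Z (f * b) 1 else 0))"
  proof (intro sum.cong refl, clarify)
    fix f b assume fb: "f * b dvd d"
    define K where "K = {l. l dvd q * f \<and> f * b * l dvd m}"
    have "q * f > 0" using fb pos by (auto intro!: gr0I)
    then have K: "finite K" "0 \<notin> K" using pos by (auto simp: K_def)
    have "(\<Sum>(g, c) | g * c \<in> K. moebius_mu f * (moebius_mu g * Z (f * b) (g * c)))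
       = moebius_mu f * (\<Sum>(g, c) | g * c \<in> K. moebius_mu g * Z (f * b) (g * c))"
      by (simp add: sum_distrib_left case_prod_unfold)
    also have "\<dots> = moebius_mu f * (if f * b dvd m then Z (f * b) 1 else 0)"
      by (subst moebius_collapse[OF K]) (auto simp: K_def)
    finally show "(\<Sum>(g, c) | g * c \<in> {l. l dvd q * f \<and> f * b * l dvd m}. moebius_mu f * (moebius_mu g * Z (f * b) (g * c)))
       = moebius_mu f * (if f * b dvd m then Z (f * b) 1 else 0)" by (simp add: K_def)
  qed
  also have "\<dots> = Z 1 1"
    using moebius_collapse[of "{k. k dvd d}" "\<lambda>k. if k dvd m then Z k 1 else 0"] pos by simp
  also have "\<dots> = A q (d * m)"
    using dc_1[OF \<psi>] by (simp add: Z_def mult.commute)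
  finally show ?thesis by (simp add: I_def)
qed

text \<open>Put \<open>k = l div d\<close>. Then \<open>X k * X e = X (k * e)\<close>,
  \<open>d div e = l div (k * e)\<close>, and the range is \<open>k * e * f dvd l\<close>, so for
  fixed \<open>f\<close> Moebius inversion over the product leaves \<open>k * e = 1\<close>. It
  removes the sum over divisors of \<open>l\<close> that the induced Gauss sum introduces.\<close>

lemma moebius_twisted_collapse:
  fixes X :: "nat \<Rightarrow> complex"
  assumes l: "l > 0" and X: "\<And>a b. X (a * b) = X a * X b" "X 1 = 1"
  shows "(\<Sum>(d, f) | d dvd l \<and> f dvd d. X (l div d) * moebius_mu (l div d) * (\<Sum>e | e dvd d div f. X e * V f (d div e)))
     = (\<Sum>f | f dvd l. V f l)"
proof -
  have fin: "finite {f. f dvd l}" using l by simp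
  have fin2: "finite {(k, e). k * e \<in> {t. t * f dvd l}}" for f
  proof (rule finite_subset)
    show "{(k, e). k * e \<in> {t. t * f dvd l}} \<subseteq> {k. k dvd l} \<times> {k. k dvd l}"
      by (auto dest: dvd_mult_left dvd_mult_right)
  qed (use fin in simp)
  have fin3: "finite {(d, f). d dvd l \<and> f dvd d}"
    by (rule finite_dvd_pairs) (use l in \<open>auto intro: gr0I\<close>)
  have pos: "d div f > 0" if "d dvd l" "f dvd d" for d f
    using that l by (auto elim!: dvdE)
  have "(\<Sum>(d, f) | d dvd l \<and> f dvd d. X (l div d) * moebius_mu (l div d) * (\<Sum>e | e dvd d div f. X e * V f (d div e)))
     = (\<Sum>((d, f), e)\<in>(SIGMA p:{(d, f). d dvd l \<and> f dvd d}. {e. e dvd fst p div snd p}).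
          X (l div d) * moebius_mu (l div d) * (X e * V f (d div e)))"
    using fin3 pos by (subst sum.Sigma [symmetric]) (auto simp: sum_distrib_left case_prod_unfold)
  also have "\<dots> = (\<Sum>(f, (k, e))\<in>(SIGMA f:{f. f dvd l}. {(k, e). k * e \<in> {t. t * f dvd l}}).
          moebius_mu k * (X (k * e) * V f (l div (k * e))))"
  proof (rule sum.reindex_bij_witness[of _ "\<lambda>(f, (k, e)). ((l div k, f), e)" "\<lambda>((d, f), e). (f, (l div d, e))"], goal_cases)
    case (1 x)
    then obtain d f e where x: "x = ((d, f), e)" "d dvd l" by auto
    then show ?case using l by (auto elim!: dvdE)
  next
    case (2 x)
    then obtain d f e where x: "x = ((d, f), e)" and d: "d dvd l" "f dvd d" "e dvd d div f" by auto
    obtain k where k: "l = d * k" using d by (auto elim: dvdE)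
    obtain d' where d': "d = f * d'" using d by (auto elim: dvdE)
    have p: "f > 0" "d' > 0" "k > 0" using l k d' by auto
    obtain d'' where "d' = e * d''" using d d' p by (auto elim: dvdE)
    then show ?case using p by (auto simp: x k d')
  next
    case (3 x)
    then obtain f k e where x: "x = (f, (k, e))" and kef: "k * e * f dvd l" by auto
    then have "k dvd l" by (metis dvd_mult_left mult.assoc)
    then show ?case using l by (auto simp: x elim!: dvdE)
  next
    case (4 x)
    then obtain f k e where x: "x = (f, (k, e))" and kef: "k * e * f dvd l" by auto
    then obtain t where t: "l = k * e * f * t" by (auto elim: dvdE)
    then have p: "k > 0" "e > 0" "f > 0" "t > 0" using l by auto
    have "l div k = f * (e * t)" using p by (simp add: t mult_ac)
    \<comment> \<open>With \<open>d = l div k = f * (e * t)\<close> the divisibilities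
      \<open>f dvd d\<close> and \<open>e dvd d div f\<close> can be read off.\<close>
    then show ?case using p by (auto simp: x) (auto simp: t)
  next
    case (5 x)
    then obtain d f e where x: "x = ((d, f), e)" and d: "d dvd l" "f dvd d" "e dvd d div f" by auto
    obtain k where k: "l = d * k" using d by (auto elim: dvdE)
    have "e dvd d" using d by (metis dvd_div_mult_self dvd_mult2 mult.commute dvd_trans)
    then obtain t where t: "d = e * t" by (auto elim: dvdE)
    have p: "k > 0" "e > 0" "t > 0" using l k t by auto
    have "l div (k * e) = t" "l div d = k" "d div e = t" using p by (simp_all add: k t)
    then show ?case by (simp add: x X)
  qed
  also have "\<dots> = (\<Sum>f | f dvd l. \<Sum>(k, e) | k * e \<in> {t. t * f dvd l}. moebius_mu k * (X (k * e) * V f (l div (k * e))))"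
    using fin fin2 by (subst sum.Sigma [symmetric]) (auto simp del: mem_Collect_eq)
  also have "\<dots> = (\<Sum>f | f dvd l. V f l)"
  proof (intro sum.cong refl)
    fix f assume "f \<in> {f. f dvd l}"
    then have f: "f dvd l" "f > 0" using l by (auto intro: gr0I)
    have "{t. t * f dvd l} \<subseteq> {t. t dvd l}" by (auto dest: dvd_mult_left)
    then have K: "finite {t. t * f dvd l}" "0 \<notin> {t. t * f dvd l}" using l fin by (blast intro: finite_subset, simp)
    show "(\<Sum>(k, e) | k * e \<in> {t. t * f dvd l}. moebius_mu k * (X (k * e) * V f (l div (k * e)))) = V f l"
      by (subst moebius_collapse[OF K, of "\<lambda>t. X t * V f (l div t)"]) (use f X in simp)
  qed
  finally show ?thesis .
qed

subsection \<open>Dirichlet series\<close>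

text \<open>Unconditional summation over the positive integers, so that coefficients may be
  reindexed along multiples of \<open>k\<close>; ordered summation, used in
  \<open>dirichlet_series_continuation\<close>, does not give this directly.\<close>

definition ds_sums :: "(nat \<Rightarrow> complex) \<Rightarrow> complex \<Rightarrow> complex \<Rightarrow> bool" where
  "ds_sums f s S \<longleftrightarrow> ((\<lambda>n. f n / of_nat n powr s) has_sum S) {0<..}"

text \<open>The bridge between the two notions of convergence: it follows from ordered convergence
  at one point and yields unconditional convergence further to the right.\<close>

definition poly_growth :: "(nat \<Rightarrow> complex) \<Rightarrow> nat \<Rightarrow> bool" where
  "poly_growth f k \<longleftrightarrow> (\<exists>K. \<forall>n>0. norm (f n) \<le> K * real n ^ k)"

lemma of_nat_powr_mult: "(of_nat (a * b) :: complex) powr s = of_nat a powr s * of_nat b powr s"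
  by (simp add: powr_times_real)

lemma ds_sums_Suc_iff: "ds_sums f s S \<longleftrightarrow> ((\<lambda>k. f (Suc k) / of_nat (Suc k) powr s) has_sum S) UNIV"
proof -
  have "{0::nat<..} = range Suc"
    by (auto simp: image_iff gr0_conv_Suc)
  then show ?thesis
    unfolding ds_sums_def by (simp add: has_sum_reindex comp_def del: of_nat_Suc)
qed

lemma ds_sums_imp_sums: "ds_sums f s S \<Longrightarrow> (\<lambda>k. f (Suc k) / of_nat (Suc k) powr s) sums S"
  unfolding ds_sums_Suc_iff by (rule has_sum_imp_sums)

lemma ds_sums_unique: "ds_sums f s S \<Longrightarrow> ds_sums f s S' \<Longrightarrow> S = S'"
  unfolding ds_sums_def using infsumI by blast

lemma ds_sums_cong: "(\<And>n. n > 0 \<Longrightarrow> f n = g n) \<Longrightarrow> ds_sums f s S \<longleftrightarrow> ds_sums g s S"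
  unfolding ds_sums_def by (intro has_sum_cong) auto

lemma ds_sums_cmult: "ds_sums f s S \<Longrightarrow> ds_sums (\<lambda>n. a * f n) s (a * S)"
  unfolding ds_sums_def by (drule has_sum_cmult_right[of _ _ _ a]) simp

lemma ds_sums_sum:
  "(\<And>i. i \<in> I \<Longrightarrow> ds_sums (f i) s (S i)) \<Longrightarrow> ds_sums (\<lambda>n. \<Sum>i\<in>I. f i n) s (\<Sum>i\<in>I. S i)"
  unfolding ds_sums_def sum_divide_distrib
  by (induction I rule: infinite_finite_induct) (auto intro!: has_sum_add)

text \<open>Multiplication of the series by \<open>k\<close> to the power \<open>-s\<close> carries
  the coefficient at \<open>n\<close> to the place \<open>k * n\<close>.\<close>

lemma ds_sums_shift:
  assumes "ds_sums h s S" "k > 0"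
  shows "ds_sums (\<lambda>n. if k dvd n then h (n div k) else 0) s (S / of_nat k powr s)"
proof -
  have "((\<lambda>n. h n / of_nat n powr s / of_nat k powr s) has_sum S / of_nat k powr s) {0<..}"
    using has_sum_cmult_right[OF assms(1)[unfolded ds_sums_def], of "1 / of_nat k powr s"]
    by (simp add: mult.commute)
  moreover have "(\<lambda>n. h n / of_nat n powr s / of_nat k powr s) = (\<lambda>n. h (n div k) / of_nat n powr s) \<circ> (*) k"
  proof
    fix n
    show "h n / of_nat n powr s / of_nat k powr s = ((\<lambda>n. h (n div k) / of_nat n powr s) \<circ> (*) k) n"
      unfolding comp_def of_nat_powr_mult using assms(2) by (simp add: mult.commute)
  qed
  ultimately have "((\<lambda>n. h (n div k) / of_nat n powr s) \<circ> (*) k has_sum S / of_nat k powr s) {0<..}"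
    by simp
  then have "((\<lambda>n. h (n div k) / of_nat n powr s) has_sum S / of_nat k powr s) ((*) k ` {0<..})"
    by (subst has_sum_reindex) (use assms(2) in \<open>auto simp: inj_on_def\<close>)
  then show ?thesis
    unfolding ds_sums_def
    by (rule has_sum_cong_neutral[THEN iffD1, rotated 3])
       (use assms(2) in \<open>auto simp: image_iff elim!: dvdE\<close>)
qed

lemma poly_growth_imp_ds_sums:
  assumes "poly_growth f k" "Re s > real k + 1"
  obtains S where "ds_sums f s S"
proof -
  obtain K where K: "\<And>n. n > 0 \<Longrightarrow> norm (f n) \<le> K * real n ^ k"
    using assms(1) by (auto simp: poly_growth_def)
  have "summable (\<lambda>n. norm (f (Suc n) / of_nat (Suc n) powr s))"
  proof (rule summable_comparison_test')
    have "summable (\<lambda>n. real n powr (real k - Re s))"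
      using assms(2) by (simp add: summable_real_powr_iff)
    then have "summable (\<lambda>n. real (Suc n) powr (real k - Re s))"
      by (subst summable_Suc_iff)
    then show "summable (\<lambda>n. K * real (Suc n) powr (real k - Re s))"
      by (rule summable_mult)
    fix n
    have "norm (f (Suc n) / of_nat (Suc n) powr s) = norm (f (Suc n)) / real (Suc n) powr Re s"
      by (simp add: norm_divide norm_powr_real_powr del: of_nat_Suc)
    also have "\<dots> \<le> K * real (Suc n) ^ k / real (Suc n) powr Re s"
      using K[of "Suc n"] by (intro divide_right_mono) auto
    also have "\<dots> = K * real (Suc n) powr (real k - Re s)"
      by (simp add: powr_diff powr_realpow del: of_nat_Suc)
    finally show "norm (norm (f (Suc n) / of_nat (Suc n) powr s)) \<le> K * real (Suc n) powr (real k - Re s)"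
      by simp
  qed
  then have "(\<lambda>n. f (Suc n) / of_nat (Suc n) powr s) summable_on UNIV"
    by (rule norm_summable_imp_summable_on)
  then obtain S where "((\<lambda>n. f (Suc n) / of_nat (Suc n) powr s) has_sum S) UNIV"
    by (auto simp: summable_on_def)
  then show ?thesis using that ds_sums_Suc_iff by blast
qed

lemma poly_growth_mono: "poly_growth f k \<Longrightarrow> (\<And>n. n > 0 \<Longrightarrow> norm (g n) \<le> norm (f n)) \<Longrightarrow> poly_growth g k"
  unfolding poly_growth_def by (meson order_trans)

lemma poly_growth_add:
  assumes "poly_growth f k" "poly_growth g k"
  shows "poly_growth (\<lambda>n. f n + g n) k"
proof -
  obtain K K' where "\<forall>n>0. norm (f n) \<le> K * real n ^ k" "\<forall>n>0. norm (g n) \<le> K' * real n ^ k"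
    using assms by (auto simp: poly_growth_def)
  then have "norm (f n + g n) \<le> (K + K') * real n ^ k" if "n > 0" for n
    unfolding distrib_right using that by (intro norm_triangle_le add_mono) auto
  then show ?thesis unfolding poly_growth_def by blast
qed

lemma poly_growth_cmult:
  assumes "poly_growth f k"
  shows "poly_growth (\<lambda>n. a * f n) k"
proof -
  obtain K where "\<forall>n>0. norm (f n) \<le> K * real n ^ k"
    using assms by (auto simp: poly_growth_def)
  then have "norm (a * f n) \<le> (norm a * K) * real n ^ k" if "n > 0" for n
    using that by (simp add: norm_mult mult.assoc mult_left_mono)
  then show ?thesis by (auto simp: poly_growth_def)
qed

lemma poly_growth_sum: "(\<And>i. i \<in> I \<Longrightarrow> poly_growth (f i) k) \<Longrightarrow> poly_growth (\<lambda>n. \<Sum>i\<in>I. f i n) k"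
proof (induction I rule: infinite_finite_induct)
  case (insert i I)
  then show ?case by (simp add: poly_growth_add)
qed (auto simp: poly_growth_def intro!: exI[of _ 0])

lemma poly_growth_shift:
  assumes "poly_growth h k" "l > 0"
  shows "poly_growth (\<lambda>n. if l dvd n then h (n div l) else 0) k"
proof -
  obtain K where K: "\<forall>n>0. norm (h n) \<le> K * real n ^ k"
    using assms by (auto simp: poly_growth_def)
  have K0: "K \<ge> 0" using order_trans[OF norm_ge_zero K[rule_format, of 1]] by simp
  have "norm (if l dvd n then h (n div l) else 0) \<le> K * real n ^ k" if "n > 0" for n
  proof (cases "l dvd n")
    case True
    then have pos: "n div l > 0" using that assms(2) by (auto elim!: dvdE)
    then have "norm (h (n div l)) \<le> K * real (n div l) ^ k" using K by simp
    also have "\<dots> \<le> K * real n ^ k"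
      using K0 by (intro mult_left_mono power_mono) (auto simp: div_le_dividend)
    finally show ?thesis using True by simp
  qed (use K0 in auto)
  then show ?thesis unfolding poly_growth_def by blast
qed

text \<open>At a point of convergence the terms tend to zero and are therefore bounded. An integer
  point beyond \<sigma> is chosen so that the bound is an integral power of
  \<open>n\<close>.\<close>

lemma dirichlet_series_continuation_growth:
  assumes "dirichlet_series_continuation f \<Phi>"
  obtains k where "poly_growth f k"
proof -
  obtain \<sigma> :: real where \<sigma>: "\<And>s. Re s > \<sigma> \<Longrightarrow> (\<lambda>k. f (Suc k) / of_nat (Suc k) powr s) sums \<Phi> s"
    using assms by (auto simp: dirichlet_series_continuation_def)
  define k where "k = nat \<lceil>max \<sigma> 0\<rceil> + 1"
  have k: "real k > \<sigma>" unfolding k_def by linarith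
  have "(\<lambda>n. f (Suc n) / of_nat (Suc n) powr (of_nat k)) \<longlonglongrightarrow> 0"
    using \<sigma>[of "of_nat k"] k by (intro summable_LIMSEQ_zero) (auto simp: sums_iff)
  then have "Bseq (\<lambda>n. f (Suc n) / of_nat (Suc n) powr (of_nat k))"
    by (intro convergent_imp_Bseq) (auto simp: convergent_def)
  then obtain K where K: "\<And>n. norm (f (Suc n) / of_nat (Suc n) powr (of_nat k)) \<le> K"
    by (auto simp: Bseq_def)
  have "norm (f n) \<le> K * real n ^ k" if "n > 0" for n
  proof -
    have m: "Suc (n - 1) = n" using that by simp
    have "norm (f n) / real n ^ k \<le> K"
      using K[of "n - 1"] that unfolding m
      by (simp add: norm_divide norm_powr_real_powr powr_realpow norm_power)
    then show ?thesis using that by (simp add: pos_divide_le_eq)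
  qed
  then have "poly_growth f k" unfolding poly_growth_def by blast
  then show ?thesis by (rule that)
qed

lemma dirichlet_series_continuation_iff:
  assumes "poly_growth f k"
  shows "dirichlet_series_continuation f \<Phi> \<longleftrightarrow>
    \<Phi> holomorphic_on UNIV \<and> (\<exists>\<sigma>::real. \<forall>s. Re s > \<sigma> \<longrightarrow> ds_sums f s (\<Phi> s))" (is "_ \<longleftrightarrow> ?R")
proof
  assume L: "dirichlet_series_continuation f \<Phi>"
  then obtain \<sigma> :: real where \<sigma>: "\<And>s. Re s > \<sigma> \<Longrightarrow> (\<lambda>k. f (Suc k) / of_nat (Suc k) powr s) sums \<Phi> s"
    by (auto simp: dirichlet_series_continuation_def)
  have "ds_sums f s (\<Phi> s)" if "Re s > max \<sigma> (real k + 1)" for s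
  proof -
    have "Re s > real k + 1" using that by simp
    then obtain S where S: "ds_sums f s S"
      by (rule poly_growth_imp_ds_sums[OF assms])
    moreover have "S = \<Phi> s"
      by (rule sums_unique2[OF ds_sums_imp_sums[OF S] \<sigma>]) (use that in simp)
    ultimately show ?thesis by simp
  qed
  then have "\<exists>\<sigma>::real. \<forall>s. Re s > \<sigma> \<longrightarrow> ds_sums f s (\<Phi> s)" by blast
  then show ?R using L by (simp add: dirichlet_series_continuation_def)
next
  assume ?R
  then show "dirichlet_series_continuation f \<Phi>"
    unfolding dirichlet_series_continuation_def using ds_sums_imp_sums by blast
qed

text \<open>Inserting the coefficients of \<open>h\<close> along multiples of finitely many
  \<open>k i\<close> multiplies the series by a Dirichlet polynomial, which is entire.\<close>

lemma dirichlet_series_continuation_combination: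
  assumes dsc: "dirichlet_series_continuation h L" and I: "finite I" and k: "\<And>i. i \<in> I \<Longrightarrow> k i > 0"
    and f: "\<And>n. n > 0 \<Longrightarrow> f n = (\<Sum>i\<in>I. \<alpha> i * (if k i dvd n then h (n div k i) else 0))"
  shows "dirichlet_series_continuation f (\<lambda>s. (\<Sum>i\<in>I. \<alpha> i / of_nat (k i) powr s) * L s)"
proof -
  obtain K where K: "poly_growth h K" using dirichlet_series_continuation_growth[OF dsc] .
  have "poly_growth (\<lambda>n. \<Sum>i\<in>I. \<alpha> i * (if k i dvd n then h (n div k i) else 0)) K"
    by (intro poly_growth_sum poly_growth_cmult poly_growth_shift K k)
  then have gf: "poly_growth f K"
    by (rule poly_growth_mono) (simp add: f)
  obtain \<sigma> :: real where \<sigma>: "\<And>s. Re s > \<sigma> \<Longrightarrow> ds_sums h s (L s)" and hol: "L holomorphic_on UNIV"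
    using dsc dirichlet_series_continuation_iff[OF K] by blast
  have "ds_sums f s ((\<Sum>i\<in>I. \<alpha> i / of_nat (k i) powr s) * L s)" if "Re s > \<sigma>" for s
  proof -
    have "ds_sums (\<lambda>n. \<Sum>i\<in>I. \<alpha> i * (if k i dvd n then h (n div k i) else 0)) s (\<Sum>i\<in>I. \<alpha> i * (L s / of_nat (k i) powr s))"
      by (intro ds_sums_sum ds_sums_cmult ds_sums_shift \<sigma> that k)
    then have "ds_sums f s (\<Sum>i\<in>I. \<alpha> i * (L s / of_nat (k i) powr s))"
      using ds_sums_cong[of f] f by simp
    then show ?thesis by (simp add: sum_distrib_right)
  qed
  moreover have "(\<lambda>s. (\<Sum>i\<in>I. \<alpha> i / of_nat (k i) powr s) * L s) holomorphic_on UNIV"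
    by (intro holomorphic_intros hol) (use k in fastforce)+
  ultimately show ?thesis
    using dirichlet_series_continuation_iff[OF gf] by blast
qed

lemma dirichlet_series_continuation_sum:
  fixes n :: nat
  assumes "\<And>i. i < n \<Longrightarrow> dirichlet_series_continuation (f i) (\<Phi> i)"
  shows "dirichlet_series_continuation (\<lambda>k. \<Sum>i<n. \<alpha> i * f i k) (\<lambda>s. \<Sum>i<n. \<alpha> i * \<Phi> i s)"
proof -
  have "\<exists>\<sigma>::real. \<forall>s. Re s > \<sigma> \<longrightarrow> (\<lambda>k. f i (Suc k) / of_nat (Suc k) powr s) sums \<Phi> i s" if "i < n" for i
    using assms[OF that] by (auto simp: dirichlet_series_continuation_def)
  then obtain \<sigma> :: "nat \<Rightarrow> real" where \<sigma>: "\<And>i s. i < n \<Longrightarrow> Re s > \<sigma> i \<Longrightarrow> (\<lambda>k. f i (Suc k) / of_nat (Suc k) powr s) sums \<Phi> i s"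
    by metis
  \<comment> \<open>The inserted 0 keeps the maximum defined for \<open>n = 0\<close>.\<close>
  have "(\<lambda>k. (\<Sum>i<n. \<alpha> i * f i (Suc k)) / of_nat (Suc k) powr s) sums (\<Sum>i<n. \<alpha> i * \<Phi> i s)"
    if "Re s > Max (insert 0 (\<sigma> ` {..<n}))" for s
  proof -
    have "Re s > \<sigma> i" if "i < n" for i
      using \<open>Re s > _\<close> that by simp
    then have "(\<lambda>k. \<Sum>i<n. \<alpha> i * (f i (Suc k) / of_nat (Suc k) powr s)) sums (\<Sum>i<n. \<alpha> i * \<Phi> i s)"
      by (intro sums_sum sums_mult \<sigma>) auto
    then show ?thesis by (simp add: sum_divide_distrib)
  qed
  moreover have "(\<lambda>s. \<Sum>i<n. \<alpha> i * \<Phi> i s) holomorphic_on UNIV"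
    using assms by (intro holomorphic_intros) (auto simp: dirichlet_series_continuation_def)
  ultimately show ?thesis unfolding dirichlet_series_continuation_def by blast
qed

subsection \<open>The twisted series\<close>

text \<open>Inversion with \<open>d = 1\<close> writes \<open>A q m\<close> as a fixed finite
  combination of values \<open>A 1 (m div k)\<close>, so the growth of the first row controls that
  of row \<open>q\<close>.\<close>

lemma hecke_growth:
  assumes hecke: "hecke_relations N \<psi> A" and \<psi>: "dirichlet_character N \<psi>"
    and growth: "poly_growth (A 1) k" and q: "q > 0" "coprime q N"
  shows "poly_growth (A q) k"
proof -
  define I where "I = {(f, g). f dvd 1 \<and> g dvd q * f}"
  have pos: "fst p * snd p > 0" if "p \<in> I" for p
    using that q by (auto simp: I_def intro!: gr0I)
  have "poly_growth (\<lambda>m. \<Sum>p\<in>I. moebius_mu (fst p) * moebius_mu (snd p) * \<psi> (int (snd p)) * A (q * fst p div snd p) (1 div fst p) *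
        (if fst p * snd p dvd m then A 1 (m div (fst p * snd p)) else 0)) k"
    by (intro poly_growth_sum poly_growth_cmult poly_growth_shift growth pos)
  then show ?thesis
  proof (rule poly_growth_mono)
    fix m :: nat assume m: "m > 0"
    have "A q (1 * m) = (\<Sum>p\<in>I. moebius_mu (fst p) * moebius_mu (snd p) * \<psi> (int (snd p)) * A (q * fst p div snd p) (1 div fst p) *
        (if fst p * snd p dvd m then A 1 (m div (fst p * snd p)) else 0))"
      by (subst hecke_inversion[OF hecke \<psi>])
         (use q m in \<open>auto simp: I_def case_prod_unfold mult_ac intro!: sum.cong\<close>)
    then show "norm (A q m) \<le> norm (\<Sum>p\<in>I. moebius_mu (fst p) * moebius_mu (snd p) * \<psi> (int (snd p)) * A (q * fst p div snd p) (1 div fst p) *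
        (if fst p * snd p dvd m then A 1 (m div (fst p * snd p)) else 0))"
      by simp
  qed
qed

text \<open>Here \<open>d\<close> comes from the induced Gauss sum and \<open>(f, g)\<close> from
  Hecke inversion at \<open>n = d * m\<close>.\<close>

definition twist_index :: "nat \<Rightarrow> nat \<Rightarrow> (nat \<times> nat \<times> nat) set" where
  "twist_index q l = (SIGMA d:{d. d dvd l}. {(f, g). f dvd d \<and> g dvd q * f})"

definition twist_coeff ::
  "(int \<Rightarrow> complex) \<Rightarrow> (int \<Rightarrow> complex) \<Rightarrow> (nat \<Rightarrow> nat \<Rightarrow> complex) \<Rightarrow> nat \<Rightarrow> nat \<Rightarrow> nat \<times> nat \<times> nat \<Rightarrow> complex" where
  "twist_coeff \<psi> chi A q l = (\<lambda>(d, f, g). of_nat d * chi (int (l div d)) * moebius_mu (l div d) *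
     moebius_mu f * moebius_mu g * cnj (chi (int (f * g))) * \<psi> (int g) * A (q * f div g) (d div f))"

lemma twist_index_finite:
  assumes "q > 0" "l > 0"
  shows "finite (twist_index q l)"
proof -
  have "finite {(f, g). f dvd d \<and> g dvd q * f}" if "d dvd l" for d
    by (rule finite_dvd_pairs) (use assms that in \<open>auto intro!: gr0I\<close>)
  then show ?thesis unfolding twist_index_def using assms by (intro finite_SigmaI) auto
qed

lemma twist_index_pos:
  assumes "q > 0" "l > 0" "(d, f, g) \<in> twist_index q l"
  shows "d > 0" "f > 0" "g > 0"
  using assms by (auto simp: twist_index_def intro!: gr0I)

text \<open>The Gauss sum contributes only at divisors \<open>d\<close> of \<open>n\<close>. Writing
  \<open>n = d * m\<close>, Hecke inversion reduces \<open>A q (d * m)\<close> to the first row at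
  \<open>m div (f * g)\<close>, and \<open>cnj (chi m)\<close> splits off its factor at
  \<open>f * g\<close>. The result is a combination of shifted coefficients of one
  L-function.\<close>

lemma twisted_coefficients:
  assumes hecke: "hecke_relations N \<psi> A" and \<psi>: "dirichlet_character N \<psi>"
    and prim: "primitive_dirichlet_character c chi"
    and pos: "q > 0" "l > 0" "n > 0" and cop: "coprime (q * l) N"
  shows "A q n * unit_gauss_sum chi (c * l) (int n) = gauss_sum c chi *
    (\<Sum>i\<in>twist_index q l. twist_coeff \<psi> chi A q l i *
        (if (case i of (d, f, g) \<Rightarrow> d * f * g) dvd n
         then A 1 (n div (case i of (d, f, g) \<Rightarrow> d * f * g)) * cnj (chi (int (n div (case i of (d, f, g) \<Rightarrow> d * f * g)))) else 0))"
proof -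
  note chi = primitive_imp_dc[OF prim]
  define h where "h m = A 1 m * cnj (chi (int m))" for m
  define \<kappa> where "\<kappa> = twist_coeff \<psi> chi A q l"
  have inner: "(if d dvd n then A q n * (of_nat d * cnj (chi (int (n div d))) * chi (int (l div d)) * moebius_mu (l div d)) else 0)
      = (\<Sum>(f, g) | f dvd d \<and> g dvd q * f. \<kappa> (d, f, g) * (if d * f * g dvd n then h (n div (d * f * g)) else 0))"
    if d: "d dvd l" for d
  proof (cases "d dvd n")
    case True
    then obtain m where n: "n = d * m" by (auto elim: dvdE)
    have pos': "d > 0" "m > 0" using pos n by auto
    have "coprime (q * d) N"
      using cop d by (metis coprime_mult_left_iff coprime_divisors dvd_refl)
    then have "A q n = (\<Sum>(f, g) | f dvd d \<and> g dvd q * f. moebius_mu f * moebius_mu g * \<psi> (int g) *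
        (if f * g dvd m then A 1 (m div (f * g)) else 0) * A (q * f div g) (d div f))"
      unfolding n using pos pos' by (intro hecke_inversion[OF hecke \<psi>])
    then have "A q n * (of_nat d * cnj (chi (int m)) * chi (int (l div d)) * moebius_mu (l div d)) =
      (\<Sum>(f, g) | f dvd d \<and> g dvd q * f. moebius_mu f * moebius_mu g * \<psi> (int g) *
        (if f * g dvd m then A 1 (m div (f * g)) else 0) * A (q * f div g) (d div f) *
         (of_nat d * cnj (chi (int m)) * chi (int (l div d)) * moebius_mu (l div d)))"
      by (simp add: sum_distrib_right case_prod_unfold)
    also have "\<dots> = (\<Sum>(f, g) | f dvd d \<and> g dvd q * f. \<kappa> (d, f, g) * (if d * f * g dvd n then h (n div (d * f * g)) else 0))"
    proof (intro sum.cong refl, clarify)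
      fix f g assume fg: "f dvd d" "g dvd q * f"
      then have fgpos: "f > 0" "g > 0" using pos pos' by (auto intro!: gr0I)
      show "moebius_mu f * moebius_mu g * \<psi> (int g) *
        (if f * g dvd m then A 1 (m div (f * g)) else 0) * A (q * f div g) (d div f) *
         (of_nat d * cnj (chi (int m)) * chi (int (l div d)) * moebius_mu (l div d))
        = \<kappa> (d, f, g) * (if d * f * g dvd n then h (n div (d * f * g)) else 0)"
      proof (cases "f * g dvd m")
        case True
        then obtain m' where m': "m = f * g * m'" by (auto elim: dvdE)
        have 1: "m div (f * g) = m'" "n div (d * f * g) = m'" "d * f * g dvd n"
          using fgpos pos' by (simp_all add: m' n mult.assoc)
        have "chi (int m) = chi (int (f * g)) * chi (int m')"
          unfolding m' by (simp add: dc_mult[OF chi])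
        then show ?thesis using True 1(3) unfolding 1 by (simp add: \<kappa>_def twist_coeff_def h_def mult_ac)
      next
        case False
        moreover have "\<not> d * f * g dvd n" using False pos' by (simp add: n mult.assoc)
        ultimately show ?thesis by simp
      qed
    qed
    finally show ?thesis using True pos' by (simp add: n)
  next
    case False
    then have "\<not> d * f * g dvd n" for f g by (metis dvd_mult_left mult.assoc)
    then show ?thesis using False by simp
  qed
  have "A q n * unit_gauss_sum chi (c * l) (int n) = gauss_sum c chi * (\<Sum>d | d dvd l.
      if d dvd n then A q n * (of_nat d * cnj (chi (int (n div d))) * chi (int (l div d)) * moebius_mu (l div d)) else 0)"
  proof -
    have "(\<Sum>d | d dvd l \<and> int d dvd int n. of_nat d * cnj (chi (int n div int d)) * chi (int (l div d)) * moebius_mu (l div d))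
       = (\<Sum>d | d dvd l. if d dvd n then (of_nat d * cnj (chi (int (n div d))) * chi (int (l div d)) * moebius_mu (l div d)) else 0)"
      by (rule sum.mono_neutral_cong_left) (use pos in \<open>auto simp: zdiv_int\<close>)
    then show ?thesis
      unfolding unit_gauss_sum_formula[OF prim pos(2)]
      by (simp add: sum_distrib_left if_distrib mult_ac cong: if_cong)
  qed
  also have "(\<Sum>d | d dvd l.
      if d dvd n then A q n * (of_nat d * cnj (chi (int (n div d))) * chi (int (l div d)) * moebius_mu (l div d)) else 0)
     = (\<Sum>d | d dvd l. \<Sum>(f, g) | f dvd d \<and> g dvd q * f. \<kappa> (d, f, g) * (if d * f * g dvd n then h (n div (d * f * g)) else 0))"
    by (intro sum.cong refl inner) auto
  also have "\<dots> = (\<Sum>(d, f, g)\<in>twist_index q l. \<kappa> (d, f, g) * (if d * f * g dvd n then h (n div (d * f * g)) else 0))"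
  proof -
    have "finite {(f, g). f dvd d \<and> g dvd q * f}" if "d dvd l" for d
      by (rule finite_dvd_pairs) (use pos that in \<open>auto intro!: gr0I\<close>)
    then show ?thesis
      unfolding twist_index_def using pos by (subst sum.Sigma) (auto simp: case_prod_unfold)
  qed
  also have "\<dots> = (\<Sum>i\<in>twist_index q l. \<kappa> i *
        (if (case i of (d, f, g) \<Rightarrow> d * f * g) dvd n then h (n div (case i of (d, f, g) \<Rightarrow> d * f * g)) else 0))"
    by (simp add: case_prod_unfold cong: if_cong)
  finally show ?thesis by (simp add: h_def \<kappa>_def cong: if_cong)
qed

lemma twisted_continuation:
  assumes hecke: "hecke_relations N \<psi> A" and \<psi>: "dirichlet_character N \<psi>"
    and prim: "primitive_dirichlet_character c chi"
    and pos: "q > 0" "l > 0" and cop: "coprime (q * l) N"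
    and L: "dirichlet_series_continuation (\<lambda>n. A 1 n * cnj (chi (int n))) L"
  shows "dirichlet_series_continuation (\<lambda>n. A q n * unit_gauss_sum chi (c * l) (int n))
     (\<lambda>s. gauss_sum c chi * (\<Sum>(d, f, g)\<in>twist_index q l. twist_coeff \<psi> chi A q l (d, f, g) / of_nat (d * f * g) powr s) * L s)"
proof -
  define k where "k = (\<lambda>(d, f, g). d * f * g :: nat)"
  have "dirichlet_series_continuation (\<lambda>n. A q n * unit_gauss_sum chi (c * l) (int n))
     (\<lambda>s. (\<Sum>i\<in>twist_index q l. gauss_sum c chi * twist_coeff \<psi> chi A q l i / of_nat (k i) powr s) * L s)"
  proof (rule dirichlet_series_continuation_combination[OF L])
    show "k i > 0" if "i \<in> twist_index q l" for i
      using that twist_index_pos[OF pos] by (cases i) (auto simp: k_def)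
    show "A q n * unit_gauss_sum chi (c * l) (int n) = (\<Sum>i\<in>twist_index q l. gauss_sum c chi * twist_coeff \<psi> chi A q l i *
         (if k i dvd n then A 1 (n div k i) * cnj (chi (int (n div k i))) else 0))" if "n > 0" for n
      by (subst twisted_coefficients[OF hecke \<psi> prim pos that cop])
         (simp add: sum_distrib_left k_def mult.assoc [of "gauss_sum c chi"] cong: if_cong)
  qed (use twist_index_finite pos in auto)
  then show ?thesis
    by (simp add: k_def case_prod_unfold sum_distrib_left)
qed

subsection \<open>The dual series\<close>

lemma poly_growth_dilate:
  assumes "poly_growth h k" "y > 0"
  shows "poly_growth (\<lambda>n. h (n * y)) k"
proof -
  obtain K where K: "\<And>n. n > 0 \<Longrightarrow> norm (h n) \<le> K * real n ^ k"
    using assms by (auto simp: poly_growth_def)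
  have "norm (h (n * y)) \<le> (K * real y ^ k) * real n ^ k" if "n > 0" for n
    using K[of "n * y"] that assms(2) by (simp add: power_mult_distrib mult_ac)
  then show ?thesis unfolding poly_growth_def by blast
qed

text \<open>Each product \<open>B 1 n * B x y\<close> is expanded by the Hecke relation. For fixed
  \<open>(b, e)\<close> only multiples of \<open>b * e\<close> occur, and \<open>chi n\<close>
  factors along \<open>b * e\<close>, so every pair contributes a shifted copy of one of the series
  \<open>U\<close>.\<close>

lemma dual_hecke_expansion:
  assumes hecke: "hecke_relations N \<psi> B" and chi: "dirichlet_character c chi"
    and pos: "x > 0" "y > 0" and cop: "coprime (y * x) N"
    and Lt: "ds_sums (\<lambda>n. B 1 n * chi (int n)) w Lt"
    and U: "\<And>x y. x > 0 \<Longrightarrow> y > 0 \<Longrightarrow> coprime x N \<Longrightarrow> ds_sums (\<lambda>n. B x (n * y) * chi (int n)) w (U x y)"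
  shows "Lt * B x y = (\<Sum>(b, e) | b dvd y \<and> e dvd x. \<psi> (int e) * chi (int (b * e)) / of_nat (b * e) powr w * U (b * x div e) (y div b))"
proof -
  define I where "I = {(b, e). b dvd y \<and> e dvd x}"
  have finI: "finite I" unfolding I_def by (rule finite_dvd_pairs) (use pos in auto)
  have Ipos: "b > 0" "e > 0" if "(b, e) \<in> I" for b e
    using that pos by (auto simp: I_def intro!: gr0I)
  have "ds_sums (\<lambda>n. \<Sum>(b, e)\<in>I. \<psi> (int e) * chi (int (b * e)) * (if b * e dvd n then B (b * x div e) (n div (b * e) * (y div b)) * chi (int (n div (b * e))) else 0)) w
     (\<Sum>(b, e)\<in>I. \<psi> (int e) * chi (int (b * e)) * (U (b * x div e) (y div b) / of_nat (b * e) powr w))"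
    unfolding case_prod_unfold
  proof (intro ds_sums_sum ds_sums_cmult)
    fix p assume p: "p \<in> I"
    obtain b e where be: "p = (b, e)" by (cases p)
    have "b * x div e > 0" "y div b > 0" "coprime (b * x div e) N" "b * e > 0"
    proof -
      obtain x' y' where xy: "x = e * x'" "y = b * y'" using p be by (auto simp: I_def elim!: dvdE)
      have "b * x div e = b * x'" using xy pos by simp
      then show "b * x div e > 0" "coprime (b * x div e) N" using xy pos cop by auto
      show "y div b > 0" "b * e > 0" using xy pos by auto
    qed
    then have "ds_sums (\<lambda>n. if b * e dvd n then (\<lambda>n. B (b * x div e) (n * (y div b)) * chi (int n)) (n div (b * e)) else 0) w
        (U (b * x div e) (y div b) / of_nat (b * e) powr w)"
      by (intro ds_sums_shift U)
    then show "ds_sums (\<lambda>n. if fst p * snd p dvd n then B (fst p * x div snd p) (n div (fst p * snd p) * (y div fst p)) * chi (int (n div (fst p * snd p))) else 0) w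
        (U (fst p * x div snd p) (y div fst p) / of_nat (fst p * snd p) powr w)"
      by (simp add: be cong: if_cong)
  qed
  moreover have "(\<Sum>(b, e)\<in>I. \<psi> (int e) * chi (int (b * e)) * (if b * e dvd n then B (b * x div e) (n div (b * e) * (y div b)) * chi (int (n div (b * e))) else 0))
     = B x y * (B 1 n * chi (int n))" if n: "n > 0" for n
  proof -
    have "B 1 n * B x y = (\<Sum>(b, e) | b dvd y \<and> e dvd x \<and> b * e dvd n. B (b * x div e) (n div (b * e) * y div b) * \<psi> (int e))"
      by (rule hecke_pairs[OF hecke n pos(2,1) cop])
    also have "\<dots> = (\<Sum>(b, e)\<in>I. if b * e dvd n then B (b * x div e) (n div (b * e) * (y div b)) * \<psi> (int e) else 0)"
      by (rule sum.mono_neutral_cong_left) (use finI in \<open>auto simp: I_def div_mult_swap split: if_splits\<close>)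
    finally have "B x y * (B 1 n * chi (int n)) = (\<Sum>(b, e)\<in>I. (if b * e dvd n then B (b * x div e) (n div (b * e) * (y div b)) * \<psi> (int e) else 0)) * chi (int n)"
      by (simp add: mult_ac)
    also have "\<dots> = (\<Sum>(b, e)\<in>I. \<psi> (int e) * chi (int (b * e)) * (if b * e dvd n then B (b * x div e) (n div (b * e) * (y div b)) * chi (int (n div (b * e))) else 0))"
      unfolding sum_distrib_right
    proof (intro sum.cong refl, clarify)
      fix b e assume "(b, e) \<in> I"
      show "(if b * e dvd n then B (b * x div e) (n div (b * e) * (y div b)) * \<psi> (int e) else 0) * chi (int n)
        = \<psi> (int e) * chi (int (b * e)) * (if b * e dvd n then B (b * x div e) (n div (b * e) * (y div b)) * chi (int (n div (b * e))) else 0)"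
      proof (cases "b * e dvd n")
        case True
        then have "chi (int n) = chi (int (b * e)) * chi (int (n div (b * e)))"
          unfolding dc_mult[OF chi, symmetric] by (metis dvd_mult_div_cancel of_nat_mult)
        then show ?thesis using True by (simp add: mult_ac)
      qed auto
    qed
    finally show ?thesis ..
  qed
  ultimately have "ds_sums (\<lambda>n. B x y * (B 1 n * chi (int n))) w (\<Sum>(b, e)\<in>I. \<psi> (int e) * chi (int (b * e)) * (U (b * x div e) (y div b) / of_nat (b * e) powr w))"
    by (subst ds_sums_cong) auto
  then have "B x y * Lt = (\<Sum>(b, e)\<in>I. \<psi> (int e) * chi (int (b * e)) * (U (b * x div e) (y div b) / of_nat (b * e) powr w))"
    using ds_sums_unique ds_sums_cmult[OF Lt] by blast
  then show ?thesis by (simp add: I_def mult_ac)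
qed

subsection \<open>Averages of Kloosterman sums\<close>

text \<open>A nonzero term of the formula gives \<open>m = d * m'\<close> with \<open>d\<close>
  dividing \<open>l\<close> and \<open>m'\<close> prime to \<open>c\<close>, so the factor
  \<open>c\<close> can be cancelled from the divisibility. This trims the divisors of
  \<open>c * l * q\<close> to those of \<open>l * q\<close>.\<close>

lemma unit_gauss_sum_nonzero_imp_dvd:
  assumes prim: "primitive_dirichlet_character c chi" and pos: "l > 0" "q > 0"
    and m: "m dvd c * l * q" and nz: "unit_gauss_sum chi (c * l) (int m) \<noteq> 0"
  shows "m dvd l * q"
proof -
  note dc = primitive_imp_dc[OF prim]
  obtain d where d: "d dvd l" "int d dvd int m" "chi (int m div int d) \<noteq> 0"
  proof -
    have "(\<Sum>d | d dvd l \<and> int d dvd int m. of_nat d * cnj (chi (int m div int d)) * chi (int (l div d)) * moebius_mu (l div d)) \<noteq> 0"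
      using nz unfolding unit_gauss_sum_formula[OF prim pos(1)] by (metis mult_zero_right)
    then obtain d where "d \<in> {d. d dvd l \<and> int d dvd int m}"
      "of_nat d * cnj (chi (int m div int d)) * chi (int (l div d)) * moebius_mu (l div d) \<noteq> 0"
      by (rule sum.not_neutral_contains_not_neutral)
    then show ?thesis using that[of d] by auto
  qed
  then obtain m' l' where ml: "m = d * m'" "l = d * l'" by (auto elim!: dvdE)
  have d0: "d > 0" using pos ml by auto
  then have "coprime (int m') (int c)" using d(3) dc_eq_0_iff[OF dc] by (simp add: ml)
  then have cop: "coprime m' c" by simp
  have "d * m' dvd d * (c * (l' * q))" using m by (simp add: ml mult_ac)
  then have "m' dvd c * (l' * q)" using d0 by simp
  then have "m' dvd l' * q" using cop by (simp add: coprime_dvd_mult_right_iff)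
  then show ?thesis using d0 by (simp add: ml mult.assoc)
qed

lemma unit_gauss_sum_mult:
  assumes prim: "primitive_dirichlet_character c chi" and l: "l > 0"
    and C: "c * l dvd m * C" and t: "coprime t (int (c * l))" and D: "coprime D (int C)"
  shows "unit_gauss_sum chi (c * l) (t * D * int m) = cnj (chi (t * D)) * unit_gauss_sum chi (c * l) (int m)"
proof -
  note dc = primitive_imp_dc[OF prim]
  have iff: "int d dvd t * D * int m \<longleftrightarrow> int d dvd int m" if d: "d dvd l" for d
  proof
    assume 1: "int d dvd t * D * int m"
    have "coprime (int d) t"
    proof -
      have "int d dvd int (c * l)" using d by (simp add: dvd_mult)
      then show ?thesis using t by (metis coprime_commute coprime_divisors dvd_refl)
    qed
    then have 2: "int d dvd D * int m" using 1 by (simp add: mult.assoc coprime_dvd_mult_right_iff)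
    \<comment> \<open>From \<open>d\<close> dividing both \<open>D * m\<close> and
      \<open>C * m\<close> it follows that \<open>d\<close> divides their gcd, which is
      \<open>m\<close>.\<close>
    have "d dvd m * C" using C d by (meson dvd_trans dvd_triv_right)
    then have "int d dvd int C * int m" by (metis int_dvd_int_iff mult.commute of_nat_mult)
    then have "int d dvd gcd (D * int m) (int C * int m)" using 2 by simp
    also have "gcd (D * int m) (int C * int m) = int m"
      using D by (simp add: gcd_mult_right coprime_iff_gcd_eq_1 gcd.commute)
    finally show "int d dvd int m" .
  qed simp
  have "(\<Sum>d | d dvd l \<and> int d dvd t * D * int m. of_nat d * cnj (chi (t * D * int m div int d)) * chi (int (l div d)) * moebius_mu (l div d))
     = (\<Sum>d | d dvd l \<and> int d dvd int m. cnj (chi (t * D)) * (of_nat d * cnj (chi (int m div int d)) * chi (int (l div d)) * moebius_mu (l div d)))"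
  proof (rule sum.cong)
    show "{d. d dvd l \<and> int d dvd t * D * int m} = {d. d dvd l \<and> int d dvd int m}" using iff by auto
    fix d assume "d \<in> {d. d dvd l \<and> int d dvd int m}"
    then have "t * D * int m div int d = t * D * (int m div int d)" by (simp add: div_mult_swap)
    then show "of_nat d * cnj (chi (t * D * int m div int d)) * chi (int (l div d)) * moebius_mu (l div d)
      = cnj (chi (t * D)) * (of_nat d * cnj (chi (int m div int d)) * chi (int (l div d)) * moebius_mu (l div d))"
      by (simp add: dc_mult[OF dc])
  qed
  then show ?thesis
    unfolding unit_gauss_sum_formula[OF prim l] by (simp add: sum_distrib_left mult_ac)
qed

lemma sum_units_modular_inverse:
  assumes "C > 0"
  shows "(\<Sum>D | D \<in> {0..<int C} \<and> coprime D (int C). F (modular_inverse (int C) D))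
       = (\<Sum>D | D \<in> {0..<int C} \<and> coprime D (int C). F D)"
proof -
  have inv: "modular_inverse (int C) (modular_inverse (int C) D) = D"
    if "D \<in> {0..<int C}" "coprime D (int C)" for D
    by (rule modular_inverse_int_eqI) (use that cong_modular_inverse2 in auto)
  show ?thesis
    by (rule sum.reindex_bij_witness[of _ "modular_inverse (int C)" "modular_inverse (int C)"])
       (use assms in \<open>auto simp: inv modular_inverse_int_nonneg modular_inverse_int_less\<close>)
qed

text \<open>With \<open>C = c * l * q div m1\<close> the frequency \<open>t * q * v * D / C\<close>
  equals \<open>v * t * D * m1 / (c * l)\<close>. The sum over \<open>v\<close> is thus a Gauss sum
  modulo \<open>c * l\<close>, which releases \<open>cnj (chi (t * D))\<close>, and the sum over
  \<open>D\<close> is a second Gauss sum modulo \<open>C\<close>.\<close>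

lemma kloosterman_average:
  assumes prim: "primitive_dirichlet_character c chi" and pos: "l > 0" "q > 0"
    and m1: "m1 dvd c * l * q" and t: "coprime t (int (c * l))"
  shows "(\<Sum>v | v \<in> {0..<int (c * l)} \<and> coprime v (int (c * l)).
            chi v * kloosterman_sum (t * int q * v) m2 (c * l * q div m1))
       = cnj (chi t) * unit_gauss_sum chi (c * l) (int m1) * unit_gauss_sum chi (c * l * q div m1) m2"
proof -
  note dc = primitive_imp_dc[OF prim]
  have c0: "c > 0" using dc_pos[OF dc] .
  define C where "C = c * l * q div m1"
  have Cm: "m1 * C = c * l * q" using m1 by (simp add: C_def)
  then have pos': "m1 > 0" "C > 0" using pos c0 by (auto intro!: gr0I)
  define V where "V = {v. v \<in> {0..<int (c * l)} \<and> coprime v (int (c * l))}"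
  define W where "W = {D. D \<in> {0..<int C} \<and> coprime D (int C)}"
  have split: "additive_char (real_of_int (t * int q * v * D + m2 * modular_inverse (int C) D) / real C)
     = additive_char (real_of_int (m2 * modular_inverse (int C) D) / real C) * additive_char (real_of_int (v * (t * D * int m1)) / real (c * l))" for v D
  proof -
    have "real_of_int (t * int q * v * D) / real C = real_of_int (v * (t * D * int m1)) / real (c * l)"
    proof -
      have Cm': "real m1 * real C = real c * real l * real q" using Cm by (metis of_nat_mult)
      have "real_of_int (t * int q * v * D) * real (c * l) = real_of_int (t * v * D) * (real c * real l * real q)"
        by simp
      also have "\<dots> = real_of_int (v * (t * D * int m1)) * real C"
        unfolding Cm' [symmetric] by simp
      finally show ?thesis using pos pos' c0 by (simp add: frac_eq_eq)
    qed
    then show ?thesis by (simp add: add_divide_distrib additive_char_add)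
  qed
  have "(\<Sum>v\<in>V. chi v * kloosterman_sum (t * int q * v) m2 C)
     = (\<Sum>v\<in>V. \<Sum>D\<in>W. chi v * (additive_char (real_of_int (m2 * modular_inverse (int C) D) / real C) * additive_char (real_of_int (v * (t * D * int m1)) / real (c * l))))"
    unfolding kloosterman_sum_def split W_def by (simp only: sum_distrib_left)
  also have "\<dots> = (\<Sum>D\<in>W. additive_char (real_of_int (m2 * modular_inverse (int C) D) / real C) * unit_gauss_sum chi (c * l) (t * D * int m1))"
    unfolding unit_gauss_sum_def V_def by (subst sum.swap) (simp only: sum_distrib_left mult_ac)
  also have "\<dots> = (\<Sum>D\<in>W. additive_char (real_of_int (m2 * modular_inverse (int C) D) / real C) * (cnj (chi (t * D)) * unit_gauss_sum chi (c * l) (int m1)))"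
  proof (intro sum.cong refl)
    fix D assume "D \<in> W"
    then show "additive_char (real_of_int (m2 * modular_inverse (int C) D) / real C) * unit_gauss_sum chi (c * l) (t * D * int m1)
      = additive_char (real_of_int (m2 * modular_inverse (int C) D) / real C) * (cnj (chi (t * D)) * unit_gauss_sum chi (c * l) (int m1))"
      by (subst unit_gauss_sum_mult[OF prim pos(1), of m1 C]) (use t in \<open>auto simp: Cm W_def\<close>)
  qed
  also have "\<dots> = cnj (chi t) * unit_gauss_sum chi (c * l) (int m1) *
      (\<Sum>D\<in>W. cnj (chi D) * additive_char (real_of_int (m2 * modular_inverse (int C) D) / real C))"
    by (simp add: sum_distrib_left dc_mult[OF dc] mult_ac)
  also have "\<dots> = cnj (chi t) * unit_gauss_sum chi (c * l) (int m1) * unit_gauss_sum chi C m2"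
  \<comment> \<open>Replacing \<open>cnj (chi D)\<close> by \<open>chi\<close> of the inverse of
    \<open>D\<close> modulo \<open>C\<close> requires \<open>c dvd C\<close>. This can fail, but not
    when the first Gauss sum is nonzero.\<close>
  proof (cases "unit_gauss_sum chi (c * l) (int m1) = 0")
    case False
    then have "m1 dvd l * q" using unit_gauss_sum_nonzero_imp_dvd[OF prim pos m1] by simp
    then obtain r where r: "l * q = m1 * r" by (auto elim: dvdE)
    have "m1 * C = m1 * (c * r)" using Cm r by (metis mult.assoc mult.left_commute)
    then have cC: "c dvd C" using pos' by simp
    have "cnj (chi D) = chi (modular_inverse (int C) D)" if "D \<in> W" for D
    proof (rule dc_cnj_eqI[OF dc])
      have "[D * modular_inverse (int C) D = 1] (mod int C)"
        using that by (intro cong_modular_inverse1) (simp add: W_def)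
      then show "[D * modular_inverse (int C) D = 1] (mod int c)"
        using cC by (meson cong_dvd_modulus int_dvd_int_iff)
    qed
    then have "(\<Sum>D\<in>W. cnj (chi D) * additive_char (real_of_int (m2 * modular_inverse (int C) D) / real C))
       = (\<Sum>D\<in>W. (\<lambda>D. chi D * additive_char (real_of_int (m2 * D) / real C)) (modular_inverse (int C) D))"
      by (intro sum.cong refl) simp
    also have "\<dots> = unit_gauss_sum chi C m2"
      unfolding W_def unit_gauss_sum_def by (subst sum_units_modular_inverse[OF pos'(2)]) (simp add: mult_ac)
    finally show ?thesis by simp
  qed simp
  finally show ?thesis by (simp add: C_def V_def)
qed

subsection \<open>Matching the two sides\<close>

text \<open>The common value, up to elementary factors, of \<open>L(1 - s)\<close> times the Dirichlet polynomial of the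
  twisted series and of the averaged Kloosterman side; \<open>U x y\<close> stands for the value of the series
  \<open>\<Sum>n. B x (n * y) * chi n / n powr (1 - s)\<close>.\<close>

definition dual_sum ::
  "(int \<Rightarrow> complex) \<Rightarrow> nat \<Rightarrow> nat \<Rightarrow> (nat \<Rightarrow> nat \<Rightarrow> complex) \<Rightarrow> complex \<Rightarrow> complex" where
  "dual_sum chi q l U s = (\<Sum>f | f dvd l. \<Sum>(g, b) | g * b dvd q * f.
     moebius_mu f * moebius_mu g * cnj (chi (int (f * g))) * chi (int b) /
     (of_nat (f * g) powr s * of_nat b powr (1 - s)) * U (b * (l div f)) (q * f div (g * b)))"

lemma of_nat_powr_one_minus: "n > 0 \<Longrightarrow> (of_nat n :: complex) powr (1 - s) = of_nat n / of_nat n powr s"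
  by (simp add: powr_diff)

text \<open>With \<open>r = l div d\<close>, the factor \<open>d / (d * f * g) powr s\<close> turns
  into \<open>l powr (1 - s)\<close> divided by \<open>r powr (1 - s)\<close> and
  \<open>(f * g) powr s\<close>. Thus \<open>r\<close> and the Hecke variable \<open>e\<close> carry
  the same completely multiplicative weight \<open>X\<close>, which is just what the twisted Moebius
  collapse requires.\<close>

lemma twist_sum_dual:
  assumes \<psi>: "dirichlet_character N \<psi>" and chi: "dirichlet_character c chi"
    and pos: "q > 0" "l > 0" and cop: "coprime (q * l) N"
    and AB: "\<And>m n. m > 0 \<Longrightarrow> n > 0 \<Longrightarrow> coprime (m * n) N \<Longrightarrow> A m n = \<psi> (int m) * \<psi> (int n) * B n m"
    and expand: "\<And>x y. x > 0 \<Longrightarrow> y > 0 \<Longrightarrow> coprime (y * x) N \<Longrightarrow>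
      Lt * B x y = (\<Sum>(b, e) | b dvd y \<and> e dvd x. cnj (\<psi> (int e)) * chi (int (b * e)) / of_nat (b * e) powr (1 - s) * U (b * x div e) (y div b))"
  shows "(\<Sum>(d, f, g)\<in>twist_index q l. twist_coeff \<psi> chi A q l (d, f, g) / of_nat (d * f * g) powr s) * Lt
     = \<psi> (int (q * l)) * of_nat l powr (1 - s) * dual_sum chi q l U s"
proof -
  define X where "X k = chi (int k) / of_nat k powr (1 - s)" for k
  define T where "T f h g b = moebius_mu f * moebius_mu g * cnj (chi (int (f * g))) * chi (int b) /
     (of_nat (f * g) powr s * of_nat b powr (1 - s)) * U (b * (h div f)) (q * f div (g * b))" for f h g b
  define V where "V f h = of_nat l powr (1 - s) * \<psi> (int (q * h)) * (\<Sum>(g, b) | g * b dvd q * f. T f h g b)" for f h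
  have single: "twist_coeff \<psi> chi A q l (d, f, g) / of_nat (d * f * g) powr s * Lt
      = (\<Sum>e | e dvd d div f. \<Sum>b | b dvd q * f div g.
          X (l div d) * moebius_mu (l div d) * (X e * (of_nat l powr (1 - s) * \<psi> (int (q * (d div e))) * T f (d div e) g b)))"
    if d: "d dvd l" and f: "f dvd d" and g: "g dvd q * f" for d f g
  proof -
    obtain x where x: "d = f * x" using f by (auto elim: dvdE)
    obtain r where r: "l = d * r" using d by (auto elim: dvdE)
    obtain y where y: "q * f = g * y" using g by (auto elim: dvdE)
    have p: "d > 0" "f > 0" "x > 0" "r > 0" "g > 0" "y > 0"
      using pos x r y by (auto intro!: gr0I)
    have copf: "coprime f N" "coprime x N" "coprime q N"
      using cop unfolding r x by auto
    then have "coprime (g * y) N" unfolding y [symmetric] by simp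
    then have copy: "coprime y N" "coprime g N" by auto
    have Aeq: "A (q * f div g) (d div f) = \<psi> (int y) * \<psi> (int x) * B x y"
      using AB[OF p(6,3)] copf copy p by (simp add: x y)
    have "twist_coeff \<psi> chi A q l (d, f, g) / of_nat (d * f * g) powr s * Lt
       = of_nat d * chi (int r) * moebius_mu r * moebius_mu f * moebius_mu g * cnj (chi (int (f * g))) * \<psi> (int g)
           * (\<psi> (int y) * \<psi> (int x)) / of_nat (d * f * g) powr s * (Lt * B x y)"
      unfolding twist_coeff_def prod.case Aeq using p by (simp add: r mult_ac)
    also have "\<dots> = (\<Sum>(b, e) | b dvd y \<and> e dvd x. of_nat d * chi (int r) * moebius_mu r * moebius_mu f * moebius_mu g * cnj (chi (int (f * g))) * \<psi> (int g)
           * (\<psi> (int y) * \<psi> (int x)) / of_nat (d * f * g) powr s *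
           (cnj (\<psi> (int e)) * chi (int (b * e)) / of_nat (b * e) powr (1 - s) * U (b * x div e) (y div b)))"
      by (subst expand) (use p copf copy in \<open>auto simp: sum_distrib_left case_prod_unfold\<close>)
    also have "\<dots> = (\<Sum>(b, e) | b dvd y \<and> e dvd x.
          X r * moebius_mu r * (X e * (of_nat l powr (1 - s) * \<psi> (int (q * (d div e))) * T f (d div e) g b)))"
    proof (intro sum.cong refl, clarify)
      fix b e assume b: "b dvd y" and e: "e dvd x"
      obtain k where k: "x = e * k" using e by (auto elim: dvdE)
      obtain u where u: "y = b * u" using b by (auto elim: dvdE)
      have p': "e > 0" "k > 0" "b > 0" "u > 0" using p k u by auto
      have de: "d div e = f * k" using p' by (simp add: x k)
      have U: "U (b * x div e) (y div b) = U (b * (d div e div f)) (q * f div (g * b))"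
      proof -
        have "b * x div e = b * k" using p' by (simp add: k)
        moreover have "d div e div f = k" using p by (simp add: de)
        moreover have "q * f div (g * b) = u" unfolding y u using p p' by simp
        moreover have "y div b = u" unfolding u using p' by simp
        ultimately show ?thesis by simp
      qed
      have ce: "coprime (int e) (int N)" using copf k by simp
      \<comment> \<open>From \<open>q * f = g * y\<close> the first two factors give \<psi> at
        \<open>q * f\<close>, and \<open>x = e * k\<close> cancels \<psi> at \<open>e\<close>
        against its conjugate; what is left is \<psi> at \<open>q * f * k\<close>, where
        \<open>d div e = f * k\<close>.\<close>
      have psi: "\<psi> (int g) * (\<psi> (int y) * \<psi> (int x)) * cnj (\<psi> (int e)) = \<psi> (int (q * (d div e)))"
      proof -
        have "\<psi> (int g) * \<psi> (int y) = \<psi> (int (q * f))" unfolding y by (simp add: dc_mult[OF \<psi>])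
        then have "\<psi> (int g) * (\<psi> (int y) * \<psi> (int x)) * cnj (\<psi> (int e))
           = \<psi> (int q) * \<psi> (int f) * \<psi> (int k) * (\<psi> (int e) * cnj (\<psi> (int e)))"
          by (simp add: k dc_mult[OF \<psi>] mult_ac)
        also have "\<dots> = \<psi> (int (q * (d div e)))"
          using dc_mult_cnj[OF \<psi> ce] by (simp add: de dc_mult[OF \<psi>])
        finally show ?thesis .
      qed
      have pw: "of_nat d / of_nat (d * f * g) powr s = of_nat l powr (1 - s) / of_nat r powr (1 - s) / (of_nat (f * g) powr s :: complex)"
        unfolding r mult.assoc of_nat_powr_mult[of d] using p by (simp add: of_nat_powr_one_minus)
      show "of_nat d * chi (int r) * moebius_mu r * moebius_mu f * moebius_mu g * cnj (chi (int (f * g))) * \<psi> (int g)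
           * (\<psi> (int y) * \<psi> (int x)) / of_nat (d * f * g) powr s *
           (cnj (\<psi> (int e)) * chi (int (b * e)) / of_nat (b * e) powr (1 - s) * U (b * x div e) (y div b))
          = X r * moebius_mu r * (X e * (of_nat l powr (1 - s) * \<psi> (int (q * (d div e))) * T f (d div e) g b))"
      proof -
        have be: "chi (int (b * e)) = chi (int b) * chi (int e)"
          "(of_nat (b * e) :: complex) powr (1 - s) = of_nat b powr (1 - s) * of_nat e powr (1 - s)"
          by (simp_all only: of_nat_powr_mult of_nat_mult [where 'a = int] dc_mult[OF chi])
        have "of_nat d * chi (int r) * moebius_mu r * moebius_mu f * moebius_mu g * cnj (chi (int (f * g))) * \<psi> (int g)
           * (\<psi> (int y) * \<psi> (int x)) / of_nat (d * f * g) powr s *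
           (cnj (\<psi> (int e)) * chi (int (b * e)) / of_nat (b * e) powr (1 - s) * U (b * x div e) (y div b))
          = (of_nat d / of_nat (d * f * g) powr s) * (\<psi> (int g) * (\<psi> (int y) * \<psi> (int x)) * cnj (\<psi> (int e))) *
             (chi (int r) * moebius_mu r * moebius_mu f * moebius_mu g * cnj (chi (int (f * g))) *
               (chi (int b) * chi (int e)) / (of_nat b powr (1 - s) * of_nat e powr (1 - s)) * U (b * x div e) (y div b))"
          unfolding be by (simp only: times_divide_eq_left times_divide_eq_right divide_divide_eq_left mult_ac)
        also have "\<dots> = X r * moebius_mu r * (X e * (of_nat l powr (1 - s) * \<psi> (int (q * (d div e))) * T f (d div e) g b))"
          unfolding pw psi U T_def X_def by (simp add: mult_ac)
        finally show ?thesis .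
      qed
    qed
    also have "\<dots> = (\<Sum>b | b dvd y. \<Sum>e | e dvd x.
          X r * moebius_mu r * (X e * (of_nat l powr (1 - s) * \<psi> (int (q * (d div e))) * T f (d div e) g b)))"
    proof -
      have "{(b, e). b dvd y \<and> e dvd x} = {b. b dvd y} \<times> {e. e dvd x}" by auto
      then show ?thesis by (simp only: sum.cartesian_product)
    qed
    also have "\<dots> = (\<Sum>e | e dvd x. \<Sum>b | b dvd y.
          X r * moebius_mu r * (X e * (of_nat l powr (1 - s) * \<psi> (int (q * (d div e))) * T f (d div e) g b)))"
      by (rule sum.swap)
    finally show ?thesis using p by (simp add: x y r)
  qed
  have fin_gb: "(\<Sum>g | g dvd q * f. \<Sum>b | b dvd q * f div g. F g b) = (\<Sum>(g, b) | g * b dvd q * f. F g b)"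
    if "f > 0" for f and F :: "nat \<Rightarrow> nat \<Rightarrow> complex"
  proof -
    have qf: "q * f > 0" using that pos by simp
    have "g dvd q * f \<and> b dvd q * f div g \<longleftrightarrow> g * b dvd q * f" for g b
    proof (intro iffI; (elim conjE)?)
      assume g: "g dvd q * f" and b: "b dvd q * f div g"
      obtain y where y: "q * f = g * y" using g by (auto elim: dvdE)
      then have "g > 0" using qf by (auto intro: gr0I)
      then show "g * b dvd q * f" using b by (simp add: y)
    next
      assume gb: "g * b dvd q * f"
      then obtain y where y: "q * f = g * b * y" by (auto elim: dvdE)
      then have "g > 0" using qf by (auto intro: gr0I)
      then show "g dvd q * f \<and> b dvd q * f div g" by (simp add: y mult.assoc)
    qed
    then have "(SIGMA g:{g. g dvd q * f}. {b. b dvd q * f div g}) = {(g, b). g * b dvd q * f}" by auto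
    moreover have "finite {b. b dvd q * f div g}" if "g dvd q * f" for g
    proof -
      have "q * f div g > 0" using that qf by (metis dvd_div_eq_0_iff gr0I less_irrefl)
      then show ?thesis by simp
    qed
    ultimately show ?thesis
      using qf by (subst sum.Sigma) auto
  qed
  have pair: "(\<Sum>g | g dvd q * f. twist_coeff \<psi> chi A q l (d, f, g) / of_nat (d * f * g) powr s * Lt)
      = X (l div d) * moebius_mu (l div d) * (\<Sum>e | e dvd d div f. X e * V f (d div e))"
    if d: "d dvd l" and f: "f dvd d" for d f
  proof -
    have f0: "f > 0" using d f pos by (auto intro!: gr0I)
    have "(\<Sum>g | g dvd q * f. twist_coeff \<psi> chi A q l (d, f, g) / of_nat (d * f * g) powr s * Lt)
       = (\<Sum>g | g dvd q * f. \<Sum>e | e dvd d div f. \<Sum>b | b dvd q * f div g.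
          X (l div d) * moebius_mu (l div d) * (X e * (of_nat l powr (1 - s) * \<psi> (int (q * (d div e))) * T f (d div e) g b)))"
      by (intro sum.cong refl single d f) auto
    also have "\<dots> = (\<Sum>e | e dvd d div f. \<Sum>g | g dvd q * f. \<Sum>b | b dvd q * f div g.
          X (l div d) * moebius_mu (l div d) * (X e * (of_nat l powr (1 - s) * \<psi> (int (q * (d div e))) * T f (d div e) g b)))"
      by (rule sum.swap)
    also have "\<dots> = X (l div d) * moebius_mu (l div d) * (\<Sum>e | e dvd d div f. X e * V f (d div e))"
      unfolding fin_gb[OF f0] V_def by (simp add: sum_distrib_left case_prod_unfold)
    finally show ?thesis .
  qed
  have fin1: "finite {d. d dvd l}" using pos by simp
  have fin2: "finite {(f, g). f dvd d \<and> g dvd q * f}" if "d dvd l" for d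
    by (rule finite_dvd_pairs) (use pos that in \<open>auto intro!: gr0I\<close>)
  have Sig: "{(f, g). f dvd d \<and> g dvd q * f} = (SIGMA f:{f. f dvd d}. {g. g dvd q * f})" for d by auto
  have "(\<Sum>(d, f, g)\<in>twist_index q l. twist_coeff \<psi> chi A q l (d, f, g) / of_nat (d * f * g) powr s) * Lt
     = (\<Sum>d | d dvd l. \<Sum>f | f dvd d. \<Sum>g | g dvd q * f. twist_coeff \<psi> chi A q l (d, f, g) / of_nat (d * f * g) powr s * Lt)"
  proof -
    have "(\<Sum>(d, f, g)\<in>twist_index q l. twist_coeff \<psi> chi A q l (d, f, g) / of_nat (d * f * g) powr s) * Lt
      = (\<Sum>d | d dvd l. \<Sum>(f, g) | f dvd d \<and> g dvd q * f. twist_coeff \<psi> chi A q l (d, f, g) / of_nat (d * f * g) powr s * Lt)"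
      unfolding twist_index_def sum_distrib_right
      using fin1 fin2 by (subst sum.Sigma) (auto simp: case_prod_unfold)
    also have "\<dots> = (\<Sum>d | d dvd l. \<Sum>f | f dvd d. \<Sum>g | g dvd q * f. twist_coeff \<psi> chi A q l (d, f, g) / of_nat (d * f * g) powr s * Lt)"
    proof (intro sum.cong refl)
      fix d assume "d \<in> {d. d dvd l}"
      then have d: "finite {f. f dvd d}" "d > 0" using pos by (auto intro: gr0I)
      have "finite {g. g dvd q * f}" if "f dvd d" for f
        using that d pos by (auto intro!: gr0I elim!: dvdE)
      then show "(\<Sum>(f, g) | f dvd d \<and> g dvd q * f. twist_coeff \<psi> chi A q l (d, f, g) / of_nat (d * f * g) powr s * Lt)
        = (\<Sum>f | f dvd d. \<Sum>g | g dvd q * f. twist_coeff \<psi> chi A q l (d, f, g) / of_nat (d * f * g) powr s * Lt)"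
        unfolding Sig using d by (subst sum.Sigma) auto
    qed
    finally show ?thesis .
  qed
  also have "\<dots> = (\<Sum>d | d dvd l. \<Sum>f | f dvd d. X (l div d) * moebius_mu (l div d) * (\<Sum>e | e dvd d div f. X e * V f (d div e)))"
    by (intro sum.cong refl pair) auto
  also have "\<dots> = (\<Sum>(d, f) | d dvd l \<and> f dvd d. X (l div d) * moebius_mu (l div d) * (\<Sum>e | e dvd d div f. X e * V f (d div e)))"
  proof -
    have "{(d, f). d dvd l \<and> f dvd d} = (SIGMA d:{d. d dvd l}. {f. f dvd d})" by auto
    moreover have "finite {f. f dvd d}" if "d dvd l" for d using that pos by (auto intro!: gr0I)
    ultimately show ?thesis using fin1 by (subst sum.Sigma) auto
  qed
  also have "\<dots> = (\<Sum>f | f dvd l. V f l)"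
  proof (rule moebius_twisted_collapse[OF pos(2)])
    show "X (a * b) = X a * X b" for a b
      unfolding X_def of_nat_powr_mult by (simp add: dc_mult[OF chi])
    show "X 1 = 1" by (simp add: X_def dc_1[OF chi])
  qed
  also have "\<dots> = \<psi> (int (q * l)) * of_nat l powr (1 - s) * dual_sum chi q l U s"
    unfolding V_def T_def dual_sum_def by (simp add: sum_distrib_left mult_ac)
  finally show ?thesis .
qed

text \<open>The substitution is \<open>f = l / e\<close>, \<open>b = m / e\<close>,
  \<open>g = l * q / (m * d)\<close>. Under it \<open>l * q = m * d * g\<close> becomes
  \<open>q * f = g * b * d\<close>, the constraint of \<open>dual_sum\<close>, and the same relation
  raised to the power \<open>s\<close> matches the weights.\<close>

lemma kloosterman_side_sum:
  assumes chi: "dirichlet_character c chi" and pos: "q > 0" "l > 0"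
  shows "(\<Sum>m | m dvd l * q. (of_nat m powr s)\<^sup>2 / of_nat m *
      (\<Sum>e | e dvd l \<and> e dvd m. of_nat e * chi (int (m div e)) * cnj (chi (int (l div e))) * moebius_mu (l div e)) *
      (\<Sum>d | d dvd l * q div m. of_nat d * cnj (chi (int (l * q div m div d))) * moebius_mu (l * q div m div d) *
          (U m d / of_nat d powr (1 - s))))
    = (of_nat l powr s)\<^sup>2 * of_nat q powr s * dual_sum chi q l U s"
proof -
  define P where "P m e d = (of_nat m powr s)\<^sup>2 / of_nat m *
      (of_nat e * chi (int (m div e)) * cnj (chi (int (l div e))) * moebius_mu (l div e)) *
      (of_nat d * cnj (chi (int (l * q div m div d))) * moebius_mu (l * q div m div d) *
          (U m d / of_nat d powr (1 - s)))" for m e d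
  define R where "R f g b = moebius_mu f * moebius_mu g * cnj (chi (int (f * g))) * chi (int b) /
     (of_nat (f * g) powr s * of_nat b powr (1 - s)) * U (b * (l div f)) (q * f div (g * b))" for f g b
  have fin1: "finite {m. m dvd l * q}" "finite {e. e dvd l \<and> e dvd m}" for m
    using pos by (auto intro: finite_subset[of _ "{e. e dvd l}"])
  have fin2: "finite {d. d dvd l * q div m}" if "m dvd l * q" for m
  proof -
    have "l * q > 0" using pos by simp
    then have "l * q div m > 0" using that by (metis dvd_div_eq_0_iff gr0I less_irrefl)
    then show ?thesis by simp
  qed
  have fin3: "finite {f. f dvd l}" using pos by simp
  have fin4: "finite {(g, b). g * b dvd q * f}" if "f dvd l" for f
    by (rule finite_subset[of _ "{k. k dvd q * f} \<times> {k. k dvd q * f}"])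
       (use that pos in \<open>auto dest: dvd_mult_left dvd_mult_right intro!: gr0I\<close>)
  have distr: "k * sum F A * sum G B = (\<Sum>(e, d)\<in>A \<times> B. k * F e * G d)"
    for k :: complex and F G :: "nat \<Rightarrow> complex" and A B
    by (simp only: mult.assoc sum_product sum.cartesian_product [symmetric]) (simp add: sum_distrib_left)
  have "(\<Sum>m | m dvd l * q. (of_nat m powr s)\<^sup>2 / of_nat m *
      (\<Sum>e | e dvd l \<and> e dvd m. of_nat e * chi (int (m div e)) * cnj (chi (int (l div e))) * moebius_mu (l div e)) *
      (\<Sum>d | d dvd l * q div m. of_nat d * cnj (chi (int (l * q div m div d))) * moebius_mu (l * q div m div d) *
          (U m d / of_nat d powr (1 - s))))
    = (\<Sum>m | m dvd l * q. \<Sum>(e, d)\<in>{e. e dvd l \<and> e dvd m} \<times> {d. d dvd l * q div m}. P m e d)"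
    unfolding P_def distr ..
  also have "\<dots> = (\<Sum>(m, (e, d))\<in>(SIGMA m:{m. m dvd l * q}. {e. e dvd l \<and> e dvd m} \<times> {d. d dvd l * q div m}). P m e d)"
    using fin1 fin2 by (subst sum.Sigma) auto
  also have "\<dots> = (\<Sum>(f, (g, b))\<in>(SIGMA f:{f. f dvd l}. {(g, b). g * b dvd q * f}). (of_nat l powr s)\<^sup>2 * of_nat q powr s * R f g b)"
  proof (rule sum.reindex_bij_witness[of _ "\<lambda>(f, (g, b)). (b * (l div f), (l div f, q * f div (g * b)))"
        "\<lambda>(m, (e, d)). (l div e, (l * q div m div d, m div e))"])
    fix x assume "x \<in> (SIGMA m:{m. m dvd l * q}. {e. e dvd l \<and> e dvd m} \<times> {d. d dvd l * q div m})"
    then obtain m e d where x: "x = (m, (e, d))" and md: "m dvd l * q" and e: "e dvd l" "e dvd m" and d: "d dvd l * q div m"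
      by auto
    obtain f where f: "l = e * f" using e by (auto elim: dvdE)
    obtain b where b: "m = e * b" using e by (auto elim: dvdE)
    obtain r where r: "l * q = m * r" using md by (auto elim: dvdE)
    have p: "e > 0" "f > 0" "m > 0" "b > 0" "r > 0"
    proof -
      show "e > 0" "f > 0" using f pos by (auto intro!: gr0I)
      have "m * r > 0" using r pos by (metis nat_0_less_mult_iff)
      then show "m > 0" "r > 0" by auto
      then show "b > 0" using b by auto
    qed
    have "d dvd r" using d p by (simp add: r)
    then obtain g where g: "r = d * g" by (auto elim: dvdE)
    have p': "d > 0" "g > 0" using g p by auto
    have "e * (q * f) = e * (g * b * d)"
      using r unfolding f b g by (simp add: mult_ac)
    then have qf: "q * f = g * b * d" using p by simp
    have le: "l div e = f" "m div e = b" "l * q div m div d = g" "l div f = e" "q * f div (g * b) = d"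
    proof -
      show "l div e = f" "m div e = b" "l div f = e" using p by (simp_all add: f b)
      show "l * q div m div d = g" using p p' unfolding r g by simp
      show "q * f div (g * b) = d" using p p' unfolding qf by simp
    qed
    show "(\<lambda>(f, (g, b)). (b * (l div f), (l div f, q * f div (g * b)))) ((\<lambda>(m, (e, d)). (l div e, (l * q div m div d, m div e))) x) = x"
      by (simp add: x le) (simp add: b)
    show "(\<lambda>(m, (e, d)). (l div e, (l * q div m div d, m div e))) x \<in> (SIGMA f:{f. f dvd l}. {(g, b). g * b dvd q * f})"
      by (simp add: x le qf) (simp add: f)
    show "(case (\<lambda>(m, (e, d)). (l div e, (l * q div m div d, m div e))) x of (f, (g, b)) \<Rightarrow> (of_nat l powr s)\<^sup>2 * of_nat q powr s * R f g b)
        = (case x of (m, (e, d)) \<Rightarrow> P m e d)"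
    proof -
      define E F G H D Q where defs: "E = (of_nat e :: complex) powr s" "F = (of_nat f :: complex) powr s"
        "G = (of_nat g :: complex) powr s" "H = (of_nat b :: complex) powr s" "D = (of_nat d :: complex) powr s"
        "Q = (of_nat q :: complex) powr s"
      have nz: "E \<noteq> 0" "F \<noteq> 0" "G \<noteq> 0" "H \<noteq> 0" "D \<noteq> 0" using p p' by (simp_all add: defs)
      have QF: "Q * F = G * H * D"
        unfolding defs of_nat_powr_mult [symmetric] qf ..
      have lm: "(of_nat l :: complex) powr s = E * F" "(of_nat m :: complex) powr s = E * H" "(of_nat (f * g) :: complex) powr s = F * G"
        unfolding f b defs of_nat_powr_mult by simp_all
      \<comment> \<open>Eliminating the power of \<open>q\<close> in this way reduces the comparison
        of weights to a rational identity.\<close>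
      have Q: "Q = G * H * D / F" using QF nz by (simp add: field_simps)
      have "(of_nat l powr s)\<^sup>2 * of_nat q powr s / (of_nat (f * g) powr s * of_nat b powr (1 - s))
          = (of_nat m powr s)\<^sup>2 / of_nat m * of_nat e * of_nat d / (of_nat d powr (1 - s) :: complex)"
        unfolding of_nat_powr_one_minus[OF p(4)] of_nat_powr_one_minus[OF p'(1)] lm
          defs(4,5,6) [symmetric] Q unfolding b
        using nz p p' by (simp add: field_simps power2_eq_square)
      then have "((of_nat l powr s)\<^sup>2 * of_nat q powr s / (of_nat (f * g) powr s * of_nat b powr (1 - s))) *
          (moebius_mu f * moebius_mu g * (cnj (chi (int f)) * cnj (chi (int g))) * chi (int b) * U m d)
         = ((of_nat m powr s)\<^sup>2 / of_nat m * of_nat e * of_nat d / (of_nat d powr (1 - s))) *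
          (moebius_mu f * moebius_mu g * (cnj (chi (int f)) * cnj (chi (int g))) * chi (int b) * U m d)"
        by (rule arg_cong)
      moreover have "R f g b = moebius_mu f * moebius_mu g * (cnj (chi (int f)) * cnj (chi (int g))) * chi (int b) /
          (of_nat (f * g) powr s * of_nat b powr (1 - s)) * U m d"
      proof -
        have "b * e = m" using b by simp
        then show ?thesis unfolding R_def le by (simp add: dc_mult[OF chi])
      qed
      ultimately have "(of_nat l powr s)\<^sup>2 * of_nat q powr s * R f g b = P m e d"
        unfolding P_def le
        by (simp only: times_divide_eq_left times_divide_eq_right divide_divide_eq_left mult_ac)
      then show ?thesis by (simp add: x le)
    qed
  next
    fix x assume "x \<in> (SIGMA f:{f. f dvd l}. {(g, b). g * b dvd q * f})"
    then obtain f g b where x: "x = (f, (g, b))" and fl: "f dvd l" and gb: "g * b dvd q * f" by auto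
    obtain e where e: "l = f * e" using fl by (auto elim: dvdE)
    obtain d where d: "q * f = g * b * d" using gb by (auto elim: dvdE)
    have p: "e > 0" "f > 0" using e pos by (auto intro!: gr0I)
    then have "g * b * d > 0" using d pos by (metis nat_0_less_mult_iff)
    then have p': "g > 0" "b > 0" "d > 0" by auto
    have lq: "l * q = (b * e) * (d * g)"
      using d by (simp add: e mult_ac)
    have le: "l div f = e" "l div e = f" "q * f div (g * b) = d" "l * q div (b * e) = d * g"
    proof -
      show "l div f = e" "l div e = f" using p by (simp_all add: e)
      show "q * f div (g * b) = d" using p' unfolding d by simp
      show "l * q div (b * e) = d * g" unfolding lq using p p' by simp
    qed
    show "(\<lambda>(m, (e, d)). (l div e, (l * q div m div d, m div e))) ((\<lambda>(f, (g, b)). (b * (l div f), (l div f, q * f div (g * b)))) x) = x"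
      using p p' by (simp add: x le)
    show "(\<lambda>(f, (g, b)). (b * (l div f), (l div f, q * f div (g * b)))) x \<in> (SIGMA m:{m. m dvd l * q}. {e. e dvd l \<and> e dvd m} \<times> {d. d dvd l * q div m})"
      by (simp add: x le) (simp add: lq, simp add: e)
  qed
  also have "\<dots> = (\<Sum>f | f dvd l. \<Sum>(g, b) | g * b dvd q * f. (of_nat l powr s)\<^sup>2 * of_nat q powr s * R f g b)"
    using fin3 fin4 by (subst sum.Sigma) (auto simp: case_prod_unfold)
  also have "\<dots> = (of_nat l powr s)\<^sup>2 * of_nat q powr s * dual_sum chi q l U s"
    unfolding dual_sum_def R_def by (simp add: sum_distrib_left case_prod_unfold)
  finally show ?thesis .
qed

text \<open>Divisors \<open>m\<close> outside those of \<open>l * q\<close> drop out with the first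
  Gauss sum. For the others both Gauss sums are opened by the divisor formula, which gives the
  square of the primitive Gauss sum and, in \<open>n\<close>, shifted copies of the series
  \<open>U\<close>.\<close>

lemma kloosterman_side_ds_sums:
  fixes N :: nat
  assumes prim: "primitive_dirichlet_character c chi" and pos: "q > 0" "l > 0" and cop: "coprime (q * l) N"
    and U: "\<And>x y. x > 0 \<Longrightarrow> y > 0 \<Longrightarrow> coprime x N \<Longrightarrow> ds_sums (\<lambda>n. B x (n * y) * chi (int n)) (1 - s) (U x y)"
  shows "ds_sums (\<lambda>n. \<Sum>m | m dvd c * l * q. (of_nat m powr s)\<^sup>2 / of_nat m * B m n *
        unit_gauss_sum (\<lambda>x. cnj (chi x)) (c * l) (int m) * unit_gauss_sum (\<lambda>x. cnj (chi x)) (c * l * q div m) (int n)) (1 - s)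
     ((gauss_sum c (\<lambda>x. cnj (chi x)))\<^sup>2 * ((of_nat l powr s)\<^sup>2 * of_nat q powr s * dual_sum chi q l U s))"
proof -
  note dc = primitive_imp_dc[OF prim]
  have c0: "c > 0" using dc_pos[OF dc] .
  define chi' where "chi' = (\<lambda>x. cnj (chi x))"
  have prim': "primitive_dirichlet_character c chi'" unfolding chi'_def by (rule primitive_cnj[OF prim])
  define \<tau> where "\<tau> = gauss_sum c chi'"
  define K where "K m = (of_nat m powr s)\<^sup>2 / of_nat m * unit_gauss_sum chi' (c * l) (int m)" for m
  define R where "R m d = of_nat d * cnj (chi (int (l * q div m div d))) * moebius_mu (l * q div m div d)" for m d
  have red: "(\<Sum>m | m dvd c * l * q. (of_nat m powr s)\<^sup>2 / of_nat m * B m n *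
        unit_gauss_sum chi' (c * l) (int m) * unit_gauss_sum chi' (c * l * q div m) (int n))
      = (\<Sum>m | m dvd l * q. K m * (\<tau> * (\<Sum>d | d dvd l * q div m. R m d * (if d dvd n then B m (n div d * d) * chi (int (n div d)) else 0))))" for n
  proof (rule sum.mono_neutral_cong_right)
    show "finite {m. m dvd c * l * q}" using pos c0 by simp
    show "{m. m dvd l * q} \<subseteq> {m. m dvd c * l * q}" by (auto simp: mult.assoc)
    show "\<forall>m\<in>{m. m dvd c * l * q} - {m. m dvd l * q}. (of_nat m powr s)\<^sup>2 / of_nat m * B m n *
        unit_gauss_sum chi' (c * l) (int m) * unit_gauss_sum chi' (c * l * q div m) (int n) = 0"
      using unit_gauss_sum_nonzero_imp_dvd[OF prim' pos(2,1)] by auto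
    fix m assume "m \<in> {m. m dvd l * q}"
    then have m: "m dvd l * q" by simp
    define r where "r = l * q div m"
    have r: "r > 0" using m pos unfolding r_def by (metis dvd_div_eq_0_iff gr0I mult_is_0 less_irrefl)
    have cr: "c * l * q div m = c * r" using m by (simp add: r_def div_mult_swap mult.assoc)
    have eq: "B m n * (\<Sum>d | d dvd r \<and> int d dvd int n. of_nat d * cnj (chi' (int n div int d)) * chi' (int (r div d)) * moebius_mu (r div d))
       = (\<Sum>d | d dvd r. R m d * (if d dvd n then B m (n div d * d) * chi (int (n div d)) else 0))"
      unfolding sum_distrib_left
      by (rule sum.mono_neutral_cong_left)
         (use r in \<open>auto simp: R_def chi'_def r_def [symmetric] zdiv_int\<close>)
    show "(of_nat m powr s)\<^sup>2 / of_nat m * B m n *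
        unit_gauss_sum chi' (c * l) (int m) * unit_gauss_sum chi' (c * l * q div m) (int n)
      = K m * (\<tau> * (\<Sum>d | d dvd l * q div m. R m d * (if d dvd n then B m (n div d * d) * chi (int (n div d)) else 0)))"
      unfolding cr unit_gauss_sum_formula[OF prim' r] K_def r_def [symmetric] \<tau>_def [symmetric] eq [symmetric]
      by (simp only: mult_ac)
  qed
  have "ds_sums (\<lambda>n. \<Sum>m | m dvd l * q. K m * (\<tau> * (\<Sum>d | d dvd l * q div m. R m d * (if d dvd n then B m (n div d * d) * chi (int (n div d)) else 0)))) (1 - s)
     (\<Sum>m | m dvd l * q. K m * (\<tau> * (\<Sum>d | d dvd l * q div m. R m d * (U m d / of_nat d powr (1 - s)))))"
  proof (intro ds_sums_sum ds_sums_cmult)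
    fix m d assume m: "m \<in> {m. m dvd l * q}" and d: "d \<in> {d. d dvd l * q div m}"
    have m0: "m > 0" using m pos by (auto intro!: gr0I)
    have "l * q div m > 0" using m pos by (metis dvd_div_eq_0_iff gr0I mult_is_0 less_irrefl mem_Collect_eq)
    then have d0: "d > 0" using d by (auto intro!: gr0I)
    have "coprime m N" using m cop by (metis coprime_divisors dvd_refl mem_Collect_eq mult.commute)
    then show "ds_sums (\<lambda>n. if d dvd n then B m (n div d * d) * chi (int (n div d)) else 0) (1 - s) (U m d / of_nat d powr (1 - s))"
      by (rule ds_sums_shift[OF U[OF m0 d0] d0])
  qed
  moreover have "(\<Sum>m | m dvd l * q. K m * (\<tau> * (\<Sum>d | d dvd l * q div m. R m d * (U m d / of_nat d powr (1 - s)))))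
     = \<tau>\<^sup>2 * ((of_nat l powr s)\<^sup>2 * of_nat q powr s * dual_sum chi q l U s)"
  proof -
    have "unit_gauss_sum chi' (c * l) (int m) = \<tau> *
        (\<Sum>e | e dvd l \<and> e dvd m. of_nat e * chi (int (m div e)) * cnj (chi (int (l div e))) * moebius_mu (l div e))" for m
      unfolding unit_gauss_sum_formula[OF prim' pos(2)] \<tau>_def by (simp add: chi'_def zdiv_int)
    then show ?thesis
      unfolding kloosterman_side_sum[OF dc pos, symmetric] K_def R_def sum_distrib_left [of "\<tau>\<^sup>2"]
      by (intro sum.cong refl) (simp add: power2_eq_square mult_ac)
  qed
  ultimately show ?thesis
    unfolding red chi'_def [symmetric] \<tau>_def [symmetric] by simp
qed

text \<open>For one fixed \<open>s\<close>, with \<open>L\<close>, \<open>Lt\<close> and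
  \<open>G\<close> mere numbers, the functional equation becomes an identity between sums. Both
  sides equal a multiple of \<open>dual_sum\<close>; the rest is bookkeeping of powers and of the
  Gauss sum relation.\<close>

lemma twisted_dual_identity:
  assumes \<psi>: "dirichlet_character N \<psi>" and prim: "primitive_dirichlet_character c chi"
    and pos: "q > 0" "l > 0" and cop: "coprime (q * l) N"
    and hecke: "hecke_relations N (\<lambda>x. cnj (\<psi> x)) B"
    and AB: "\<And>m n. m > 0 \<Longrightarrow> n > 0 \<Longrightarrow> coprime (m * n) N \<Longrightarrow> A m n = \<psi> (int m) * \<psi> (int n) * B n m"
    and growth: "poly_growth (B 1) k" and s: "Re (1 - s) > real k + 1"
    and Lt: "ds_sums (\<lambda>n. B 1 n * chi (int n)) (1 - s) Lt"
    and L: "L = G * \<psi> (int c) * cnj (chi (int N)) * of_nat c powr (- 3 * s) * gauss_sum c (\<lambda>x. cnj (chi x)) ^ 3 * Lt"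
  obtains S where
    "ds_sums (\<lambda>n. \<Sum>m | m dvd c * l * q. (of_nat m powr s)\<^sup>2 / of_nat m * B m n *
        unit_gauss_sum (\<lambda>x. cnj (chi x)) (c * l) (int m) * unit_gauss_sum (\<lambda>x. cnj (chi x)) (c * l * q div m) (int n)) (1 - s) S"
    "gauss_sum c chi * (\<Sum>(d, f, g)\<in>twist_index q l. twist_coeff \<psi> chi A q l (d, f, g) / of_nat (d * f * g) powr s) * L
      = chi (- 1) * G * cnj (chi (int N)) * of_nat (c * l) * \<psi> (int (c * l * q)) * S / ((of_nat (c * l) powr s) ^ 3 * of_nat q powr s)"
proof -
  note dc = primitive_imp_dc[OF prim]
  have c0: "c > 0" using dc_pos[OF dc] .
  \<comment> \<open>Meaningful at admissible \<open>x\<close> and \<open>y\<close>, where polynomial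
    growth of row \<open>x\<close> guarantees convergence at \<open>1 - s\<close>.\<close>
  define U where "U x y = (SOME S. ds_sums (\<lambda>n. B x (n * y) * chi (int n)) (1 - s) S)" for x y
  have U: "ds_sums (\<lambda>n. B x (n * y) * chi (int n)) (1 - s) (U x y)" if xy: "x > 0" "y > 0" "coprime x N" for x y
  proof -
    have "poly_growth (\<lambda>n. B x (n * y)) k"
      by (intro poly_growth_dilate hecke_growth[OF hecke dc_cnj[OF \<psi>] growth] xy)
    then have "poly_growth (\<lambda>n. B x (n * y) * chi (int n)) k"
      by (rule poly_growth_mono) (simp add: norm_mult mult_left_le dc_norm_le[OF dc])
    then obtain S where "ds_sums (\<lambda>n. B x (n * y) * chi (int n)) (1 - s) S"
      using poly_growth_imp_ds_sums s by blast
    then show ?thesis unfolding U_def by (rule someI)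
  qed
  define R where "R = dual_sum chi q l U s"
  define \<tau> where "\<tau> = gauss_sum c (\<lambda>x. cnj (chi x))"
  have 1: "(\<Sum>(d, f, g)\<in>twist_index q l. twist_coeff \<psi> chi A q l (d, f, g) / of_nat (d * f * g) powr s) * Lt
     = \<psi> (int (q * l)) * of_nat l powr (1 - s) * R" (is "?T * Lt = _")
    unfolding R_def
  proof (rule twist_sum_dual[OF \<psi> dc pos cop AB])
    fix x y :: nat assume xy: "x > 0" "y > 0" "coprime (y * x) N"
    show "Lt * B x y = (\<Sum>(b, e) | b dvd y \<and> e dvd x. cnj (\<psi> (int e)) * chi (int (b * e)) / of_nat (b * e) powr (1 - s) * U (b * x div e) (y div b))"
      by (rule dual_hecke_expansion[OF hecke dc xy Lt U])
  qed
  have cpow: "(of_nat c :: complex) powr (- 3 * s) = 1 / (of_nat c powr s) ^ 3"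
  proof -
    have "(of_nat c :: complex) powr (- 3 * s) = exp (- (3 * (s * Ln (of_nat c))))"
      using c0 by (simp add: powr_def mult.assoc)
    also have "\<dots> = 1 / (of_nat c powr s) ^ 3"
      using c0 by (simp add: powr_def exp_minus exp_of_nat_mult [symmetric] inverse_eq_divide)
    finally show ?thesis .
  qed
  have gg: "gauss_sum c chi * \<tau> = chi (- 1) * of_nat c"
    unfolding \<tau>_def by (rule gauss_sum_mult_cnj[OF prim])
  define S where "S = \<tau>\<^sup>2 * ((of_nat l powr s)\<^sup>2 * of_nat q powr s * R)"
  have nz: "(of_nat l :: complex) powr s \<noteq> 0" "(of_nat q :: complex) powr s \<noteq> 0" "(of_nat c :: complex) powr s \<noteq> 0"
    using pos c0 by simp_all
  define T where "T = ?T"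
  \<comment> \<open>The surplus \<open>(of_nat l powr s)\<^sup>2 * of_nat q powr s\<close> in
    \<open>S\<close> converts the denominator belonging to the full modulus \<open>c * l\<close>
    into that of the conductor with a single power of \<open>l\<close>.\<close>
  have alg: "(of_nat l powr s)\<^sup>2 * of_nat q powr s / ((of_nat c powr s * of_nat l powr s) ^ 3 * of_nat q powr s)
      = 1 / ((of_nat c powr s) ^ 3 * (of_nat l powr s :: complex))"
    using nz by (simp add: power_mult_distrib power2_eq_square power3_eq_cube)
  have \<psi>clq: "\<psi> (int (c * l * q)) = \<psi> (int c) * \<psi> (int (q * l))"
    by (simp add: dc_mult[OF \<psi>] mult_ac)
  have "gauss_sum c chi * T * L
     = (gauss_sum c chi * \<tau>) * \<tau>\<^sup>2 * G * \<psi> (int c) * cnj (chi (int N)) * of_nat c powr (- 3 * s) * (T * Lt)"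
    unfolding L \<tau>_def [symmetric] by (simp add: power2_eq_square power3_eq_cube mult_ac)
  also have "\<dots> = chi (- 1) * of_nat c * \<tau>\<^sup>2 * G * \<psi> (int c) * cnj (chi (int N)) / (of_nat c powr s) ^ 3 *
      (\<psi> (int (q * l)) * (of_nat l / of_nat l powr s) * R)"
    unfolding 1 [folded T_def] gg cpow of_nat_powr_one_minus[OF pos(2)] by simp
  also have "\<dots> = chi (- 1) * G * cnj (chi (int N)) * of_nat (c * l) * \<psi> (int (c * l * q)) * S / ((of_nat (c * l) powr s) ^ 3 * of_nat q powr s)"
  proof -
    have "chi (- 1) * G * cnj (chi (int N)) * of_nat (c * l) * \<psi> (int (c * l * q)) * S / ((of_nat (c * l) powr s) ^ 3 * of_nat q powr s)
      = chi (- 1) * G * cnj (chi (int N)) * of_nat (c * l) * (\<psi> (int c) * \<psi> (int (q * l))) * \<tau>\<^sup>2 * R *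
        ((of_nat l powr s)\<^sup>2 * of_nat q powr s / ((of_nat c powr s * of_nat l powr s) ^ 3 * of_nat q powr s))"
      unfolding S_def of_nat_powr_mult \<psi>clq by (simp add: mult_ac)
    then show ?thesis unfolding alg by (simp add: mult_ac)
  qed
  finally have 2: "gauss_sum c chi * T * L
     = chi (- 1) * G * cnj (chi (int N)) * of_nat (c * l) * \<psi> (int (c * l * q)) * S / ((of_nat (c * l) powr s) ^ 3 * of_nat q powr s)" .
  show ?thesis
  proof (rule that[OF _ 2 [unfolded T_def]])
    show "ds_sums (\<lambda>n. \<Sum>m | m dvd c * l * q. (of_nat m powr s)\<^sup>2 / of_nat m * B m n *
        unit_gauss_sum (\<lambda>x. cnj (chi x)) (c * l) (int m) * unit_gauss_sum (\<lambda>x. cnj (chi x)) (c * l * q div m) (int n)) (1 - s) S"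
      unfolding S_def R_def \<tau>_def by (rule kloosterman_side_ds_sums[OF prim pos cop U])
  qed
qed

section \<open>Recovering single residues from averages over characters\<close>

lemma delta_average:
  assumes c: "c > 0" and X: "\<And>i. i < n \<Longrightarrow> dirichlet_character c (X i)"
    and delta: "\<And>u. coprime u (int c) \<Longrightarrow> (\<Sum>i<n. \<alpha> i * X i u) = (if [u = 1] (mod int c) then 1 else 0)"
    and a: "[a * abar = 1] (mod int c)"
  shows "(\<Sum>i<n. \<alpha> i * X i a * (\<Sum>v | v \<in> {0..<int c} \<and> coprime v (int c). X i v * F v)) = F (abar mod int c)"
proof -
  define V where "V = {v. v \<in> {0..<int c} \<and> coprime v (int c)}"
  have finV: "finite V" unfolding V_def by (rule finite_subset[of _ "{0..<int c}"]) auto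
  have copa: "coprime a (int c)" "coprime abar (int c)"
    using a by (metis cong_imp_coprime cong_sym coprime_1_left coprime_mult_left_iff)+
  have "(\<Sum>i<n. \<alpha> i * X i a * (\<Sum>v\<in>V. X i v * F v)) = (\<Sum>i<n. \<Sum>v\<in>V. \<alpha> i * X i (a * v) * F v)"
    unfolding sum_distrib_left
    by (intro sum.cong refl) (auto simp: dc_mult[OF X])
  also have "\<dots> = (\<Sum>v\<in>V. (\<Sum>i<n. \<alpha> i * X i (a * v)) * F v)"
    by (subst sum.swap) (simp add: sum_distrib_right)
  \<comment> \<open>The combination detects \<open>a * v = 1\<close>, and within the residue system
    this singles out the inverse of \<open>a\<close>.\<close>
  also have "\<dots> = (\<Sum>v\<in>V. if v = abar mod int c then F v else 0)"
  proof (intro sum.cong refl)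
    fix v assume v: "v \<in> V"
    have "[a * v = 1] (mod int c) \<longleftrightarrow> [a * v = a * abar] (mod int c)"
      using a by (meson cong_sym cong_trans)
    also have "\<dots> \<longleftrightarrow> [v = abar] (mod int c)"
      using copa(1) by (rule cong_mult_lcancel)
    also have "\<dots> \<longleftrightarrow> v = abar mod int c"
      using v by (auto simp: cong_def V_def)
    finally show "(\<Sum>i<n. \<alpha> i * X i (a * v)) * F v = (if v = abar mod int c then F v else 0)"
      using v copa by (subst delta) (auto simp: V_def)
  qed
  also have "\<dots> = F (abar mod int c)"
    using finV c copa(2) by (simp add: V_def)
  finally show ?thesis by (simp add: V_def)
qed

lemma kloosterman_sum_cong:
  assumes "[u = u'] (mod int C)" "C > 0"
  shows "kloosterman_sum u v C = kloosterman_sum u' v C"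
  unfolding kloosterman_sum_def
  by (rule sum.cong[OF refl], rule additive_char_cong[OF _ assms(2)], rule cong_add[OF _ cong_refl],
      rule cong_scalar_right[OF assms(1)])

lemma primitive_trivial: "primitive_dirichlet_character 1 (\<lambda>_. 1)"
  unfolding primitive_dirichlet_character_def
proof (intro conjI notI)
  show "dirichlet_character 1 (\<lambda>_. 1)" by (simp add: dirichlet_character_def)
  assume "\<exists>d chi'. d dvd 1 \<and> d < 1 \<and> dirichlet_character d chi' \<and> (\<forall>x. coprime x (int 1) \<longrightarrow> 1 = chi' x)"
  then show False
    by (elim exE conjE) simp
qed

text \<open>Conjugating a character inverts its argument, and a unit is 1 exactly when its inverse
  is.\<close>

lemma delta_decomposition_cnj:
  assumes X: "\<And>i. i < n \<Longrightarrow> dirichlet_character c (X i)"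
    and delta: "\<And>u. coprime u (int c) \<Longrightarrow> (\<Sum>i<n. \<alpha> i * X i u) = (if [u = 1] (mod int c) then 1 else 0)"
    and u: "coprime u (int c)"
  shows "(\<Sum>i<n. \<alpha> i * cnj (X i u)) = (if [u = 1] (mod int c) then 1 else 0)"
proof -
  obtain w where w: "[u * w = 1] (mod int c)" using u cong_solve_coprime_int by blast
  have cw: "coprime w (int c)"
    using w by (metis cong_imp_coprime cong_sym coprime_1_left coprime_mult_left_iff)
  have "(\<Sum>i<n. \<alpha> i * cnj (X i u)) = (\<Sum>i<n. \<alpha> i * X i w)"
    by (intro sum.cong refl) (simp add: dc_cnj_eqI[OF X w])
  also have "\<dots> = (if [w = 1] (mod int c) then 1 else 0)" by (rule delta[OF cw])
  also have "[w = 1] (mod int c) \<longleftrightarrow> [u * w = u * 1] (mod int c)"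
    by (rule cong_mult_lcancel[OF u, symmetric])
  also have "\<dots> \<longleftrightarrow> [u = 1] (mod int c)"
    using w by (metis cong_sym cong_trans mult.right_neutral)
  finally show ?thesis .
qed

lemma powr_ratio:
  assumes "m > 0" "n > 0" "c > 0" "q > 0"
  shows "complex_of_real (real (m\<^sup>2 * n) / real (c ^ 3 * q)) powr s =
    (of_nat m powr s)\<^sup>2 * of_nat n powr s / ((of_nat c powr s) ^ 3 * of_nat q powr s)"
proof -
  define x where "x = real (m\<^sup>2 * n) / real (c ^ 3 * q)"
  have x: "x \<ge> 0" by (simp add: x_def)
  have "(of_nat (m\<^sup>2 * n) :: complex) = complex_of_real x * of_nat (c ^ 3 * q)"
  proof -
    have "real (m\<^sup>2 * n) = x * real (c ^ 3 * q)" using assms by (simp add: x_def)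
    then show ?thesis by (metis of_real_mult of_real_of_nat_eq)
  qed
  then have "(of_nat (m\<^sup>2 * n) :: complex) powr s = complex_of_real x powr s * of_nat (c ^ 3 * q) powr s"
    using x by (simp only: powr_times_real [of "complex_of_real x" "of_nat (c ^ 3 * q)"] Reals_of_real Reals_of_nat Re_complex_of_real complex_Re_of_nat of_nat_0_le_iff)
  then have "complex_of_real x powr s = of_nat (m\<^sup>2 * n) powr s / (of_nat (c ^ 3 * q) powr s)"
    using assms by simp
  then show ?thesis
    unfolding x_def power2_eq_square power3_eq_cube of_nat_powr_mult by simp
qed

text \<open>Each average over the units is evaluated by \<open>kloosterman_average\<close> through
  the primitive character behind \<open>X i\<close>, at the same modulus
  \<open>c = D i * l i\<close> for every \<open>i\<close>.\<close>

lemma kloosterman_expansion: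
  assumes X: "\<And>i. i < n \<Longrightarrow> dirichlet_character c (X i)"
    and delta: "\<And>u. coprime u (int c) \<Longrightarrow> (\<Sum>i<n. \<alpha> i * X i u) = (if [u = 1] (mod int c) then 1 else 0)"
    and c: "c > 0" and q: "q > 0" and a: "[a * abar = 1] (mod int c)" and t: "coprime t (int c)"
    and prim: "\<And>i. i < n \<Longrightarrow> primitive_dirichlet_character (D i) (Ch i)"
    and l: "\<And>i. i < n \<Longrightarrow> D i * l i = c"
    and XCh: "\<And>i x. i < n \<Longrightarrow> coprime x (int c) \<Longrightarrow> X i x = Ch i x"
    and m: "m dvd c * q"
  shows "kloosterman_sum (t * int q * a) v (c * q div m) =
    (\<Sum>i<n. \<alpha> i * Ch i a * Ch i t * unit_gauss_sum (\<lambda>x. cnj (Ch i x)) c (int m) * unit_gauss_sum (\<lambda>x. cnj (Ch i x)) (c * q div m) v)"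
proof -
  have copa: "coprime a (int c)" "coprime abar (int c)"
    using a by (metis cong_imp_coprime cong_sym coprime_1_left coprime_mult_left_iff)+
  have C0: "c * q div m > 0" using m c q by (metis dvd_div_eq_0_iff gr0I mult_is_0 less_irrefl)
  have Cdvd: "c * q div m dvd c * q" using m by (metis dvd_div_mult_self dvd_triv_left)
  define F where "F u = kloosterman_sum (t * int q * u) v (c * q div m)" for u
  \<comment> \<open>The conjugate characters are used, with \<open>a\<close> and \<open>abar\<close>
    exchanged: the Gauss sums must belong to \<open>cnj (Ch i)\<close>, as in the functional
    equation, while the weight stays \<alpha> times \<open>Ch i a\<close>.\<close>
  have "F (a mod int c) = (\<Sum>i<n. \<alpha> i * cnj (X i abar) * (\<Sum>u | u \<in> {0..<int c} \<and> coprime u (int c). cnj (X i u) * F u))"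
  proof (rule delta_average[symmetric, OF c, of n "\<lambda>i u. cnj (X i u)"])
    show "dirichlet_character c (\<lambda>u. cnj (X i u))" if "i < n" for i by (rule dc_cnj[OF X[OF that]])
    show "(\<Sum>i<n. \<alpha> i * cnj (X i u)) = (if [u = 1] (mod int c) then 1 else 0)" if "coprime u (int c)" for u
      by (rule delta_decomposition_cnj[OF X delta that])
    show "[abar * a = 1] (mod int c)" using a by (simp add: mult.commute)
  qed
  also have "\<dots> = (\<Sum>i<n. \<alpha> i * Ch i a * Ch i t * unit_gauss_sum (\<lambda>x. cnj (Ch i x)) c (int m) * unit_gauss_sum (\<lambda>x. cnj (Ch i x)) (c * q div m) v)"
  proof (intro sum.cong refl)
    fix i assume "i \<in> {..<n}"
    then have i: "i < n" by simp
    have l0: "l i > 0" using l[OF i] c by (metis gr0I mult_0_right less_irrefl)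
    have "cnj (X i abar) = X i a"
      using a by (intro dc_cnj_eqI[OF X[OF i]]) (simp add: mult.commute)
    then have 1: "cnj (X i abar) = Ch i a" using XCh[OF i copa(1)] by simp
    have "(\<Sum>u | u \<in> {0..<int c} \<and> coprime u (int c). cnj (X i u) * F u)
       = (\<Sum>u | u \<in> {0..<int (D i * l i)} \<and> coprime u (int (D i * l i)). cnj (Ch i u) * kloosterman_sum (t * int q * u) v (D i * l i * q div m))"
      unfolding l[OF i] by (intro sum.cong refl) (auto simp: F_def XCh[OF i])
    also have "\<dots> = cnj (cnj (Ch i t)) * unit_gauss_sum (\<lambda>x. cnj (Ch i x)) (D i * l i) (int m) * unit_gauss_sum (\<lambda>x. cnj (Ch i x)) (D i * l i * q div m) v"
      by (rule kloosterman_average[OF primitive_cnj[OF prim[OF i]] l0 q]) (use m t in \<open>simp_all add: l[OF i] del: of_nat_mult\<close>)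
    finally show "\<alpha> i * cnj (X i abar) * (\<Sum>u | u \<in> {0..<int c} \<and> coprime u (int c). cnj (X i u) * F u)
       = \<alpha> i * Ch i a * Ch i t * unit_gauss_sum (\<lambda>x. cnj (Ch i x)) c (int m) * unit_gauss_sum (\<lambda>x. cnj (Ch i x)) (c * q div m) v"
      unfolding 1 l[OF i] by (simp add: mult.assoc)
  qed
  also have "F (a mod int c) = kloosterman_sum (t * int q * a) v (c * q div m)"
    unfolding F_def
  proof (rule kloosterman_sum_cong[OF _ C0])
    \<comment> \<open>The factor \<open>q\<close> lifts the congruence from \<open>c\<close> to
      \<open>c * q\<close>, of which the modulus of the Kloosterman sum is a divisor.\<close>
    have "[int q * (a mod int c) = int q * a] (mod int (c * q))"
    proof -
      have "[a mod int c = a] (mod int c)" by (simp add: cong_def)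
      then have "int c dvd a mod int c - a" by (simp add: cong_iff_dvd_diff)
      then have "int q * int c dvd int q * (a mod int c - a)" by (rule mult_dvd_mono[OF dvd_refl])
      then show ?thesis by (simp add: cong_iff_dvd_diff algebra_simps)
    qed
    then have "[int q * (a mod int c) = int q * a] (mod int (c * q div m))"
      using Cdvd by (meson cong_dvd_modulus int_dvd_int_iff)
    then show "[t * int q * (a mod int c) = t * int q * a] (mod int (c * q div m))"
      unfolding mult.assoc by (rule cong_scalar_left)
  qed
  finally show ?thesis .
qed

section \<open>The Voronoi summation formula\<close>

theorem theorem4p1:
  fixes N c q :: nat
    and \<psi> :: "int \<Rightarrow> complex"
    and A_F A_Ft :: "nat \<Rightarrow> nat \<Rightarrow> complex"
    and Gp Gm :: "complex \<Rightarrow> complex"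
    and P :: "complex set"
    and a abar Nbar :: int
  assumes "N \<ge> 1"
    and "dirichlet_character N \<psi>"
    and "\<And>m n. m > 0 \<Longrightarrow> n > 0 \<Longrightarrow> coprime (m * n) N \<Longrightarrow>
           A_F m n = \<psi> (int m) * \<psi> (int n) * A_Ft n m"
    and "hecke_relations N \<psi> A_F"
    and "hecke_relations N (\<lambda>x. cnj (\<psi> x)) A_Ft"
    and "P sparse_in UNIV"
    and "twisted_functional_equations N \<psi> P Gp Gm A_F A_Ft"
    and "c > 0" and "q > 0" and "coprime c N" and "coprime q N"
    and "coprime a (int c)"
    and "[a * abar = 1] (mod int c)"
    and "[int N * Nbar = 1] (mod int c)"
  shows "\<exists>\<Phi>.
     dirichlet_series_continuation
       (\<lambda>n. A_F q n * additive_char (real_of_int (abar * int n) / real c)) \<Phi> \<and>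
     (\<exists>\<sigma>::real. \<forall>s. - Re s > \<sigma> \<longrightarrow>
        (\<forall>\<epsilon>\<in>{1, -1}. summable (\<lambda>k. dual_term A_Ft c q a Nbar \<epsilon> s (Suc k))) \<and>
        (s \<notin> P \<longrightarrow>
           \<Phi> s = of_nat c * \<psi> (int (c * q)) *
             (\<Sum>\<epsilon>\<in>{1, -1}. \<Sum>k.
                (Gp s - of_int \<epsilon> * Gm s) / 2 * dual_term A_Ft c q a Nbar \<epsilon> s (Suc k))))"
proof -
  note \<psi> = assms(2) and AB = assms(3) and heckeF = assms(4) and heckeFt = assms(5)
    and tfe = assms(7) and c = assms(8) and q = assms(9) and a = assms(13) and Nb = assms(14)
  have copa: "coprime a (int c)" "coprime abar (int c)"
    using a by (metis cong_imp_coprime cong_sym coprime_1_left coprime_mult_left_iff)+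
  have copNbar: "coprime Nbar (int c)"
    using Nb by (metis cong_imp_coprime cong_sym coprime_1_left coprime_mult_left_iff)
  obtain n :: nat and \<alpha> X where X: "\<And>i. i < n \<Longrightarrow> dirichlet_character c (X i)"
    and delta: "\<And>u. coprime u (int c) \<Longrightarrow> (\<Sum>i<n. \<alpha> i * X i u) = (if [u = 1] (mod int c) then 1 else 0)"
    by (rule unit_delta_decomposition[OF c], rule that)
  have "\<exists>d chi. d dvd c \<and> primitive_dirichlet_character d chi \<and> (\<forall>x. coprime x (int c) \<longrightarrow> X i x = chi x)"
    if "i < n" for i
    by (rule ex_inducing_primitive[OF X[OF that]]) blast
  then obtain D Ch where D: "\<And>i. i < n \<Longrightarrow> D i dvd c"
    and prim: "\<And>i. i < n \<Longrightarrow> primitive_dirichlet_character (D i) (Ch i)"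
    and XCh: "\<And>i x. i < n \<Longrightarrow> coprime x (int c) \<Longrightarrow> X i x = Ch i x"
    by metis
  define l where "l i = c div D i" for i
  have l: "D i * l i = c" and l0: "l i > 0" and copD: "coprime (D i) N" and copl: "coprime (q * l i) N"
    if "i < n" for i
  proof -
    show 1: "D i * l i = c" using D[OF that] by (simp add: l_def)
    then show "l i > 0" using c by (metis gr0I mult_0_right less_irrefl)
    show "coprime (D i) N" "coprime (q * l i) N"
      using assms(10,11) by (simp_all add: 1 [symmetric])
  qed
  note dcCh = primitive_imp_dc[OF prim]

  \<comment> \<open>The functional equation is taken for the conjugate of \<open>Ch i\<close>: the
    Gauss weight formed with \<open>Ch i\<close> produces the L-function twisted by
    \<open>cnj (Ch i)\<close>. Conjugation does not change the parity.\<close>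
  define R where "R i L Lt \<longleftrightarrow> dirichlet_series_continuation (\<lambda>n. A_F 1 n * cnj (Ch i (int n))) L \<and>
      dirichlet_series_continuation (\<lambda>n. A_Ft 1 n * Ch i (int n)) Lt \<and>
      (\<forall>s. s \<notin> P \<longrightarrow> L s = (if Ch i (- 1) = 1 then Gp s else Gm s) * \<psi> (int (D i)) * cnj (Ch i (int N)) *
          of_nat (D i) powr (- 3 * s) * gauss_sum (D i) (\<lambda>x. cnj (Ch i x)) ^ 3 * Lt (1 - s))" for i L Lt
  have "\<exists>L Lt. R i L Lt" if i: "i < n" for i
  proof -
    have "cnj (Ch i (- 1)) = 1 \<longleftrightarrow> Ch i (- 1) = 1" by (metis complex_cnj_cnj complex_cnj_one)
    then show ?thesis
      using tfe[unfolded twisted_functional_equations_def, rule_format, OF primitive_cnj[OF prim[OF i]] copD[OF i]]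
      by (simp only: complex_cnj_cnj R_def)
  qed
  then obtain L Lt where "\<And>i. i < n \<Longrightarrow> R i (L i) (Lt i)"
    by metis
  then have
    L: "\<And>i. i < n \<Longrightarrow> dirichlet_series_continuation (\<lambda>n. A_F 1 n * cnj (Ch i (int n))) (L i)"
    and Lt: "\<And>i. i < n \<Longrightarrow> dirichlet_series_continuation (\<lambda>n. A_Ft 1 n * Ch i (int n)) (Lt i)"
    and FE: "\<And>i s. i < n \<Longrightarrow> s \<notin> P \<Longrightarrow> L i s = (if Ch i (- 1) = 1 then Gp s else Gm s) * \<psi> (int (D i)) * cnj (Ch i (int N)) *
          of_nat (D i) powr (- 3 * s) * gauss_sum (D i) (\<lambda>x. cnj (Ch i x)) ^ 3 * Lt i (1 - s)"
    unfolding R_def by blast+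

  \<comment> \<open>The trivial character of conductor 1 supplies a bound for the untwisted
    coefficients, and hence one for every twist.\<close>
  obtain k where growth: "poly_growth (A_Ft 1) k"
  proof -
    obtain Lt0 where "dirichlet_series_continuation (\<lambda>n. A_Ft 1 n * cnj 1) Lt0"
      using tfe[unfolded twisted_functional_equations_def, rule_format, OF primitive_trivial coprime_1_left]
      by (elim exE conjE, intro that)
    then have "dirichlet_series_continuation (A_Ft 1) Lt0" by simp
    then show ?thesis
      by (rule dirichlet_series_continuation_growth, intro that)
  qed
  define H where "H i \<sigma> \<longleftrightarrow> (\<forall>w. Re w > \<sigma> \<longrightarrow> ds_sums (\<lambda>n. A_Ft 1 n * Ch i (int n)) w (Lt i w))" for i \<sigma>
  have "\<exists>\<sigma>. H i \<sigma>" if i: "i < n" for i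
  proof -
    obtain K where K: "poly_growth (\<lambda>n. A_Ft 1 n * Ch i (int n)) K"
      using dirichlet_series_continuation_growth[OF Lt[OF i]] .
    show ?thesis using Lt[OF i] unfolding dirichlet_series_continuation_iff[OF K] H_def by (rule conjunct2)
  qed
  then obtain \<sigma>' :: "nat \<Rightarrow> real" where "\<And>i. i < n \<Longrightarrow> H i (\<sigma>' i)"
    by metis
  then have \<sigma>': "\<And>i w. i < n \<Longrightarrow> Re w > \<sigma>' i \<Longrightarrow> ds_sums (\<lambda>n. A_Ft 1 n * Ch i (int n)) w (Lt i w)"
    unfolding H_def by blast
  \<comment> \<open>Beyond this bound all rows of the dual coefficients converge absolutely at
    \<open>1 - s\<close>, and each \<open>Lt i (1 - s)\<close> is the sum of its series.\<close>
  define \<sigma> where "\<sigma> = Max (insert (real k + 1) (\<sigma>' ` {..<n}))"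

  define T where "T i s = (\<Sum>(d, f, g)\<in>twist_index q (l i). twist_coeff \<psi> (Ch i) A_F q (l i) (d, f, g) / of_nat (d * f * g) powr s)" for i s
  \<comment> \<open>The weights are those of \<open>delta_average\<close>: combined with them, the
    unit Gauss sums of the \<open>Ch i\<close> at \<open>m\<close> reassemble the additive character
    at \<open>abar * m / c\<close>.\<close>
  define \<Phi> where "\<Phi> s = (\<Sum>i<n. \<alpha> i * Ch i a * (gauss_sum (D i) (Ch i) * T i s * L i s))" for s

  have "dirichlet_series_continuation (\<lambda>m. A_F q m * additive_char (real_of_int (abar * int m) / real c)) \<Phi>"
  proof -
    have "dirichlet_series_continuation (\<lambda>m. \<Sum>i<n. \<alpha> i * Ch i a * (A_F q m * unit_gauss_sum (Ch i) (D i * l i) (int m))) \<Phi>"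
      unfolding \<Phi>_def T_def
      by (intro dirichlet_series_continuation_sum twisted_continuation[OF heckeF \<psi> prim q l0 copl L])
    moreover have "(\<Sum>i<n. \<alpha> i * Ch i a * (A_F q m * unit_gauss_sum (Ch i) (D i * l i) (int m)))
       = A_F q m * additive_char (real_of_int (abar * int m) / real c)" for m
    proof -
      have "(\<Sum>i<n. \<alpha> i * Ch i a * (A_F q m * unit_gauss_sum (Ch i) (D i * l i) (int m)))
         = A_F q m * (\<Sum>i<n. \<alpha> i * X i a * (\<Sum>v | v \<in> {0..<int c} \<and> coprime v (int c). X i v * additive_char (real_of_int (v * int m) / real c)))"
        unfolding sum_distrib_left [of "A_F q m"]
      proof (intro sum.cong refl)
        fix i assume "i \<in> {..<n}"
        then have i: "i < n" by simp
        have "unit_gauss_sum (Ch i) (D i * l i) (int m) = (\<Sum>v | v \<in> {0..<int c} \<and> coprime v (int c). X i v * additive_char (real_of_int (v * int m) / real c))"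
          unfolding l[OF i] unit_gauss_sum_def by (intro sum.cong refl) (auto simp: XCh[OF i])
        then show "\<alpha> i * Ch i a * (A_F q m * unit_gauss_sum (Ch i) (D i * l i) (int m))
          = A_F q m * (\<alpha> i * X i a * (\<Sum>v | v \<in> {0..<int c} \<and> coprime v (int c). X i v * additive_char (real_of_int (v * int m) / real c)))"
          using XCh[OF i copa(1)] by (simp add: mult_ac)
      qed
      also have "\<dots> = A_F q m * additive_char (real_of_int (abar mod int c * int m) / real c)"
        by (subst delta_average[OF c X delta a]) auto
      also have "additive_char (real_of_int (abar mod int c * int m) / real c) = additive_char (real_of_int (abar * int m) / real c)"
        by (rule additive_char_cong[OF _ c]) (simp add: cong_def mod_simps)
      finally show ?thesis .
    qed
    ultimately show ?thesis by simp
  qed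
  moreover have "(\<forall>\<epsilon>\<in>{1, -1}. summable (\<lambda>k. dual_term A_Ft c q a Nbar \<epsilon> s (Suc k))) \<and>
        (s \<notin> P \<longrightarrow>
           \<Phi> s = of_nat c * \<psi> (int (c * q)) *
             (\<Sum>\<epsilon>\<in>{1, -1}. \<Sum>k. (Gp s - of_int \<epsilon> * Gm s) / 2 * dual_term A_Ft c q a Nbar \<epsilon> s (Suc k)))"
    if s: "- Re s > \<sigma>" for s
  proof -
    have s1: "Re (1 - s) > real k + 1" and s2: "\<And>i. i < n \<Longrightarrow> Re (1 - s) > \<sigma>' i"
    proof -
      have "real k + 1 \<le> \<sigma>" unfolding \<sigma>_def by (intro Max_ge) auto
      then show "Re (1 - s) > real k + 1" using s by simp
      fix i assume "i < n"
      then have "\<sigma>' i \<le> \<sigma>" unfolding \<sigma>_def by (intro Max_ge) auto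
      then show "Re (1 - s) > \<sigma>' i" using s by simp
    qed
    define G where "G i = (if Ch i (- 1) = 1 then Gp s else Gm s)" for i
    \<comment> \<open>The right-hand side of the functional equation, kept apart from
      \<open>L i s\<close> because the two are known to agree only off \<open>P\<close>, while
      summability of the dual series is claimed on the whole half-plane.\<close>
    define Lr where "Lr i = G i * \<psi> (int (D i)) * cnj (Ch i (int N)) * of_nat (D i) powr (- 3 * s) * gauss_sum (D i) (\<lambda>x. cnj (Ch i x)) ^ 3 * Lt i (1 - s)" for i
    define W where "W = (of_nat c powr s) ^ 3 * (of_nat q powr s :: complex)"
    define Z where "Z i m1 = (\<Sum>m | m dvd c * q. (of_nat m powr s)\<^sup>2 / of_nat m * A_Ft m m1 *
        unit_gauss_sum (\<lambda>x. cnj (Ch i x)) c (int m) * unit_gauss_sum (\<lambda>x. cnj (Ch i x)) (c * q div m) (int m1))" for i m1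
    define J where "J i S \<longleftrightarrow> ds_sums (Z i) (1 - s) S \<and>
       gauss_sum (D i) (Ch i) * T i s * Lr i = Ch i (- 1) * G i * cnj (Ch i (int N)) * of_nat c * \<psi> (int (c * q)) * S / W" for i S
    have "\<exists>S. J i S" if i: "i < n" for i
      by (rule twisted_dual_identity[OF \<psi> prim[OF i] q l0[OF i] copl[OF i] heckeFt AB growth s1 \<sigma>'[OF i s2[OF i]] Lr_def])
         (assumption+, unfold l[OF i] J_def T_def Z_def W_def, intro exI conjI, assumption+)
    then obtain S where "\<And>i. i < n \<Longrightarrow> J i (S i)"
      by metis
    then have S: "\<And>i. i < n \<Longrightarrow> ds_sums (Z i) (1 - s) (S i)"
      and SL: "\<And>i. i < n \<Longrightarrow> gauss_sum (D i) (Ch i) * T i s * Lr i = Ch i (- 1) * G i * cnj (Ch i (int N)) * of_nat c * \<psi> (int (c * q)) * S i / W"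
      unfolding J_def by blast+
    \<comment> \<open>The sign enters only through \<open>Ch i\<close> at
      \<open>\<epsilon> * Nbar\<close>, so both dual series are combinations of the same sums
      \<open>S i\<close>.\<close>
    define E where "E \<epsilon> = (\<Sum>i<n. \<alpha> i * Ch i a * Ch i (\<epsilon> * Nbar) / W * S i)" for \<epsilon>
    have dual: "(\<lambda>k. dual_term A_Ft c q a Nbar \<epsilon> s (Suc k)) sums E \<epsilon>" if \<epsilon>: "\<epsilon> \<in> {1, -1}" for \<epsilon>
    proof -
      have "ds_sums (\<lambda>m. \<Sum>i<n. \<alpha> i * Ch i a * Ch i (\<epsilon> * Nbar) / W * Z i m) (1 - s) (E \<epsilon>)"
        unfolding E_def by (intro ds_sums_sum ds_sums_cmult S) simp
      then have "(\<lambda>k. (\<Sum>i<n. \<alpha> i * Ch i a * Ch i (\<epsilon> * Nbar) / W * Z i (Suc k)) / of_nat (Suc k) powr (1 - s)) sums E \<epsilon>"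
        by (rule ds_sums_imp_sums)
      moreover have "dual_term A_Ft c q a Nbar \<epsilon> s m1 = (\<Sum>i<n. \<alpha> i * Ch i a * Ch i (\<epsilon> * Nbar) / W * Z i m1) / of_nat m1 powr (1 - s)"
        if m1: "m1 > 0" for m1
      proof -
        have t: "coprime (\<epsilon> * Nbar) (int c)" using \<epsilon> copNbar by auto
        have "dual_term A_Ft c q a Nbar \<epsilon> s m1 = (\<Sum>m | m dvd c * q. \<Sum>i<n.
            \<alpha> i * Ch i a * Ch i (\<epsilon> * Nbar) / W * ((of_nat m powr s)\<^sup>2 / of_nat m * A_Ft m m1 *
        unit_gauss_sum (\<lambda>x. cnj (Ch i x)) c (int m) * unit_gauss_sum (\<lambda>x. cnj (Ch i x)) (c * q div m) (int m1)) / of_nat m1 powr (1 - s))"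
          unfolding dual_term_def
        proof (intro sum.cong refl)
          fix m assume "m \<in> {m. m dvd c * q}"
          then have m: "m dvd c * q" by simp
          then have m0: "m > 0" using c q by (auto intro!: gr0I)
          have kl: "kloosterman_sum (\<epsilon> * Nbar * int q * a) (int m1) (c * q div m) = (\<Sum>i<n. \<alpha> i * Ch i a * Ch i (\<epsilon> * Nbar) *
              unit_gauss_sum (\<lambda>x. cnj (Ch i x)) c (int m) * unit_gauss_sum (\<lambda>x. cnj (Ch i x)) (c * q div m) (int m1))"
            by (rule kloosterman_expansion[OF X delta c q a t prim l XCh m])
          show "A_Ft m m1 / (of_nat m * of_nat m1) * kloosterman_sum (\<epsilon> * Nbar * int q * a) (int m1) (c * q div m) *
              complex_of_real (real (m\<^sup>2 * m1) / real (c ^ 3 * q)) powr s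
             = (\<Sum>i<n. \<alpha> i * Ch i a * Ch i (\<epsilon> * Nbar) / W * ((of_nat m powr s)\<^sup>2 / of_nat m * A_Ft m m1 *
        unit_gauss_sum (\<lambda>x. cnj (Ch i x)) c (int m) * unit_gauss_sum (\<lambda>x. cnj (Ch i x)) (c * q div m) (int m1)) / of_nat m1 powr (1 - s))"
            unfolding powr_ratio[OF m0 m1 c q] W_def [symmetric]
              kl
              of_nat_powr_one_minus[OF m1] sum_distrib_left sum_distrib_right
            by (intro sum.cong refl) (simp add: mult_ac)
        qed
        also have "\<dots> = (\<Sum>i<n. \<alpha> i * Ch i a * Ch i (\<epsilon> * Nbar) / W * Z i m1) / of_nat m1 powr (1 - s)"
          unfolding Z_def sum_distrib_left sum_divide_distrib by (rule sum.swap)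
        finally show ?thesis .
      qed
      ultimately show ?thesis by simp
    qed
    have "\<Phi> s = of_nat c * \<psi> (int (c * q)) *
             (\<Sum>\<epsilon>\<in>{1, -1}. \<Sum>k. (Gp s - of_int \<epsilon> * Gm s) / 2 * dual_term A_Ft c q a Nbar \<epsilon> s (Suc k))" if sP: "s \<notin> P"
    proof -
      have "(\<Sum>\<epsilon>\<in>{1, -1}. \<Sum>k. (Gp s - of_int \<epsilon> * Gm s) / 2 * dual_term A_Ft c q a Nbar \<epsilon> s (Suc k))
         = (\<Sum>\<epsilon>\<in>{1, -1}. (Gp s - of_int \<epsilon> * Gm s) / 2 * E \<epsilon>)"
        by (intro sum.cong refl sums_unique [symmetric] sums_mult dual)
      also have "\<dots> = (\<Sum>i<n. \<alpha> i * Ch i a * (Ch i (- 1) * G i * cnj (Ch i (int N)) * S i / W))"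
      proof -
        have "(Gp s - Gm s) / 2 * (\<alpha> i * Ch i a * Ch i Nbar / W * S i) + (Gp s + Gm s) / 2 * (\<alpha> i * Ch i a * Ch i (- Nbar) / W * S i)
            = \<alpha> i * Ch i a * (Ch i (- 1) * G i * cnj (Ch i (int N)) * S i / W)" if i: "i < n" for i
        proof -
          have "[int N * Nbar = 1] (mod int (D i))"
            using Nb D[OF i] by (meson cong_dvd_modulus int_dvd_int_iff)
          then have 1: "cnj (Ch i (int N)) = Ch i Nbar" by (rule dc_cnj_eqI[OF dcCh[OF i]])
          have 2: "Ch i (- Nbar) = Ch i (- 1) * Ch i Nbar"
            using dc_mult[OF dcCh[OF i], of "- 1" Nbar] by simp
          \<comment> \<open>For an even character this is \<open>Gp s\<close>, for an odd one
            \<open>- Gm s\<close>; the two signs together thus reproduce the factor of the right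
            parity.\<close>
          have 3: "(Gp s - Gm s) / 2 + (Gp s + Gm s) / 2 * Ch i (- 1) = Ch i (- 1) * G i"
            using dc_minus_1[OF dcCh[OF i]] by (auto simp: G_def field_simps)
          have "(Gp s - Gm s) / 2 * (\<alpha> i * Ch i a * Ch i Nbar / W * S i) + (Gp s + Gm s) / 2 * (\<alpha> i * Ch i a * Ch i (- Nbar) / W * S i)
             = ((Gp s - Gm s) / 2 + (Gp s + Gm s) / 2 * Ch i (- 1)) * (\<alpha> i * Ch i a * Ch i Nbar / W * S i)"
          proof -
            have "\<alpha> i * Ch i a * Ch i (- Nbar) / W * S i = Ch i (- 1) * (\<alpha> i * Ch i a * Ch i Nbar / W * S i)"
              unfolding 2 by simp
            then show ?thesis by (simp only: distrib_right mult.assoc)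
          qed
          then show ?thesis unfolding 1 3 by (simp add: mult_ac)
        qed
        then show ?thesis
          by (simp add: E_def sum_distrib_left sum.distrib [symmetric])
      qed
      finally have "of_nat c * \<psi> (int (c * q)) *
             (\<Sum>\<epsilon>\<in>{1, -1}. \<Sum>k. (Gp s - of_int \<epsilon> * Gm s) / 2 * dual_term A_Ft c q a Nbar \<epsilon> s (Suc k))
         = (\<Sum>i<n. \<alpha> i * Ch i a * (Ch i (- 1) * G i * cnj (Ch i (int N)) * of_nat c * \<psi> (int (c * q)) * S i / W))"
        by (simp add: sum_distrib_left mult_ac)
      also have "\<dots> = \<Phi> s"
        unfolding \<Phi>_def
      proof (intro sum.cong refl)
        fix i assume "i \<in> {..<n}"
        then have i: "i < n" by simp
        have "L i s = Lr i" unfolding FE[OF i sP] Lr_def G_def ..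
        then show "\<alpha> i * Ch i a * (Ch i (- 1) * G i * cnj (Ch i (int N)) * of_nat c * \<psi> (int (c * q)) * S i / W)
           = \<alpha> i * Ch i a * (gauss_sum (D i) (Ch i) * T i s * L i s)"
          using SL[OF i] by simp
      qed
      finally show ?thesis ..
    qed
    then show ?thesis using dual by (auto simp: sums_iff)
  qed
  ultimately show ?thesis by blast
qed

end
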